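(* There is a universal constant $C$ such that for all $n\ge 2$, $1\le k\le n$, $m\ge 1$, every $k$-rUCG $\mathrm{LU}_{n,k}(\boldsymbol\chi)$ with $n$ control qubits, $m$ target qubits and target operator family $\mathcal U$ has a circuit decomposition with $$D_{\mathrm{CNOT}}\le \frac{C}{n}\sum_{i=0}^{k}\binom{n}{i},\qquad D_{\mathrm{CU}}\le \frac{C\log n}{n}\sum_{i=0}^{k}\binom{n}{i},$$ that is, $D_{\mathrm{CNOT}}=O\!\left(\frac1n\sum_{i=0}^k\binom ni\right)$ and $D_{\mathrm{CU}}=O\!\left(\frac{\log n}{n}\sum_{i=0}^k\binom ni\right)$, using at most $O(mn)$ ancilla qubits.
   Context: $\mathcal U$ is a subgroup of the unitary group on the $m$ target qubits that is Abelian and 2-divisible (for every $U\in\mathcal U$ there is $V\in\mathcal U$ with $V^2=U$), parametrized by a group homomorphism $U(\cdot):D_2\to\mathcal U$ from a 2-divisible Abelian group $(D_2,+)$. For $Q\subseteq[n]=\{1,\dots,n\}$ and a unitary $V$ on the target register, $C_Q[V]$ is the gate applying $V$ to the target register if all control qubits in $Q$ are in state $|1\rangle$ and the identity otherwise. A (standard) $k$-rUCG is an operator of the form $\prod_i C_{Q_i}[U(\mu_i)]$ (finite product) with $\mu_i\in D_2$ and $|Q_i|\le k$; it equals $\sum_c|c\rangle\langle c|\otimes U(\chi_c)$ with $\chi_c=\sum_{i:\,Q_i\subseteq\mathrm{supp}(c)}\mu_i$, where $\mathrm{supp}(c)$ is the set of control qubits with bit value 1 in $c$. Ancilla qubits start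 in $|0\rangle$ and are returned to $|0\rangle$. Cost model. Unit gates are CNOT gates, the elements of $\mathcal U$, their singly-controlled versions (controlled-$U$, or CU), and the "U-closed" gates algebraically derived from these by diagonalization: since $\mathcal U$ is Abelian, there is a unitary $A$ with $AUA^\dagger$ diagonal for all $U\in\mathcal U$, and $A$, $A^\dagger$ and $AUA^\dagger$ with its singly-controlled versions are U-closed gates. The circuit alternates between CNOT sub-circuits $S_i$ on the control register and controlled-$U$ stages; in a controlled-$U$ stage several controlled-$U(\cdot)$ gates with distinct control qubits and the same target register are applied. $D_{\mathrm{CNOT}}$ is the total depth of the CNOT sub-circuits $S_i$. $D_{\mathrm{CU}}$ is the total depth of the controlled-$U$ stages, each of these being implemented with CNOT gates, elements of $\mathcal U$, controlled-$U$ gates with $U\in\mathcal U$, and U-closed gates, each counted as a unit gate (including the CNOTs used to copy (fan out) qubits to ancillae inside the stage). *)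

theory Defs
  imports
    Complex_Main
    "HOL-Algebra.Group"
    "HOL-Library.Disjoint_Sets"
    "Jordan_Normal_Form.Schur_Decomposition"
begin

section \<open>The family of target operators\<close>

definition unitary :: "nat \<Rightarrow> complex mat \<Rightarrow> bool" where
  "unitary d V \<longleftrightarrow> V \<in> carrier_mat d d \<and>
     V * mat_adjoint V = 1\<^sub>m d \<and> mat_adjoint V * V = 1\<^sub>m d"

definition unitary_group :: "nat \<Rightarrow> complex mat monoid" where
  "unitary_group m =
     \<lparr>carrier = {V. unitary (2 ^ m) V}, monoid.mult = (*), one = 1\<^sub>m (2 ^ m)\<rparr>"

definition two_divisible :: "('a, 'b) monoid_scheme \<Rightarrow> bool" where
  "two_divisible G \<longleftrightarrow> (\<forall>x \<in> carrier G. \<exists>y \<in> carrier G. y \<otimes>\<^bsub>G\<^esub> y = x)"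

abbreviation family_group :: "nat \<Rightarrow> complex mat set \<Rightarrow> complex mat monoid" where
  "family_group m \<U> \<equiv> unitary_group m \<lparr>carrier := \<U>\<rparr>"

definition target_family :: "nat \<Rightarrow> complex mat set \<Rightarrow> bool" where
  "target_family m \<U> \<longleftrightarrow> subgroup \<U> (unitary_group m) \<and>
     comm_group (family_group m \<U>) \<and> two_divisible (family_group m \<U>)"

definition diagonalizes :: "nat \<Rightarrow> complex mat \<Rightarrow> complex mat set \<Rightarrow> bool" where
  "diagonalizes m A \<U> \<longleftrightarrow> unitary (2 ^ m) A \<and>
     (\<forall>V \<in> \<U>. diagonal_mat (A * V * mat_adjoint A))"


section \<open>Gates on a register of qubits\<close>

text \<open>
  The computational basis state with index \<open>x < 2 ^ N\<close> of a register of \<open>N\<close> qubits assigns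
  the value \<^term>\<open>bit x q\<close> to qubit \<open>q < N\<close>.  \<open>sub_index qs x\<close> is the index of the
  basis state to which \<open>x\<close> restricts on the qubits \<open>qs\<close> (least significant first).
\<close>

definition sub_index :: "nat list \<Rightarrow> nat \<Rightarrow> nat" where
  "sub_index qs x = horner_sum of_bool 2 (map (bit x) qs)"

text \<open>\<open>Gate Q ts V\<close> applies \<open>V\<close> to the qubits \<open>ts\<close> if all qubits in \<open>Q\<close> are in state
  \<open>|1\<rangle>\<close>, and the identity otherwise; for \<open>Q = {}\<close> it is the uncontrolled \<open>V\<close>.\<close>

datatype gate = Gate (controls: "nat set") (targets: "nat list") (action: "complex mat")

definition gate_mat :: "nat \<Rightarrow> gate \<Rightarrow> complex mat" where
  "gate_mat N g = mat (2 ^ N) (2 ^ N) (\<lambda>(x, y).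
     if \<forall>q \<in> controls g. bit y q
     then if \<forall>q < N. q \<notin> set (targets g) \<longrightarrow> bit x q = bit y q
          then action g $$ (sub_index (targets g) x, sub_index (targets g) y)
          else 0
     else of_bool (x = y))"

definition qubits :: "gate \<Rightarrow> nat set" where
  "qubits g = controls g \<union> set (targets g)"

definition gates_mat :: "nat \<Rightarrow> gate list \<Rightarrow> complex mat" where
  "gates_mat N gs = foldl (\<lambda>M g. gate_mat N g * M) (1\<^sub>m (2 ^ N)) gs"

definition cnot :: "nat \<Rightarrow> nat \<Rightarrow> gate" where
  "cnot c t = Gate {c} [t] (mat_of_rows_list 2 [[0, 1], [1, 0]])"


section \<open>Uniformly controlled gates of restricted order\<close>

text \<open>Control qubits are \<open>0, \<dots>, n - 1\<close>, target qubits are \<open>n, \<dots>, n + m - 1\<close>.\<close>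

definition C_gate :: "nat \<Rightarrow> nat \<Rightarrow> nat set \<Rightarrow> complex mat \<Rightarrow> gate" where
  "C_gate n m Q V = Gate Q [n..<n + m] V"

definition rUCG_over ::
  "('d, 'e) monoid_scheme \<Rightarrow> ('d \<Rightarrow> complex mat) \<Rightarrow> nat \<Rightarrow> nat \<Rightarrow> nat \<Rightarrow>
     complex mat set \<Rightarrow> complex mat \<Rightarrow> bool" where
  "rUCG_over D U n k m \<U> M \<longleftrightarrow>
     comm_group D \<and> two_divisible D \<and> U \<in> hom D (family_group m \<U>) \<and>
     (\<exists>terms :: (nat set \<times> 'd) list.
        (\<forall>(Q, \<mu>) \<in> set terms. Q \<subseteq> {..<n} \<and> card Q \<le> k \<and> \<mu> \<in> carrier D) \<and>
        M = gates_mat (n + m) (map (\<lambda>(Q, \<mu>). C_gate n m Q (U \<mu>)) terms))"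

text \<open>
  The parameter group is quantified over a fixed type here, so that a constant can be chosen
  uniformly in it.  Lemma \<open>rUCG_overD\<close> below shows that a parameter group on an arbitrary type
  yields no further operators.
\<close>

definition rUCG :: "nat \<Rightarrow> nat \<Rightarrow> nat \<Rightarrow> complex mat set \<Rightarrow> complex mat \<Rightarrow> bool" where
  "rUCG n k m \<U> M \<longleftrightarrow> (\<exists>(D :: complex mat monoid) U. rUCG_over D U n k m \<U> M)"

lemma rUCG_overD:
  fixes D :: "('d, 'e) monoid_scheme"
  assumes "target_family m \<U>" and "rUCG_over D U n k m \<U> M"
  shows "rUCG n k m \<U> M"
proof -
  let ?G = "family_group m \<U>"
  obtain ts where U: "U \<in> hom D ?G"
    and ts: "\<forall>(Q, \<mu>) \<in> set ts. Q \<subseteq> {..<n} \<and> card Q \<le> k \<and> \<mu> \<in> carrier D"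
    and M: "M = gates_mat (n + m) (map (\<lambda>(Q, \<mu>). C_gate n m Q (U \<mu>)) ts)"
    using assms(2) unfolding rUCG_over_def by blast
  let ?ts = "map (\<lambda>(Q, \<mu>). (Q, U \<mu>)) ts"
  have "\<forall>(Q, \<mu>) \<in> set ?ts. Q \<subseteq> {..<n} \<and> card Q \<le> k \<and> \<mu> \<in> carrier ?G"
    using ts hom_in_carrier[OF U] by fastforce
  moreover have "M = gates_mat (n + m) (map (\<lambda>(Q, \<mu>). C_gate n m Q (id \<mu>)) ?ts)"
    unfolding M by (simp add: comp_def split_def)
  moreover have "id \<in> hom ?G ?G"
    by (simp add: hom_def)
  ultimately have "rUCG_over ?G id n k m \<U> M"
    using assms(1) unfolding rUCG_over_def target_family_def by blast
  then show ?thesis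
    unfolding rUCG_def by blast
qed


section \<open>Circuits\<close>

text \<open>
  A circuit is a list of layers in the order of application; its depth is its number of layers.
  Gates in one layer act on disjoint sets of qubits.
\<close>

type_synonym circuit = "gate list list"

definition layered :: "nat \<Rightarrow> circuit \<Rightarrow> bool" where
  "layered N c \<longleftrightarrow> (\<forall>L \<in> set c. (\<forall>g \<in> set L. qubits g \<subseteq> {..<N}) \<and>
     disjoint_family_on (\<lambda>i. qubits (L ! i)) {..<length L})"

text \<open>
  Qubits \<open>w, \<dots>, w + a - 1\<close> are ancillae: an index \<open>y < 2 ^ w\<close>, read as an index of the
  extended register, has all of them in state \<open>|0\<rangle>\<close>.
\<close>

definition implements :: "nat \<Rightarrow> nat \<Rightarrow> circuit \<Rightarrow> complex mat \<Rightarrow> bool" where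
  "implements w a c M \<longleftrightarrow> (\<forall>x < 2 ^ (w + a). \<forall>y < 2 ^ w.
     gates_mat (w + a) (concat c) $$ (x, y) = (if x < 2 ^ w then M $$ (x, y) else 0))"

definition cnot_on :: "nat set \<Rightarrow> gate \<Rightarrow> bool" where
  "cnot_on R g \<longleftrightarrow> (\<exists>p \<in> R. \<exists>q \<in> R. p \<noteq> q \<and> g = cnot p q)"

text \<open>
  Unit gates on \<open>n\<close> control qubits, \<open>m\<close> target qubits and \<open>a\<close> ancillae.  The \<open>m\<close>-qubit gates
  act on any \<open>m\<close> qubits outside the control register: the target register can be copied to
  ancillae, and the gates are then applied to the copies.
\<close>

definition unit_gate :: "nat \<Rightarrow> nat \<Rightarrow> nat \<Rightarrow> complex mat set \<Rightarrow> complex mat \<Rightarrow> gate \<Rightarrow> bool" where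
  "unit_gate n m a \<U> A g \<longleftrightarrow> cnot_on {..<n + m + a} g \<or>
     (\<exists>Q ts V. g = Gate Q ts V \<and>
        distinct ts \<and> length ts = m \<and> set ts \<subseteq> {n..<n + m + a} \<and>
        (Q = {} \<and> V \<in> {A, mat_adjoint A} \<or>
         (Q = {} \<or> (\<exists>q \<in> {..<n + m + a} - set ts. Q = {q})) \<and>
           V \<in> \<U> \<union> (\<lambda>W. A * W * mat_adjoint A) ` \<U>))"

text \<open>
  Operators realized by controlled-\<open>U\<close> stages: (singly) controlled gates with distinct control
  qubits and the common target register.  The pair with control set \<open>{}\<close> is an uncontrolled
  element of \<open>\<U>\<close>; without it no circuit could produce a factor with \<open>Q = {}\<close>.
\<close>

definition CU_operator :: "nat \<Rightarrow> nat \<Rightarrow> complex mat set \<Rightarrow> complex mat \<Rightarrow> bool" where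
  "CU_operator n m \<U> M \<longleftrightarrow>
     (\<exists>cs :: (nat set \<times> complex mat) list. distinct (map fst cs) \<and>
        (\<forall>(Q, V) \<in> set cs. (Q = {} \<or> (\<exists>q < n. Q = {q})) \<and> V \<in> \<U>) \<and>
        M = gates_mat (n + m) (map (\<lambda>(Q, V). C_gate n m Q V) cs))"

text \<open>
  An alternating circuit is a list of pairs of a CNOT sub-circuit on the control register and the
  controlled-\<open>U\<close> stage that follows it.  Either component may be the empty circuit.
\<close>

type_synonym alternating_circuit = "(circuit \<times> circuit) list"

definition alternating ::
  "nat \<Rightarrow> nat \<Rightarrow> nat \<Rightarrow> complex mat set \<Rightarrow> complex mat \<Rightarrow> alternating_circuit \<Rightarrow> bool" where
  "alternating n m a \<U> A bs \<longleftrightarrow> (\<forall>(S, T) \<in> set bs.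
     layered n S \<and> (\<forall>g \<in> set (concat S). cnot_on {..<n} g) \<and>
     layered (n + m + a) T \<and> (\<forall>g \<in> set (concat T). unit_gate n m a \<U> A g) \<and>
     (\<exists>M. CU_operator n m \<U> M \<and> implements (n + m) a T M))"

definition flat_circuit :: "alternating_circuit \<Rightarrow> circuit" where
  "flat_circuit bs = concat (map (\<lambda>(S, T). S @ T) bs)"

definition D_CNOT :: "alternating_circuit \<Rightarrow> nat" where
  "D_CNOT bs = (\<Sum>(S, T) \<leftarrow> bs. length S)"

definition D_CU :: "alternating_circuit \<Rightarrow> nat" where
  "D_CU bs = (\<Sum>(S, T) \<leftarrow> bs. length T)"

end

theory Submission
  imports
    Defs
    "Jordan_Normal_Form.Spectral_Radius"
begin

text \<open>
  For bits, \<open>2 x y = x + y - (x \<oplus> y)\<close>; since \<open>\<U>\<close> is 2-divisible, a gate with at most \<open>k\<close> controls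
  is therefore a product of phases attached to parities of at most \<open>k\<close> control bits.  So it suffices
  to drive the control register by CNOT layers, with a stage after each layer, such that every
  nonempty set of at most \<open>k\<close> qubits occurs as the parity held by some qubit at some time, and such
  that a constant fraction of all (layer, qubit) pairs is used for new parities.

  Pairs are visited by a round robin of matchings.  For sets \<open>T\<close> with at least three elements, halve
  the register \<open>R\<close>.  Sets inside one half are treated by recursion, which converges geometrically.
  Every other \<open>T\<close> meets a window \<open>B\<close> of \<open>2 ^ r\<close> qubits, a constant fraction of \<open>R\<close>, and has at least
  two elements outside \<open>B\<close>.  The \<open>b\<close>-subsets of \<open>B\<close> are covered by few linearly independent families:
  identify \<open>B\<close> with the group of order \<open>2 ^ r\<close> and exponent 2; half of the translates of a set that
  meets some coset of a subgroup of index 2 in an odd number of elements are independent, and the exceptional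
  sets are so rare that each may form a family of its own.  Load such a family on the qubits of \<open>B\<close> by
  quadratically many CNOTs, and let all these qubits run in parallel through the subsets of \<open>R - B\<close>
  with at most \<open>k - b \<ge> 2\<close> elements; there are at least quadratically many of these, so loading is
  amortized.

  A stage diagonalizes the target register, fans it out to \<open>n\<close> copies in logarithmic depth and
  applies all its phases in one layer.
\<close>

section \<open>CNOT circuits and parities\<close>

text \<open>CNOT circuits are invertible, so at any moment the parities on the qubits form a basis
  over \<open>F_2\<close>: only linearly independent families can be held together. Passing between
  unrelated bases takes quadratically many gates, while the budget allows only about
  \<open>1 / n\<close> layers per parity. This is the reason both for the search for independent
  families whose size is proportional to the register and for the long walks between two loadings.
  Every piece of the construction returns to the initial state, so pieces are joined by
  concatenation and their lengths add. Sets of size at least 3 are separated from pairs because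
  their number grows at least cubically: the cost per qubit then drops by half or more when the
  register is split, and the recursion costs no logarithm. The number of pairs per qubit is linear,
  so splitting would not reduce its total.\<close>

definition symdiff :: "'a set \<Rightarrow> 'a set \<Rightarrow> 'a set" (infixl "\<triangle>" 65) where
  "A \<triangle> B = (A - B) \<union> (B - A)"

lemma mem_symdiff: "x \<in> A \<triangle> B \<longleftrightarrow> (x \<in> A) \<noteq> (x \<in> B)"
  by (auto simp: symdiff_def)

lemma symdiff_empty [simp]: "A \<triangle> {} = A" "{} \<triangle> A = A"
  by (auto simp: symdiff_def)

lemma symdiff_self [simp]: "A \<triangle> A = {}" "A \<triangle> B \<triangle> B = A"
  by (auto simp: symdiff_def)

lemma symdiff_commute: "A \<triangle> B = B \<triangle> A"
  by (auto simp: symdiff_def)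

lemma symdiff_assoc: "A \<triangle> B \<triangle> C = A \<triangle> (B \<triangle> C)"
  by (rule Set.set_eqI) (simp add: mem_symdiff, blast)

lemma symdiff_left_commute: "A \<triangle> (B \<triangle> C) = B \<triangle> (A \<triangle> C)"
  by (rule Set.set_eqI) (simp add: mem_symdiff, blast)

lemmas symdiff_ac = symdiff_assoc symdiff_commute symdiff_left_commute

lemma symdiff_left_self [simp]: "A \<triangle> (A \<triangle> B) = B"
  by (simp add: symdiff_assoc[symmetric])

lemma symdiff_disjoint: "A \<inter> B = {} \<Longrightarrow> A \<triangle> B = A \<union> B"
  by (auto simp: symdiff_def)

lemma finite_symdiff [simp]: "finite A \<Longrightarrow> finite B \<Longrightarrow> finite (A \<triangle> B)"
  by (simp add: symdiff_def)

lemma odd_card_symdiff: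
  assumes "finite A" "finite B"
  shows "odd (card (A \<triangle> B)) \<longleftrightarrow> odd (card A) \<noteq> odd (card B)"
proof -
  have "card (A \<triangle> B) = card (A - B) + card (B - A)"
    unfolding symdiff_def using assms by (intro card_Un_disjoint) auto
  moreover have "card A = card (A - B) + card (A \<inter> B)"
    using assms card_Int_Diff[of A B] by simp
  moreover have "card B = card (B - A) + card (A \<inter> B)"
    using assms card_Int_Diff[of B A] by (simp add: Int_commute)
  ultimately show ?thesis
    by auto
qed

lemma image_symdiff: "inj_on f (A \<union> B) \<Longrightarrow> f ` (A \<triangle> B) = f ` A \<triangle> f ` B"
  unfolding symdiff_def inj_on_def by blast

text \<open>A state maps each qubit to the set of initial bits whose sum modulo 2 it holds, so a
  CNOT becomes a symmetric difference. The pair is (control, target).\<close>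

definition add_parity :: "'a \<times> 'a \<Rightarrow> ('a \<Rightarrow> 'b set) \<Rightarrow> 'a \<Rightarrow> 'b set" where
  "add_parity g st = st(snd g := st (snd g) \<triangle> st (fst g))"

abbreviation run_cnots :: "('a \<times> 'a) list \<Rightarrow> ('a \<Rightarrow> 'b set) \<Rightarrow> 'a \<Rightarrow> 'b set" where
  "run_cnots gs \<equiv> fold add_parity gs"

abbreviation init :: "'a \<Rightarrow> 'a set" where
  "init \<equiv> (\<lambda>q. {q})"

definition cnots_on :: "'a set \<Rightarrow> ('a \<times> 'a) list \<Rightarrow> bool" where
  "cnots_on R gs \<longleftrightarrow> (\<forall>(c, t) \<in> set gs. c \<in> R \<and> t \<in> R \<and> c \<noteq> t)"

lemma add_parity_apply: "add_parity (c, t) st q = (if q = t then st t \<triangle> st c else st q)"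
  by (simp add: add_parity_def)

lemma run_cnots_rev:
  "cnots_on R gs \<Longrightarrow> run_cnots (rev gs) (run_cnots gs st) = st"
proof (induction gs arbitrary: st)
  case (Cons g gs)
  then have "run_cnots (rev gs) (run_cnots gs (add_parity g st)) = add_parity g st"
    by (auto simp: cnots_on_def)
  moreover have "add_parity g (add_parity g st) = st"
    using Cons.prems by (auto simp: cnots_on_def add_parity_def)
  ultimately show ?case
    by simp
qed simp

lemma run_cnots_outside: "q \<notin> snd ` set gs \<Longrightarrow> run_cnots gs st q = st q"
  by (induction gs arbitrary: st) (auto simp: add_parity_def)

abbreviation disjoint_cnots :: "('a \<times> 'a) list \<Rightarrow> bool" where
  "disjoint_cnots \<equiv> sorted_wrt (\<lambda>g h. {fst g, snd g} \<inter> {fst h, snd h} = {})"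

definition cnot_layers :: "'a set \<Rightarrow> ('a \<times> 'a) list list \<Rightarrow> bool" where
  "cnot_layers R Ls \<longleftrightarrow> (\<forall>L \<in> set Ls. cnots_on R L \<and> disjoint_cnots L)"

text \<open>Returning to \<open>init\<close> is built in so that loops can be concatenated and no
  permutation of the control states is left over at the end.\<close>

definition loop :: "'a set \<Rightarrow> ('a \<times> 'a) list list \<Rightarrow> bool" where
  "loop R Ls \<longleftrightarrow> cnot_layers R Ls \<and> run_cnots (concat Ls) init = init"

text \<open>The empty prefix is excluded because a stage follows each layer but none precedes the first.\<close>

definition visited :: "'a set \<Rightarrow> ('a \<times> 'a) list list \<Rightarrow> 'a set set" where
  "visited R Ls = {run_cnots (concat (take i Ls)) init q | i q. 0 < i \<and> i \<le> length Ls \<and> q \<in> R}"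

definition loopable :: "'a set \<Rightarrow> 'a set set \<Rightarrow> nat \<Rightarrow> bool" where
  "loopable R \<T> l \<longleftrightarrow> (\<exists>Ls. loop R Ls \<and> \<T> \<subseteq> visited R Ls \<and> length Ls \<le> l)"

lemma cnot_layers_mono: "cnot_layers R Ls \<Longrightarrow> R \<subseteq> R' \<Longrightarrow> cnot_layers R' Ls"
  unfolding cnot_layers_def cnots_on_def by fast

lemma visited_mono: "R \<subseteq> R' \<Longrightarrow> visited R Ls \<subseteq> visited R' Ls"
  unfolding visited_def by blast

lemma loopable_mono:
  "loopable R \<T> l \<Longrightarrow> R \<subseteq> R' \<Longrightarrow> \<T>' \<subseteq> \<T> \<Longrightarrow> l \<le> l' \<Longrightarrow> loopable R' \<T>' l'"
  unfolding loopable_def loop_def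
  by (meson cnot_layers_mono visited_mono order_trans)

lemma loopable_empty: "loopable R {} 0"
  unfolding loopable_def loop_def cnot_layers_def by (intro exI[of _ "[]"]) simp

text \<open>After the first loop the state is \<open>init\<close> again, so each prefix of the
  second one reaches the same parities as it does alone.\<close>

lemma loopable_Un:
  assumes "loopable R \<S> l" "loopable R \<T> l'"
  shows "loopable R (\<S> \<union> \<T>) (l + l')"
proof -
  obtain Ls Ms where Ls: "loop R Ls" "\<S> \<subseteq> visited R Ls" "length Ls \<le> l"
    and Ms: "loop R Ms" "\<T> \<subseteq> visited R Ms" "length Ms \<le> l'"
    using assms unfolding loopable_def by blast
  have "loop R (Ls @ Ms)"
    using Ls(1) Ms(1) unfolding loop_def cnot_layers_def by auto
  moreover have "visited R Ls \<subseteq> visited R (Ls @ Ms)"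
  proof
    fix T assume "T \<in> visited R Ls"
    then obtain i q where "0 < i" "i \<le> length Ls" "q \<in> R" "T = run_cnots (concat (take i Ls)) init q"
      unfolding visited_def by blast
    then show "T \<in> visited R (Ls @ Ms)"
      unfolding visited_def by (intro CollectI exI[of _ i] exI[of _ q]) simp
  qed
  moreover have "visited R Ms \<subseteq> visited R (Ls @ Ms)"
  proof
    fix T assume "T \<in> visited R Ms"
    then obtain i q where "0 < i" "i \<le> length Ms" "q \<in> R" "T = run_cnots (concat (take i Ms)) init q"
      unfolding visited_def by blast
    then show "T \<in> visited R (Ls @ Ms)"
      using Ls(1) unfolding visited_def loop_def
      by (intro CollectI exI[of _ "length Ls + i"] exI[of _ q]) simp
  qed
  ultimately show ?thesis
    unfolding loopable_def using Ls Ms by (intro exI[of _ "Ls @ Ms"]) auto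
qed

lemma loopable_UN:
  assumes "finite I" "\<And>i. i \<in> I \<Longrightarrow> loopable R (\<T> i) (l i)"
  shows "loopable R (\<Union>i\<in>I. \<T> i) (\<Sum>i\<in>I. l i)"
  using assms by (induction I rule: finite_induct) (auto simp: loopable_empty loopable_Un)

text \<open>\<open>gs\<close> loads a state, \<open>Ms\<close> is a closed walk from it, and the
  reversed \<open>gs\<close> unloads. Loading is sequential, one gate per layer; its cost is meant
  to be outweighed by a long \<open>Ms\<close>.\<close>

lemma loopable_conjugate:
  assumes go: "cnots_on R gs" and mid: "cnot_layers R Ms"
    and id: "run_cnots (concat Ms) (run_cnots gs init) = run_cnots gs init"
    and \<T>: "\<And>T. T \<in> \<T> \<Longrightarrow> \<exists>i q. i \<le> length Ms \<and> q \<in> R \<and>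
      run_cnots (concat (take i Ms)) (run_cnots gs init) q = T"
  shows "loopable R \<T> (2 * length gs + length Ms + 1)"
proof -
  let ?gs = "map (\<lambda>g. [g]) gs"
  \<comment> \<open>The leading empty layer keeps the prefix nonempty when \<open>gs = []\<close>
    and \<open>i = 0\<close>; it is the \<open>+ 1\<close> in the bound.\<close>
  let ?Ls = "([] # ?gs) @ Ms @ rev ?gs"
  have conc: "concat (rev ?gs) = rev gs" "concat ?gs = gs"
    by (induction gs) simp_all
  have "run_cnots (concat ?Ls) init = init"
    using id run_cnots_rev[OF go, of init] by (simp add: conc)
  moreover have "cnot_layers R ?Ls"
    using go mid unfolding cnot_layers_def cnots_on_def by auto
  moreover have "\<T> \<subseteq> visited R ?Ls"
  proof
    fix T assume "T \<in> \<T>"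
    then obtain i q where i: "i \<le> length Ms" "q \<in> R"
      "run_cnots (concat (take i Ms)) (run_cnots gs init) q = T"
      using \<T> by blast
    have "take (Suc (length gs) + i) ?Ls = ([] # ?gs) @ take i Ms"
      using i(1) by simp
    then have "run_cnots (concat (take (Suc (length gs) + i) ?Ls)) init q = T"
      using i(3) by (simp add: conc del: append.simps take_append)
    then show "T \<in> visited R ?Ls"
      unfolding visited_def using i by (intro CollectI exI[of _ "Suc (length gs) + i"] exI[of _ q]) auto
  qed
  ultimately show ?thesis
    unfolding loopable_def loop_def by (intro exI[of _ ?Ls]) auto
qed

section \<open>Linear independence over \<open>F_2\<close> and loading of independent
  families\<close>

definition indep :: "'a set set \<Rightarrow> bool" where
  "indep \<V> \<longleftrightarrow> (\<forall>\<S>\<subseteq>\<V>. (\<forall>x. even (card {S \<in> \<S>. x \<in> S})) \<longrightarrow> \<S> = {})"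

definition par_sum :: "('a \<Rightarrow> 'b set) \<Rightarrow> 'a set \<Rightarrow> 'b set" where
  "par_sum f J = {x. odd (card {i \<in> J. x \<in> f i})}"

lemma par_sum_empty [simp]: "par_sum f {} = {}"
  by (simp add: par_sum_def)

lemma par_sum_symdiff:
  assumes "finite I" "finite J"
  shows "par_sum f (I \<triangle> J) = par_sum f I \<triangle> par_sum f J"
proof (rule Set.set_eqI)
  fix x
  have "{i \<in> I \<triangle> J. x \<in> f i} = {i \<in> I. x \<in> f i} \<triangle> {i \<in> J. x \<in> f i}"
    by (auto simp: mem_symdiff)
  then show "x \<in> par_sum f (I \<triangle> J) \<longleftrightarrow> x \<in> par_sum f I \<triangle> par_sum f J"
    using odd_card_symdiff[of "{i \<in> I. x \<in> f i}" "{i \<in> J. x \<in> f i}"] assms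
    by (simp add: par_sum_def mem_symdiff)
qed

lemma par_sum_singleton [simp]: "par_sum f {c} = f c"
proof -
  have "{i \<in> {c}. x \<in> f i} = (if x \<in> f c then {c} else {})" for x
    by auto
  then show ?thesis
    by (auto simp: par_sum_def)
qed

lemma par_sum_insert:
  assumes "finite J" "c \<notin> J"
  shows "par_sum f (insert c J) = par_sum f J \<triangle> f c"
  using par_sum_symdiff[of J "{c}" f] assms by (simp add: symdiff_disjoint)

lemma par_sum_cong: "(\<And>i. i \<in> J \<Longrightarrow> f i = g i) \<Longrightarrow> par_sum f J = par_sum g J"
  unfolding par_sum_def by (metis (mono_tags, lifting) Collect_cong)

text \<open>The form of invertibility that loading consumes: any desired parity is a sum of parities
  currently held.\<close>

definition spanning :: "'a set \<Rightarrow> ('a \<Rightarrow> 'a set) \<Rightarrow> bool" where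
  "spanning B st \<longleftrightarrow> (\<forall>v\<subseteq>B. \<exists>J\<subseteq>B. par_sum st J = v)"

lemma spanning_init: "spanning B init"
  unfolding spanning_def
proof (intro allI impI)
  fix v assume "v \<subseteq> B"
  have "{i \<in> v. x \<in> {i}} = (if x \<in> v then {x} else {})" for x
    by auto
  then have "par_sum init v = v"
    by (auto simp: par_sum_def)
  then show "\<exists>J\<subseteq>B. par_sum init J = v"
    using \<open>v \<subseteq> B\<close> by blast
qed

text \<open>If the target lies in \<open>J\<close>, the sum over \<open>J\<close> gains the parity
  of the control; toggling the control in \<open>J\<close> cancels it.\<close>

lemma spanning_add_parity:
  assumes "finite B" "spanning B st" "fst g \<in> B" "snd g \<in> B" "fst g \<noteq> snd g"
  shows "spanning B (add_parity g st)"
  unfolding spanning_def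
proof (intro allI impI)
  fix v assume "v \<subseteq> B"
  then obtain J where J: "J \<subseteq> B" "par_sum st J = v"
    using assms(2) unfolding spanning_def by blast
  have fin: "finite J"
    using J(1) assms(1) finite_subset by blast
  show "\<exists>J\<subseteq>B. par_sum (add_parity g st) J = v"
  proof (cases "snd g \<in> J")
    case False
    then have "par_sum (add_parity g st) J = par_sum st J"
      by (intro par_sum_cong) (auto simp: add_parity_def)
    then show ?thesis
      using J by blast
  next
    case True
    then have ins: "J = insert (snd g) (J - {snd g})"
      by blast
    have eq: "par_sum (add_parity g st) (J - {snd g}) = par_sum st (J - {snd g})"
      by (intro par_sum_cong) (auto simp: add_parity_def)
    have "par_sum f J = par_sum f (J - {snd g}) \<triangle> f (snd g)" for f :: "'a \<Rightarrow> 'a set"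
      using fin par_sum_insert[of "J - {snd g}" "snd g" f] ins by simp
    then have "par_sum (add_parity g st) J = par_sum st J \<triangle> st (fst g)"
      using eq by (simp add: add_parity_def symdiff_assoc)
    then have "par_sum (add_parity g st) (J \<triangle> {fst g}) = v"
      using fin J assms(5) by (simp add: par_sum_symdiff) (simp add: add_parity_def)
    moreover have "J \<triangle> {fst g} \<subseteq> B"
      using J assms(3) by (auto simp: symdiff_def)
    ultimately show ?thesis
      by blast
  qed
qed

lemma spanning_run_cnots:
  "finite B \<Longrightarrow> spanning B st \<Longrightarrow> cnots_on B gs \<Longrightarrow> spanning B (run_cnots gs st)"
  by (induction gs arbitrary: st) (auto simp: cnots_on_def spanning_add_parity)

lemma run_cnots_collect:
  assumes "t \<notin> set cs" "distinct cs"
  shows "run_cnots (map (\<lambda>c. (c, t)) cs) st = st(t := par_sum st (insert t (set cs)))"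
  using assms
proof (induction cs arbitrary: st)
  case (Cons c cs)
  let ?st = "add_parity (c, t) st"
  have "par_sum ?st (set cs) = par_sum st (set cs)"
    using Cons.prems by (intro par_sum_cong) (auto simp: add_parity_def)
  then have *: "par_sum ?st (insert t (set cs)) = par_sum st (insert t (insert c (set cs)))"
    using Cons.prems by (simp add: par_sum_insert add_parity_def symdiff_assoc symdiff_commute)
      (metis symdiff_assoc symdiff_commute)
  have "run_cnots (map (\<lambda>c. (c, t)) cs) ?st = ?st(t := par_sum ?st (insert t (set cs)))"
    using Cons.prems by (intro Cons.IH) auto
  moreover have "?st(t := X) = st(t := X)" for X
    by (simp add: add_parity_def)
  ultimately show ?case
    by (simp add: *)
qed simp

text \<open>Among the qubits whose parities sum to \<open>v\<close>, independence yields one that carries no member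
  of \<open>\<V>\<close>; the others are added to it.\<close>

lemma insert_indep:
  assumes B: "finite B" "spanning B st" and \<V>: "\<V> \<subseteq> st ` B"
    and ind: "indep (insert v \<V>)" and v: "v \<subseteq> B" "v \<notin> \<V>"
  shows "\<exists>gs. cnots_on B gs \<and> length gs \<le> card B \<and> insert v \<V> \<subseteq> run_cnots gs st ` B"
proof -
  obtain J where J: "J \<subseteq> B" "par_sum st J = v"
    using B(2) v unfolding spanning_def by blast
  then have fin: "finite J"
    using B(1) finite_subset by blast
  \<comment> \<open>The carriers chosen by \<open>g\<close> are the qubits that must not be
    overwritten.\<close>
  obtain g where g: "\<And>u. u \<in> \<V> \<Longrightarrow> g u \<in> B \<and> st (g u) = u"
  proof -
    have "\<forall>u\<in>\<V>. \<exists>q. q \<in> B \<and> st q = u"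
      using \<V> by auto
    then show ?thesis
      using that bchoice by metis
  qed
  have "\<not> J \<subseteq> g ` \<V>"
  proof
    assume sub: "J \<subseteq> g ` \<V>"
    let ?\<S> = "insert v (st ` J)"
    have inj: "inj_on st J"
      using sub g unfolding inj_on_def by (metis imageE subsetD)
    have sub\<V>: "st ` J \<subseteq> \<V>"
      using sub g by auto
    have "even (card {S \<in> ?\<S>. x \<in> S})" for x
    proof -
      have "{S \<in> st ` J. x \<in> S} = st ` {i \<in> J. x \<in> st i}"
        by auto
      then have c: "card {S \<in> st ` J. x \<in> S} = card {i \<in> J. x \<in> st i}"
        using inj by (simp add: card_image inj_on_def)
      have "{S \<in> ?\<S>. x \<in> S} = (if x \<in> v then insert v {S \<in> st ` J. x \<in> S} else {S \<in> st ` J. x \<in> S})"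
        by auto
      moreover have "card (insert v {S \<in> st ` J. x \<in> S}) = Suc (card {S \<in> st ` J. x \<in> S})"
        using sub\<V> v fin by (intro card_insert_disjoint) auto
      ultimately have "card {S \<in> ?\<S>. x \<in> S} = card {i \<in> J. x \<in> st i} + (if x \<in> v then 1 else 0)"
        using c by simp
      then show ?thesis
        using J(2) by (auto simp: par_sum_def)
    qed
    then have "?\<S> = {}"
      using ind sub\<V> unfolding indep_def by (metis insert_mono)
    then show False
      by simp
  qed
  then obtain t where t: "t \<in> J" "t \<notin> g ` \<V>"
    by blast
  obtain cs where cs: "set cs = J - {t}" "distinct cs"
    using finite_distinct_list[of "J - {t}"] fin by blast
  let ?gs = "map (\<lambda>c. (c, t)) cs"
  have run: "run_cnots ?gs st = st(t := v)"
    using run_cnots_collect[of t cs st] cs J(2) t(1) by (simp add: insert_absorb)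
  have "cnots_on B ?gs"
    using cs J t unfolding cnots_on_def by auto
  moreover have "length ?gs \<le> card B"
    using cs J(1) B(1) by (metis card_mono distinct_card length_map Diff_subset order_trans)
  moreover have "insert v \<V> \<subseteq> run_cnots ?gs st ` B"
  proof
    fix u assume u: "u \<in> insert v \<V>"
    show "u \<in> run_cnots ?gs st ` B"
    proof (cases "u = v")
      case True
      then show ?thesis
        unfolding run using t(1) J(1) by (intro image_eqI[of _ _ t]) auto
    next
      case False
      then have "u \<in> \<V>" using u by blast
      then show ?thesis
        unfolding run using g[of u] t(2) by (intro image_eqI[of _ _ "g u"]) auto
    qed
  qed
  ultimately show ?thesis
    by blast
qed

lemma indep_subset: "indep \<V> \<Longrightarrow> \<U> \<subseteq> \<V> \<Longrightarrow> indep \<U>"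
  unfolding indep_def by blast

text \<open>One insertion per member, each with at most \<open>card B\<close> CNOTs. All members end
  up as values of the state on \<open>B\<close>, so there are at most \<open>card B\<close> of them,
  whence the square.\<close>

lemma prepare_indep:
  assumes "finite B" "finite \<V>" "indep \<V>" "\<And>v. v \<in> \<V> \<Longrightarrow> v \<subseteq> B"
  shows "\<exists>gs. cnots_on B gs \<and> length gs \<le> (card B)\<^sup>2 \<and> \<V> \<subseteq> run_cnots gs init ` B"
proof -
  have "\<exists>gs. cnots_on B gs \<and> length gs \<le> card \<V> * card B \<and> \<V> \<subseteq> run_cnots gs init ` B"
    using assms(2-4)
  proof (induction \<V> rule: finite_induct)
    case empty
    show ?case
      by (intro exI[of _ "[]"]) (simp add: cnots_on_def)
  next
    case (insert v \<V>)
    obtain gs where gs: "cnots_on B gs" "length gs \<le> card \<V> * card B" "\<V> \<subseteq> run_cnots gs init ` B"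
      using insert indep_subset[OF insert.prems(1)] by blast
    obtain hs where "cnots_on B hs" "length hs \<le> card B"
        "insert v \<V> \<subseteq> run_cnots hs (run_cnots gs init) ` B"
      using insert_indep[OF assms(1) spanning_run_cnots[OF assms(1) spanning_init gs(1)] gs(3)
          insert.prems(1)] insert by blast
    then show ?case
      using gs insert by (intro exI[of _ "gs @ hs"]) (auto simp: cnots_on_def)
  qed
  then obtain gs where gs: "cnots_on B gs" "length gs \<le> card \<V> * card B" "\<V> \<subseteq> run_cnots gs init ` B"
    by blast
  have "card \<V> \<le> card B"
    using gs(3) assms(1) surj_card_le by blast
  then show ?thesis
    using gs by (metis mult_le_mono1 order_trans power2_eq_square)
qed

section \<open>Sweeping all small subsets of the complement of a window\<close>

text \<open>The depth-first traversal of the tree of sets with at most \<open>s\<close> elements, in which the maximum of a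
  set is removed to obtain its parent.  The list consists of the elements that are toggled.\<close>

fun subset_walk :: "nat \<Rightarrow> nat \<Rightarrow> nat list" where
  "subset_walk 0 s = []"
| "subset_walk (Suc m) 0 = []"
| "subset_walk (Suc m) (Suc s) = subset_walk m (Suc s) @ [m] @ subset_walk m s @ [m]"

abbreviation toggles :: "'a list \<Rightarrow> 'a set \<Rightarrow> 'a set" where
  "toggles \<equiv> fold (\<lambda>e D. D \<triangle> {e})"

text \<open>The traversal crosses every edge of the tree twice, and the tree has one edge fewer than
  nodes.\<close>

lemma length_subset_walk: "length (subset_walk m s) + 2 = 2 * (\<Sum>i\<le>s. m choose i)"
proof (induction m s rule: subset_walk.induct)
  case (1 s)
  have "(\<Sum>i\<le>s. 0 choose i) = 1"
    by (induction s) auto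
  then show ?case by simp
next
  case (3 m s)
  have "(\<Sum>i\<le>Suc s. Suc m choose i) = (\<Sum>i\<le>Suc s. m choose i) + (\<Sum>i\<le>s. m choose i)"
    by (simp only: sum.atMost_Suc_shift) (simp add: sum.distrib)
  then show ?case
    using 3 by simp
qed auto

lemma toggles_subset_walk: "toggles (subset_walk m s) D = D"
  by (induction m s arbitrary: D rule: subset_walk.induct) auto

lemma set_subset_walk: "set (subset_walk m s) \<subseteq> {..<m}"
  by (induction m s rule: subset_walk.induct) auto

lemma subset_walk_visits:
  "E \<subseteq> {..<m} \<Longrightarrow> card E \<le> s \<Longrightarrow>
    \<exists>i \<le> length (subset_walk m s). toggles (take i (subset_walk m s)) D = D \<triangle> E"
proof (induction m s arbitrary: D E rule: subset_walk.induct)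
  case (2 m)
  then have "E = {}"
    using finite_subset by fastforce
  then show ?case by auto
next
  case (3 m s)
  show ?case
  proof (cases "m \<in> E")
    case False
    then have "E \<subseteq> {..<m}"
      using 3(3) by (auto simp: less_Suc_eq)
    then obtain i where "i \<le> length (subset_walk m (Suc s))"
        "toggles (take i (subset_walk m (Suc s))) D = D \<triangle> E"
      using 3(1)[of E D] 3(4) by blast
    then show ?thesis
      by (intro exI[of _ i]) auto
  next
    case True
    have fin: "finite E"
      using 3(3) finite_subset by blast
    have "E - {m} \<subseteq> {..<m}" "card (E - {m}) \<le> s"
      using 3(3,4) True fin by (auto simp: less_Suc_eq)
    then obtain i where i: "i \<le> length (subset_walk m s)"
        "toggles (take i (subset_walk m s)) (D \<triangle> {m}) = D \<triangle> {m} \<triangle> (E - {m})"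
      using 3(2)[of "E - {m}" "D \<triangle> {m}"] by blast
    have "D \<triangle> {m} \<triangle> (E - {m}) = D \<triangle> E"
      using True by (auto simp: symdiff_def)
    \<comment> \<open>The first closed subwalk and the toggle of \<open>m\<close> precede the walk
      through the sets containing \<open>m\<close>.\<close>
    then show ?thesis
      using i by (intro exI[of _ "length (subset_walk m (Suc s)) + Suc i"])
        (auto simp: toggles_subset_walk)
  qed
qed auto

text \<open>No control is a target of the layer, so each target sees the original value of its
  control although the gates are run one after the other.\<close>

lemma run_parallel_cnots:
  assumes bs: "distinct bs" "\<And>i. i < length bs \<Longrightarrow> a i \<notin> set bs" and j: "j < length bs"
  shows "run_cnots (map (\<lambda>i. (a i, bs ! i)) [0..<length bs]) st (bs ! j) = st (bs ! j) \<triangle> st (a j)"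
proof -
  let ?run = "\<lambda>n. run_cnots (map (\<lambda>i. (a i, bs ! i)) [0..<n]) st"
  have outside: "?run n q = st q" if "\<And>i. i < n \<Longrightarrow> q \<noteq> bs ! i" for n q
    using that by (intro run_cnots_outside) fastforce
  have "j < n \<Longrightarrow> n \<le> length bs \<Longrightarrow> ?run n (bs ! j) = st (bs ! j) \<triangle> st (a j)" for n
  proof (induction n)
    case (Suc n)
    show ?case
    proof (cases "j = n")
      case True
      have "?run n (bs ! n) = st (bs ! n)"
        using Suc.prems bs(1) by (intro outside) (auto simp: nth_eq_iff_index_eq)
      moreover have "?run n (a n) = st (a n)"
        using Suc.prems bs(2)[of n] by (intro outside) (metis Suc_le_lessD less_trans nth_mem)
      ultimately show ?thesis
        using True by (simp add: add_parity_apply)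
    next
      case False
      then have "bs ! j \<noteq> bs ! n"
        using Suc.prems bs(1) by (auto simp: nth_eq_iff_index_eq)
      then show ?thesis
        using Suc False by (simp add: add_parity_apply)
    qed
  qed simp
  then show ?thesis
    using j by blast
qed

text \<open>Each target follows the same walk in cyclically shifted coordinates, which makes the controls of
  a layer distinct.\<close>

definition walk_layer :: "'a list \<Rightarrow> 'a list \<Rightarrow> nat \<Rightarrow> ('a \<times> 'a) list" where
  "walk_layer as bs e = map (\<lambda>j. (as ! ((e + j) mod length as), bs ! j)) [0..<length bs]"

lemma inj_on_add_mod: "inj_on (\<lambda>e. (e + j) mod n) {..<n :: nat}"
proof (rule inj_onI)
  fix x y assume "x \<in> {..<n}" "y \<in> {..<n}" and "(x + j) mod n = (y + j) mod n"
  then obtain q r where "x + j + n * q = y + j + n * r"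
    unfolding nat_mod_eq_iff by blast
  then have "x + n * q = y + n * r"
    by simp
  then have "(x + n * q) mod n = (y + n * r) mod n"
    by simp
  then show "x = y"
    using \<open>x \<in> _\<close> \<open>y \<in> _\<close> by simp
qed

text \<open>\<open>bs\<close> carry the loaded parities; \<open>as\<close> keep their own bits and
  act only as controls. \<open>length_le\<close> makes the shifts by positions in \<open>bs\<close>
  pairwise different modulo \<open>length as\<close>.\<close>

locale subset_sweep =
  fixes as bs :: "'a list"
  assumes distinct_as: "distinct as" and distinct_bs: "distinct bs"
    and disjoint: "set as \<inter> set bs = {}" and length_le: "length bs \<le> length as"
begin

abbreviation "sh j e \<equiv> as ! ((e + j) mod length as)"

lemma inj_sh: "inj_on (sh j) {..<length as}"
proof (rule inj_onI)
  fix x y assume xy: "x \<in> {..<length as}" "y \<in> {..<length as}" "sh j x = sh j y"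
  then have "(x + j) mod length as = (y + j) mod length as"
    using distinct_as by (subst (asm) nth_eq_iff_index_eq) (auto intro: mod_less_divisor)
  then show "x = y"
    using inj_on_add_mod[of j "length as"] xy by (auto dest: inj_onD)
qed

lemma sh_mem: "e < length as \<Longrightarrow> sh j e \<in> set as"
  by (intro nth_mem mod_less_divisor) linarith

lemma sh_image: "sh j ` {..<length as} = set as"
proof (rule card_subset_eq)
  show "card (sh j ` {..<length as}) = card (set as)"
    using distinct_as by (simp add: card_image inj_sh distinct_card)
qed (auto intro: sh_mem)

lemma run_walk_layer:
  assumes "e < length as"
  shows "j < length bs \<Longrightarrow> run_cnots (walk_layer as bs e) st (bs ! j) = st (bs ! j) \<triangle> st (sh j e)"
    and "q \<notin> set bs \<Longrightarrow> run_cnots (walk_layer as bs e) st q = st q"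
proof -
  assume "j < length bs"
  then show "run_cnots (walk_layer as bs e) st (bs ! j) = st (bs ! j) \<triangle> st (sh j e)"
    unfolding walk_layer_def using distinct_bs disjoint sh_mem[OF assms]
    by (intro run_parallel_cnots) auto
next
  assume "q \<notin> set bs"
  then show "run_cnots (walk_layer as bs e) st q = st q"
    by (intro run_cnots_outside) (auto simp: walk_layer_def)
qed

text \<open>The invariant of the sweep: when the walk stands at \<open>D\<close>, the target at
  position \<open>j\<close> has added the \<open>j\<close>-shifted copy of \<open>D\<close> to its
  loaded parity \<open>f j\<close>.\<close>

lemma run_walk:
  assumes "\<And>a. a \<in> set as \<Longrightarrow> st a = {a}" "set es \<subseteq> {..<length as}" "D \<subseteq> {..<length as}"
    and "\<And>j. j < length bs \<Longrightarrow> st (bs ! j) = f j \<triangle> sh j ` D" "j < length bs"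
  shows "run_cnots (concat (map (walk_layer as bs) es)) st (bs ! j) = f j \<triangle> sh j ` toggles es D"
  using assms
proof (induction es arbitrary: st D)
  case (Cons e es)
  let ?st = "run_cnots (walk_layer as bs e) st"
  have e: "e < length as"
    using Cons.prems by simp
  have as: "?st a = {a}" if "a \<in> set as" for a
    using run_walk_layer(2)[OF e, of a st] that disjoint Cons.prems(1) by (metis disjoint_iff)
  have bs: "?st (bs ! i) = f i \<triangle> sh i ` (D \<triangle> {e})" if "i < length bs" for i
  proof -
    have "sh i ` (D \<triangle> {e}) = sh i ` D \<triangle> {sh i e}"
      using image_symdiff[OF inj_on_subset[OF inj_sh[of i]], of D "{e}"] Cons.prems(3) e by simp
    moreover have "?st (bs ! i) = f i \<triangle> sh i ` D \<triangle> {sh i e}"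
      using run_walk_layer(1)[OF e that, of st] Cons.prems(1)[OF sh_mem[OF e, of i]]
        Cons.prems(4)[OF that] by metis
    ultimately show ?thesis
      by (simp add: symdiff_assoc)
  qed
  have "D \<triangle> {e} \<subseteq> {..<length as}"
    using Cons.prems(3) e by (auto simp: symdiff_def)
  then show ?case
    using Cons.IH[of ?st "D \<triangle> {e}"] as bs Cons.prems by simp
qed simp

lemma run_walk_outside:
  "q \<notin> set bs \<Longrightarrow> run_cnots (concat (map (walk_layer as bs) es)) st q = st q"
  by (intro run_cnots_outside) (auto simp: walk_layer_def)

lemma cnot_layers_walk:
  assumes "set es \<subseteq> {..<length as}" "set as \<union> set bs \<subseteq> R"
  shows "cnot_layers R (map (walk_layer as bs) es)"
  unfolding cnot_layers_def
proof
  fix L assume "L \<in> set (map (walk_layer as bs) es)"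
  then obtain e where e: "e < length as" and L: "L = walk_layer as bs e"
    using assms(1) by auto
  have sep: "sh j e \<noteq> bs ! i" if "i < length bs" for i j
    using sh_mem[OF e] disjoint that by (metis disjoint_iff nth_mem)
  moreover have "sh i e \<noteq> sh j e" if "i < j" "j < length bs" for i j
  proof -
    have "(i + e) mod length as \<noteq> (j + e) mod length as"
      using inj_onD[OF inj_on_add_mod[of e "length as"], of i j] that length_le by auto
    moreover have "0 < length as"
      using that length_le by linarith
    ultimately show ?thesis
      using distinct_as that by (subst nth_eq_iff_index_eq) (auto simp: add.commute)
  qed
  moreover have "bs ! i \<noteq> bs ! j" if "i < j" "j < length bs" for i j
    using distinct_bs that by (simp add: nth_eq_iff_index_eq)
  ultimately have "disjoint_cnots L"
    unfolding L walk_layer_def sorted_wrt_iff_nth_less using sep by auto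
  moreover have "cnots_on R L"
    unfolding L walk_layer_def cnots_on_def
    using sh_mem[OF e] assms(2) sep by auto
  ultimately show "cnots_on R L \<and> disjoint_cnots L"
    by blast
qed

end

text \<open>All qubits of \<open>B\<close> sweep at once, so the walk is paid for once for the whole
  family \<open>\<V>\<close>. Loading and unloading give the first summand of the bound; the second
  covers the walk and the extra empty layer.\<close>

lemma loopable_indep_sweep:
  assumes R: "finite R" "B \<subseteq> R" and card: "card B \<le> card (R - B)"
    and \<V>: "indep \<V>" "\<And>v. v \<in> \<V> \<Longrightarrow> v \<subseteq> B"
  shows "loopable R {V \<union> W | V W. V \<in> \<V> \<and> W \<subseteq> R - B \<and> card W \<le> s}
    (2 * (card B)\<^sup>2 + 2 * (\<Sum>i\<le>s. card (R - B) choose i))"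
proof -
  let ?A = "R - B"
  have B: "finite B"
    using R finite_subset by blast
  obtain as where as: "set as = ?A" "distinct as"
    using finite_distinct_list[of ?A] R(1) by blast
  obtain bs where bs: "set bs = B" "distinct bs"
    using finite_distinct_list[OF B] by blast
  have len: "length as = card ?A" "length bs = card B"
    using as bs distinct_card by metis+
  interpret subset_sweep as bs
    using as bs card len by unfold_locales auto
  have "finite \<V>"
    using \<V>(2) B finite_subset[of \<V> "Pow B"] by auto
  then obtain gs where gs: "cnots_on B gs" "length gs \<le> (card B)\<^sup>2" "\<V> \<subseteq> run_cnots gs init ` B"
    using prepare_indep[OF B _ \<V>] by blast
  let ?st = "run_cnots gs init"
  let ?es = "subset_walk (length as) s"
  let ?Ms = "map (walk_layer as bs) ?es"
  have st: "?st a = {a}" if "a \<in> set as" for a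
    using gs(1) that as(1) by (intro run_cnots_outside) (auto simp: cnots_on_def)
  have run: "run_cnots (concat (map (walk_layer as bs) es)) ?st (bs ! j)
      = ?st (bs ! j) \<triangle> sh j ` toggles es {}" if "set es \<subseteq> {..<length as}" "j < length bs" for es j
    using run_walk[of ?st es "{}" "\<lambda>j. ?st (bs ! j)" j] that st by simp
  have "run_cnots (concat ?Ms) ?st = ?st"
  proof
    fix q show "run_cnots (concat ?Ms) ?st q = ?st q"
    proof (cases "q \<in> set bs")
      case True
      then obtain j where "j < length bs" "q = bs ! j"
        by (metis in_set_conv_nth)
      then show ?thesis
        using run[of ?es j] set_subset_walk by (simp add: toggles_subset_walk)
    qed (rule run_walk_outside)
  qed
  moreover have "\<exists>i q. i \<le> length ?Ms \<and> q \<in> R \<and> run_cnots (concat (take i ?Ms)) ?st q = T"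
    if T: "T \<in> {V \<union> W | V W. V \<in> \<V> \<and> W \<subseteq> ?A \<and> card W \<le> s}" for T
  proof -
    obtain V W where VW: "T = V \<union> W" "V \<in> \<V>" "W \<subseteq> ?A" "card W \<le> s"
      using T by blast
    obtain j where j: "j < length bs" "?st (bs ! j) = V"
    proof -
      obtain b where "b \<in> set bs" "?st b = V"
        using gs(3) VW(2) bs(1) by blast
      then show ?thesis
        using that by (metis in_set_conv_nth)
    qed
    \<comment> \<open>\<open>W\<close> in the coordinates of target \<open>j\<close>. The shift is a
      bijection onto \<open>set as\<close>, so the size is unchanged and the walk reaches this
      set.\<close>
    let ?E = "{e. e < length as \<and> sh j e \<in> W}"
    have EW: "sh j ` ?E = W"
      using sh_image[of j] VW(3) as(1) by auto
    have "inj_on (sh j) ?E"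
      using inj_sh[of j] by (rule inj_on_subset) auto
    then have "card ?E = card W"
      using card_image[of "sh j" ?E] EW by simp
    then have "card ?E \<le> s"
      using VW(4) by simp
    then obtain i where i: "i \<le> length ?es" "toggles (take i ?es) {} = ?E"
      using subset_walk_visits[of ?E "length as" s "{}"] by auto
    have "set (take i ?es) \<subseteq> {..<length as}"
      using set_subset_walk set_take_subset by fast
    then have "run_cnots (concat (take i ?Ms)) ?st (bs ! j) = V \<triangle> W"
      using run[of "take i ?es" j] j i EW by (simp add: take_map)
    moreover have "V \<triangle> W = T"
      using VW \<V>(2) by (subst symdiff_disjoint) auto
    moreover have "bs ! j \<in> R"
      using j(1) bs(1) R(2) nth_mem by blast
    ultimately show ?thesis
      using i(1) by (intro exI[of _ i] exI[of _ "bs ! j"]) simp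
  qed
  moreover have "cnot_layers R ?Ms"
    using set_subset_walk as bs R(2) by (intro cnot_layers_walk) auto
  moreover have "cnots_on R gs"
    using gs(1) R(2) unfolding cnots_on_def by blast
  ultimately have "loopable R {V \<union> W | V W. V \<in> \<V> \<and> W \<subseteq> ?A \<and> card W \<le> s}
      (2 * length gs + length ?Ms + 1)"
    by (intro loopable_conjugate)
  then show ?thesis
    using length_subset_walk[of "length as" s] gs(2) len
    by (elim loopable_mono) auto
qed

section \<open>Independent families of sets\<close>

text \<open>Off-diagonal terms come in equal pairs. For products in a group algebra this is the rule
  for squaring a sum in characteristic 2.\<close>

lemma even_sum_symmetric:
  fixes g :: "'a \<Rightarrow> 'a \<Rightarrow> nat"
  assumes "finite A" "\<And>s t. g s t = g t s"
  shows "even (\<Sum>s\<in>A. \<Sum>t\<in>A. g s t) \<longleftrightarrow> even (\<Sum>s\<in>A. g s s)"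
  using assms(1)
proof (induction A rule: finite_induct)
  case (insert a A)
  have "(\<Sum>s\<in>A. g s a) = (\<Sum>t\<in>A. g a t)"
    by (intro sum.cong refl assms(2))
  then have eq: "(\<Sum>s\<in>insert a A. \<Sum>t\<in>insert a A. g s t)
      = g a a + 2 * (\<Sum>t\<in>A. g a t) + (\<Sum>s\<in>A. \<Sum>t\<in>A. g s t)"
    using insert(1,2) by (simp add: sum.distrib)
  show ?case
    unfolding eq using insert by simp
qed simp

text \<open>The subsets of \<open>{..<r}\<close> under \<open>\<triangle>\<close> serve as the elementary abelian group of order \<open>2 ^ r\<close>; the
  coordinate \<open>j\<close> splits it into the two cosets \<open>{x. (j \<in> x) = c}\<close>.\<close>

definition translate :: "nat set \<Rightarrow> nat set set \<Rightarrow> nat set set" where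
  "translate i T = (\<lambda>t. t \<triangle> i) ` T"

lemma mem_translate: "x \<in> translate i T \<longleftrightarrow> x \<triangle> i \<in> T"
  unfolding translate_def by (metis (no_types, lifting) image_iff symdiff_self(2))

lemma translate_translate: "translate i (translate k T) = translate (i \<triangle> k) T"
  by (rule Set.set_eqI) (simp add: mem_translate symdiff_assoc)

lemma translate_empty [simp]: "translate {} T = T"
  by (simp add: translate_def)

lemma inj_symdiff: "inj_on (\<lambda>t. t \<triangle> i) A"
  by (rule inj_onI) (metis symdiff_self(2))

lemma card_translate [simp]: "card (translate i T) = card T"
  unfolding translate_def by (intro card_image inj_symdiff)

text \<open>In the group algebra over \<open>F\<^sub>2\<close> the square of a set with an odd number of elements is 1.
  Multiplying a vanishing sum of translates, restricted to a coset, by the part of \<open>T\<close> in that coset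
  therefore recovers the set of translations.\<close>

lemma translates_independent:
  assumes T: "finite T" "odd (card {x \<in> T. (j \<in> x) = c})"
    and I: "finite I" "\<And>i. i \<in> I \<Longrightarrow> j \<notin> i"
    and even: "\<And>x. even (card {i \<in> I. x \<in> translate i T})"
  shows "I = {}"
proof (rule ccontr)
  assume "I \<noteq> {}"
  then obtain y where y: "y \<in> I"
    by blast
  let ?T = "{x \<in> T. (j \<in> x) = c}"
  have "even (\<Sum>t\<in>?T. of_bool (y \<triangle> s \<triangle> t \<in> I) :: nat)" if s: "s \<in> ?T" for s
  proof -
    \<comment> \<open>Neither \<open>y\<close> nor the translations in \<open>I\<close> contain
      \<open>j\<close>, so \<open>y \<triangle> s \<triangle> i\<close> lies in the same half as
      \<open>s\<close>: membership in \<open>T\<close> already gives membership in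
      \<open>?T\<close>.\<close>
    have "bij_betw (\<lambda>i. y \<triangle> s \<triangle> i) {i \<in> I. y \<triangle> s \<in> translate i T} {t \<in> ?T. y \<triangle> s \<triangle> t \<in> I}"
    proof (rule bij_betwI[where g = "\<lambda>t. y \<triangle> s \<triangle> t"])
      show "(\<lambda>i. y \<triangle> s \<triangle> i) \<in> {i \<in> I. y \<triangle> s \<in> translate i T} \<rightarrow> {t \<in> ?T. y \<triangle> s \<triangle> t \<in> I}"
        using s y I(2) by (auto simp: mem_translate mem_symdiff symdiff_ac)
      show "(\<lambda>t. y \<triangle> s \<triangle> t) \<in> {t \<in> ?T. y \<triangle> s \<triangle> t \<in> I} \<rightarrow> {i \<in> I. y \<triangle> s \<in> translate i T}"
        by (auto simp: mem_translate symdiff_ac)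
    qed (simp_all add: symdiff_ac)
    note bij_betw_same_card[OF this, symmetric]
    moreover have "(\<Sum>t\<in>?T. of_bool (y \<triangle> s \<triangle> t \<in> I) :: nat) = card {t \<in> ?T. y \<triangle> s \<triangle> t \<in> I}"
      using T(1) by (simp add: sum.If_cases of_bool_def Int_def)
    ultimately show ?thesis
      using even[of "y \<triangle> s"] by simp
  qed
  then have "even (\<Sum>s\<in>?T. \<Sum>t\<in>?T. of_bool (y \<triangle> s \<triangle> t \<in> I) :: nat)"
    by (rule dvd_sum)
  moreover have "(of_bool (y \<triangle> s \<triangle> t \<in> I) :: nat) = of_bool (y \<triangle> t \<triangle> s \<in> I)" for s t
    by (simp add: symdiff_ac)
  \<comment> \<open>On the diagonal \<open>y \<triangle> s \<triangle> s = y\<close> lies in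
    \<open>I\<close>, so this sum is the odd number \<open>card ?T\<close>.\<close>
  ultimately have "even (\<Sum>s\<in>?T. of_bool (y \<triangle> s \<triangle> s \<in> I) :: nat)"
    using even_sum_symmetric[of ?T "\<lambda>s t. of_bool (y \<triangle> s \<triangle> t \<in> I)"] T(1) by simp
  then show False
    using T(2) y by simp
qed

text \<open>Two equal translates by different elements would already form a vanishing sum.\<close>

lemma inj_on_translate:
  assumes T: "finite T" "odd (card {x \<in> T. (j \<in> x) = c})" and H: "\<And>i. i \<in> H \<Longrightarrow> j \<notin> i"
  shows "inj_on (\<lambda>i. translate i T) H"
proof (rule inj_onI, rule ccontr)
  fix i k assume ik: "i \<in> H" "k \<in> H" "translate i T = translate k T" "i \<noteq> k"
  have "{l \<in> {i, k}. x \<in> translate l T} = (if x \<in> translate i T then {i, k} else {})" for x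
    using ik(3) by auto
  then have "even (card {l \<in> {i, k}. x \<in> translate l T})" for x
    using ik(4) by simp
  then show False
    using translates_independent[OF T, of "{i, k}"] ik H by auto
qed

lemma indep_translates:
  assumes T: "finite T" "odd (card {x \<in> T. (j \<in> x) = c})" and H: "finite H" "\<And>i. i \<in> H \<Longrightarrow> j \<notin> i"
  shows "indep ((\<lambda>i. translate i T) ` H)"
  unfolding indep_def
proof (intro allI impI)
  fix \<S> assume \<S>: "\<S> \<subseteq> (\<lambda>i. translate i T) ` H" "\<forall>x. even (card {S \<in> \<S>. x \<in> S})"
  from \<S>(1)[unfolded subset_image_inj]
  obtain I where I: "I \<subseteq> H" "inj_on (\<lambda>i. translate i T) I" "\<S> = (\<lambda>i. translate i T) ` I"
    by blast
  have "even (card {i \<in> I. x \<in> translate i T})" for x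
  proof -
    have "{S \<in> \<S>. x \<in> S} = (\<lambda>i. translate i T) ` {i \<in> I. x \<in> translate i T}"
      using I(3) by auto
    then have "card {S \<in> \<S>. x \<in> S} = card {i \<in> I. x \<in> translate i T}"
      using I(2) by (simp add: card_image inj_on_def)
    then show ?thesis
      using spec[OF \<S>(2), of x] by simp
  qed
  moreover have "finite I"
    using I(1) H(1) finite_subset by blast
  ultimately have "I = {}"
    using translates_independent[OF T, of I] I(1) H(2) by blast
  then show "\<S> = {}"
    using I(3) by simp
qed

text \<open>The half \<open>c\<close> is left open because translation by a set containing
  \<open>j\<close> exchanges the two halves; only the disjunction is invariant.\<close>

definition odd_at :: "nat set set \<Rightarrow> nat \<Rightarrow> bool" where
  "odd_at T j \<longleftrightarrow> (\<exists>c. odd (card {x \<in> T. (j \<in> x) = c}))"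

lemma odd_at_translate [simp]: "odd_at (translate i T) j = odd_at T j"
proof -
  have card: "card {x \<in> translate i T. (j \<in> x) = c} = card {x \<in> T. (j \<in> x) = (c = (j \<notin> i))}" for c
  proof -
    have "{x \<in> translate i T. (j \<in> x) = c} = (\<lambda>t. t \<triangle> i) ` {x \<in> T. (j \<in> x) = (c = (j \<notin> i))}"
      unfolding translate_def by (auto simp: mem_symdiff)
    then show ?thesis
      by (simp add: card_image inj_symdiff)
  qed
  show ?thesis
  proof (cases "j \<in> i")
    case True
    then have "odd_at (translate i T) j \<longleftrightarrow> (\<exists>c. odd (card {x \<in> T. (j \<in> x) = (\<not> c)}))"
      unfolding odd_at_def card by simp
    then show ?thesis
      unfolding odd_at_def ex_bool_eq by auto
  next
    case False
    then show ?thesis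
      unfolding odd_at_def card by simp
  qed
qed

text \<open>An orbit under the translations that avoid one odd coordinate. The least such coordinate
  depends only on \<open>odd_at\<close>, which translations preserve, so all members of an orbit
  select the same subgroup and distinct orbits are disjoint.\<close>

definition orbit :: "nat \<Rightarrow> nat set set \<Rightarrow> nat set set set" where
  "orbit r T = (\<lambda>i. translate i T) ` Pow ({..<r} - {LEAST j. j < r \<and> odd_at T j})"

lemma orbit_eq:
  assumes "S \<in> orbit r T"
  shows "orbit r S = orbit r T"
proof -
  let ?H = "Pow ({..<r} - {LEAST j. j < r \<and> odd_at T j})"
  obtain i where i: "i \<in> ?H" "S = translate i T"
    using assms unfolding orbit_def by blast
  then have "orbit r S = (\<lambda>k. translate k T) ` (\<lambda>k. k \<triangle> i) ` ?H"
    unfolding orbit_def by (simp add: image_image translate_translate)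
  also have "(\<lambda>k. k \<triangle> i) ` ?H = ?H"
  proof
    show "(\<lambda>k. k \<triangle> i) ` ?H \<subseteq> ?H"
      using i(1) by (auto simp: symdiff_def)
    show "?H \<subseteq> (\<lambda>k. k \<triangle> i) ` ?H"
    proof
      fix k assume "k \<in> ?H"
      then have "k = (k \<triangle> i) \<triangle> i" "k \<triangle> i \<in> ?H"
        using i(1) by (auto simp: symdiff_def)
      then show "k \<in> (\<lambda>k. k \<triangle> i) ` ?H"
        by blast
    qed
  qed
  finally show ?thesis
    unfolding orbit_def .
qed

lemma orbit_self: "T \<in> orbit r T"
  unfolding orbit_def by (rule image_eqI[of _ _ "{}"]) auto

lemma orbit_props:
  assumes "T \<subseteq> Pow {..<r}" "\<exists>j<r. odd_at T j"
  shows "indep (orbit r T)" and "2 * card (orbit r T) = 2 ^ r"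
    and "S \<in> orbit r T \<Longrightarrow> S \<subseteq> Pow {..<r} \<and> card S = card T \<and> (\<exists>j<r. odd_at S j)"
proof -
  let ?j = "LEAST j. j < r \<and> odd_at T j"
  have "?j < r \<and> odd_at T ?j"
    by (rule LeastI_ex) (rule assms(2))
  then obtain c where c: "?j < r" "odd (card {x \<in> T. (?j \<in> x) = c})"
    unfolding odd_at_def by blast
  have fin: "finite T"
    using assms(1) finite_subset by blast
  have H: "i \<in> Pow ({..<r} - {?j}) \<Longrightarrow> ?j \<notin> i" for i
    by blast
  show "indep (orbit r T)"
    unfolding orbit_def by (rule indep_translates[OF fin c(2) _ H]) auto
  have "card (orbit r T) = 2 ^ (r - 1)"
    unfolding orbit_def using c(1)
    by (subst card_image[OF inj_on_translate[OF fin c(2) H]]) (auto simp: card_Pow)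
  then show "2 * card (orbit r T) = 2 ^ r"
    using c(1) by (cases r) auto
  show "S \<in> orbit r T \<Longrightarrow> S \<subseteq> Pow {..<r} \<and> card S = card T \<and> (\<exists>j<r. odd_at S j)"
  proof -
    assume "S \<in> orbit r T"
    then obtain i where i: "i \<subseteq> {..<r}" "S = translate i T"
      unfolding orbit_def by blast
    have "S \<subseteq> Pow {..<r}"
      using assms(1) i by (auto simp: translate_def symdiff_def)
    then show ?thesis
      using assms(2) i(2) by simp
  qed
qed

text \<open>With both halves even for every coordinate, the elements of \<open>T\<close> sum to
  zero; each is therefore determined by the others.\<close>

lemma unbalanced_subset_unique:
  assumes "T \<subseteq> Pow {..<r}" "\<And>j. j < r \<Longrightarrow> \<not> odd_at T j" "t \<in> T"
  shows "t = par_sum id (T - {t})"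
proof (rule Set.set_eqI)
  fix j
  have fin: "finite T"
    using assms(1) finite_subset by blast
  show "j \<in> t \<longleftrightarrow> j \<in> par_sum id (T - {t})"
  proof (cases "j < r")
    case True
    then have "even (card {x \<in> T. j \<in> x})"
      using assms(2)[of j] unfolding odd_at_def ex_bool_eq by simp
    moreover have "{x \<in> T. j \<in> x} = (if j \<in> t then insert t {x \<in> T - {t}. j \<in> x} else {x \<in> T - {t}. j \<in> x})"
      using assms(3) by auto
    moreover have "card (insert t {x \<in> T - {t}. j \<in> x}) = Suc (card {x \<in> T - {t}. j \<in> x})"
      using fin by (intro card_insert_disjoint) auto
    ultimately show ?thesis
      by (auto simp: par_sum_def split: if_splits)
  next
    case False
    then have "{x \<in> T - {t}. j \<in> x} = {}" "j \<notin> t"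
      using assms(1,3) by auto
    then show ?thesis
      by (simp add: par_sum_def del: Collect_empty_eq)
  qed
qed

text \<open>By \<open>unbalanced_subset_unique\<close>, a pair of an exceptional set and one of its
  elements is recovered after deleting the element, so \<open>b\<close> times the number of these
  sets is at most \<open>2 ^ r choose (b - 1)\<close>. Absorption turns this into the bound
  \<open>2 ^ r choose b\<close> for the multiple by \<open>2 ^ r - b + 1\<close>; the two multiples
  add up to more than \<open>2 ^ r\<close>.\<close>

lemma card_unbalanced_subsets:
  assumes "1 \<le> b"
  shows "2 ^ r * card {T. T \<subseteq> Pow {..<r} \<and> card T = b \<and> (\<forall>j<r. \<not> odd_at T j)}
    \<le> ((2 ^ r) choose b) + ((2 ^ r) choose (b - 1))"
proof (cases "b \<le> 2 ^ r")
  case True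
  let ?p = "2 ^ r :: nat"
  let ?\<B> = "{T. T \<subseteq> Pow {..<r} \<and> card T = b \<and> (\<forall>j<r. \<not> odd_at T j)}"
  let ?\<N> = "{S. S \<subseteq> Pow {..<r :: nat} \<and> card S = b - 1}"
  have fin: "finite T" if "T \<subseteq> Pow {..<r}" for T
    using that finite_subset by blast
  have fins: "finite ?\<B>" "finite ?\<N>"
    by (rule finite_subset[of _ "Pow (Pow {..<r})"]; auto)+
  have "b * card ?\<B> = (\<Sum>T\<in>?\<B>. card T)"
    by simp
  also have "\<dots> = card (Sigma ?\<B> (\<lambda>T. T))"
    using fins fin by (subst card_SigmaI) auto
  also have "\<dots> \<le> card ?\<N>"
  proof (rule card_inj_on_le[where f = "\<lambda>(T, t). T - {t}"])
    show "inj_on (\<lambda>(T, t). T - {t}) (Sigma ?\<B> (\<lambda>T. T))"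
    proof (rule inj_onI, clarify)
      fix T t S s assume "T - {t} = S - {s}" and *: "T \<subseteq> Pow {..<r}" "\<forall>j<r. \<not> odd_at T j" "t \<in> T"
        "S \<subseteq> Pow {..<r}" "\<forall>j<r. \<not> odd_at S j" "s \<in> S"
      moreover from this have "t = s"
        using unbalanced_subset_unique[of T r t] unbalanced_subset_unique[of S r s] by simp
      ultimately show "T = S \<and> t = s"
        by blast
    qed
    show "(\<lambda>(T, t). T - {t}) ` Sigma ?\<B> (\<lambda>T. T) \<subseteq> ?\<N>"
      using fin by auto
  qed (rule fins)
  also have "\<dots> = (?p choose (b - 1))"
    by (subst n_subsets) (auto simp: card_Pow)
  finally have 1: "b * card ?\<B> \<le> (?p choose (b - 1))" .
  have "b * ((?p - b + 1) * card ?\<B>) \<le> (?p - b + 1) * (?p choose (b - 1))"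
    using mult_le_mono2[OF 1, of "?p - b + 1"] by (simp add: ac_simps)
  also have "\<dots> = b * (?p choose b)"
  proof -
    have "?p - b + 1 = ?p - (b - 1)"
      using assms True by simp
    then show ?thesis
      using binomial_absorb_comp[of ?p "b - 1"] times_binomial_minus1_eq[of b ?p] assms by simp
  qed
  finally have 2: "(?p - b + 1) * card ?\<B> \<le> (?p choose b)"
    using assms by simp
  have "?p * card ?\<B> \<le> (b + (?p - b + 1)) * card ?\<B>"
    using True by (intro mult_le_mono1) simp
  then show ?thesis
    using 1 2 unfolding add_mult_distrib by linarith
next
  case False
  have empty: "{T. T \<subseteq> Pow {..<r} \<and> card T = b \<and> (\<forall>j<r. \<not> odd_at T j)} = {}"
    using False card_mono[of "Pow {..<r}"] by (auto simp: card_Pow)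
  show ?thesis
    unfolding empty by simp
qed

lemma indep_singleton: "T \<noteq> {} \<Longrightarrow> indep {T}"
  unfolding indep_def
proof (intro allI impI)
  fix \<S> assume T: "T \<noteq> {}" and \<S>: "\<S> \<subseteq> {T}" "\<forall>x. even (card {S \<in> \<S>. x \<in> S})"
  obtain x where x: "x \<in> T"
    using T by blast
  show "\<S> = {}"
  proof (rule ccontr)
    assume "\<S> \<noteq> {}"
    then have "{S \<in> \<S>. x \<in> S} = {T}"
      using \<S>(1) x by blast
    then show False
      using \<S>(2) by (metis card.empty card_insert_disjoint empty_iff finite.emptyI odd_one One_nat_def)
  qed
qed

text \<open>Disjoint orbits of size \<open>2 ^ r / 2\<close> account for the coefficient 2; the
  exceptional sets, taken as singleton families, raise it to 3 and contribute the last
  summand.\<close>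

lemma indep_cover_cube:
  assumes "1 \<le> b"
  shows "\<exists>\<F>. finite \<F> \<and> (\<forall>\<V>\<in>\<F>. indep \<V>) \<and> \<Union>\<F> = {T. T \<subseteq> Pow {..<r :: nat} \<and> card T = b} \<and>
    2 ^ r * card \<F> \<le> 3 * ((2 ^ r) choose b) + ((2 ^ r) choose (b - 1))"
proof -
  let ?p = "2 ^ r :: nat"
  let ?\<N> = "{T. T \<subseteq> Pow {..<r :: nat} \<and> card T = b}"
  let ?\<G> = "{T \<in> ?\<N>. \<exists>j<r. odd_at T j}"
  let ?\<B> = "{T. T \<subseteq> Pow {..<r} \<and> card T = b \<and> (\<forall>j<r. \<not> odd_at T j)}"
  let ?\<O> = "orbit r ` ?\<G>"
  let ?\<F> = "?\<O> \<union> (\<lambda>T. {T}) ` ?\<B>"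
  have fins: "finite ?\<N>" "finite ?\<B>" "finite ?\<G>"
    by (rule finite_subset[of _ "Pow (Pow {..<r})"]; auto)+
  have UO: "\<Union>?\<O> = ?\<G>"
  proof
    show "\<Union>?\<O> \<subseteq> ?\<G>"
    proof
      fix S assume "S \<in> \<Union>?\<O>"
      then obtain T where "T \<in> ?\<G>" "S \<in> orbit r T"
        by blast
      then show "S \<in> ?\<G>"
        using orbit_props(3)[of T r S] by simp
    qed

    show "?\<G> \<subseteq> \<Union>?\<O>"
      using orbit_self by blast
  qed
  have "card (\<Union>?\<O>) = sum card ?\<O>"
  proof (rule card_Union_disjoint)
    show "pairwise disjnt ?\<O>"
    proof (rule pairwiseI)
      fix P Q assume "P \<in> ?\<O>" "Q \<in> ?\<O>" "P \<noteq> Q"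
      moreover from this obtain S T where ST: "P = orbit r S" "Q = orbit r T"
        by blast
      ultimately have "x \<notin> orbit r S \<inter> orbit r T" for x
        using orbit_eq[of x r S] orbit_eq[of x r T] by auto
      then show "disjnt P Q"
        unfolding disjnt_def ST by blast
    qed
    show "\<And>A. A \<in> ?\<O> \<Longrightarrow> finite A"
      unfolding orbit_def by auto
  qed
  then have "2 * card ?\<G> = (\<Sum>P\<in>?\<O>. 2 * card P)"
    unfolding UO by (simp add: sum_distrib_left)
  also have "\<dots> = (\<Sum>P\<in>?\<O>. ?p)"
    using orbit_props(2) by (intro sum.cong) auto
  finally have "?p * card ?\<O> = 2 * card ?\<G>"
    by simp
  also have "\<dots> \<le> 2 * card ?\<N>"
    using fins by (intro mult_le_mono2 card_mono) auto
  also have "card ?\<N> = (?p choose b)"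
    by (subst n_subsets) (auto simp: card_Pow)
  finally have 1: "?p * card ?\<O> \<le> 2 * (?p choose b)" .
  have "card ?\<F> \<le> card ?\<O> + card ((\<lambda>T. {T}) ` ?\<B>)"
    by (rule card_Un_le)
  also have "card ((\<lambda>T. {T}) ` ?\<B>) \<le> card ?\<B>"
    using fins by (intro card_image_le)
  finally have "?p * card ?\<F> \<le> ?p * card ?\<O> + ?p * card ?\<B>"
    by (simp add: add_mult_distrib2[symmetric])
  then have F1: "?p * card ?\<F> \<le> 3 * (?p choose b) + (?p choose (b - 1))"
    using 1 card_unbalanced_subsets[OF assms, of r] by linarith
  have F2: "\<Union>?\<F> = ?\<N>"
    unfolding Union_Un_distrib UO by auto
  \<comment> \<open>\<open>1 \<le> b\<close> makes the exceptional sets nonempty; the family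
    consisting of the empty set alone would be dependent.\<close>
  have F3: "indep \<V>" if "\<V> \<in> ?\<F>" for \<V>
    using that orbit_props(1) assms by (auto intro!: indep_singleton)
  have F4: "finite ?\<F>"
    using fins by auto
  show ?thesis
    by (intro exI[of _ ?\<F>] conjI ballI F1 F2 F3 F4)
qed

lemma indep_image:
  assumes "indep \<V>" "inj_on f (\<Union>\<V>)"
  shows "indep ((`) f ` \<V>)"
  unfolding indep_def
proof (intro allI impI)
  fix \<S> assume \<S>: "\<S> \<subseteq> (`) f ` \<V>" "\<forall>x. even (card {S \<in> \<S>. x \<in> S})"
  let ?\<S> = "{V \<in> \<V>. f ` V \<in> \<S>}"
  have inj: "inj_on ((`) f) \<V>"
    using assms(2) by (meson PowI Union_upper inj_on_image_Pow inj_on_subset subsetI)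
  have "even (card {S \<in> ?\<S>. x \<in> S})" for x
  proof (cases "x \<in> \<Union>\<V>")
    case True
    have mem: "f x \<in> f ` V \<longleftrightarrow> x \<in> V" if "V \<in> \<V>" for V
      using inj_on_image_mem_iff[OF assms(2) True] that by blast
    have "(`) f ` {S \<in> ?\<S>. x \<in> S} = {S \<in> \<S>. f x \<in> S}"
    proof
      show "{S \<in> \<S>. f x \<in> S} \<subseteq> (`) f ` {S \<in> ?\<S>. x \<in> S}"
      proof
        fix S assume S: "S \<in> {S \<in> \<S>. f x \<in> S}"
        then obtain V where V: "V \<in> \<V>" "S = f ` V"
          using \<S>(1) by blast
        then have "V \<in> {S \<in> ?\<S>. x \<in> S}"
          using S mem[OF V(1)] by simp
        then show "S \<in> (`) f ` {S \<in> ?\<S>. x \<in> S}"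
          using V(2) by blast
      qed
    qed auto
    moreover have "inj_on ((`) f) {S \<in> ?\<S>. x \<in> S}"
      using inj by (rule inj_on_subset) auto
    ultimately show ?thesis
      using spec[OF \<S>(2), of "f x"] card_image[of "(`) f" "{S \<in> ?\<S>. x \<in> S}"] by simp
  next
    case False
    then have empty: "{S \<in> ?\<S>. x \<in> S} = {}"
      by blast
    show ?thesis
      unfolding empty by simp
  qed
  moreover have "?\<S> \<subseteq> \<V>"
    by blast
  ultimately have "?\<S> = {}"
    using assms(1) unfolding indep_def by presburger
  then have "\<And>V. V \<in> \<V> \<Longrightarrow> f ` V \<notin> \<S>"
    by blast
  then show "\<S> = {}"
    using \<S>(1) by (auto simp: subset_iff)
qed

text \<open>Only sizes and independence enter, so any bijection between the group and
  \<open>B\<close> transports the cover.\<close>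

lemma indep_cover:
  fixes B :: "'a set"
  assumes "1 \<le> b" "card B = 2 ^ r"
  shows "\<exists>\<F>. finite \<F> \<and> (\<forall>\<V>\<in>\<F>. indep \<V>) \<and> \<Union>\<F> = {T. T \<subseteq> B \<and> card T = b} \<and>
    card B * card \<F> \<le> 3 * (card B choose b) + (card B choose (b - 1))"
proof -
  let ?G = "Pow {..<r}"
  have "finite B"
    using assms(2) card.infinite by fastforce
  then obtain f where f: "bij_betw f ?G B"
    using assms(2) finite_same_card_bij[of ?G B] by (auto simp: card_Pow)
  from indep_cover_cube[OF assms(1), of r] obtain \<F>
    where *: "finite \<F> \<and> (\<forall>\<V>\<in>\<F>. indep \<V>) \<and> \<Union>\<F> = {T. T \<subseteq> ?G \<and> card T = b} \<and>
      2 ^ r * card \<F> \<le> 3 * ((2 ^ r) choose b) + ((2 ^ r) choose (b - 1))" ..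
  then have \<F>: "finite \<F>" "\<And>\<V>. \<V> \<in> \<F> \<Longrightarrow> indep \<V>" "\<Union>\<F> = {T. T \<subseteq> ?G \<and> card T = b}"
      "2 ^ r * card \<F> \<le> 3 * ((2 ^ r) choose b) + ((2 ^ r) choose (b - 1))"
    by simp_all
  let ?\<F> = "(`) ((`) f) ` \<F>"
  have inj: "inj_on f ?G" and im: "f ` ?G = B"
    using f by (auto simp: bij_betw_def)
  have "indep \<V>" if "\<V> \<in> ?\<F>" for \<V>
  proof -
    from that obtain \<W> where \<W>: "\<W> \<in> \<F>" "\<V> = (`) f ` \<W>"
      by (rule imageE)
    then have "\<Union>\<W> \<subseteq> ?G"
      using \<F>(3) by blast
    then show ?thesis
      using \<W> \<F>(2) inj by (auto intro!: indep_image intro: inj_on_subset)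
  qed
  moreover have "\<Union>?\<F> = {T. T \<subseteq> B \<and> card T = b}"
  proof -
    have "\<Union>?\<F> = (`) f ` {T. T \<subseteq> ?G \<and> card T = b}"
      unfolding \<F>(3)[symmetric] by blast
    also have "\<dots> = {T. T \<subseteq> B \<and> card T = b}"
    proof
      show "(`) f ` {T. T \<subseteq> ?G \<and> card T = b} \<subseteq> {T. T \<subseteq> B \<and> card T = b}"
        using inj im by (auto simp: card_image inj_on_subset)
      show "{T. T \<subseteq> B \<and> card T = b} \<subseteq> (`) f ` {T. T \<subseteq> ?G \<and> card T = b}"
      proof
        fix T assume T: "T \<in> {T. T \<subseteq> B \<and> card T = b}"
        then have "T \<subseteq> f ` ?G"
          using im by simp
        from this[unfolded subset_image_inj] obtain S where "S \<subseteq> ?G" "inj_on f S" "T = f ` S"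
          by blast
        then show "T \<in> (`) f ` {T. T \<subseteq> ?G \<and> card T = b}"
          using T by (auto simp: card_image)
      qed
    qed
    finally show ?thesis .
  qed
  moreover have "card B * card ?\<F> \<le> 3 * (card B choose b) + (card B choose (b - 1))"
    unfolding assms(2)
    by (rule order_trans[OF mult_le_mono2[OF card_image_le[OF \<F>(1)]] \<F>(4)])
  ultimately show ?thesis
    using \<F>(1) by (intro exI[of _ ?\<F>]) blast
qed

section \<open>Visiting all small sets\<close>

text \<open>Both sides count the subsets of size at most \<open>k\<close> of a disjoint union, on
  the left by the size of the trace on the part with \<open>p\<close> elements.\<close>

lemma sum_binomial_split:
  "(\<Sum>b\<le>k. (p choose b) * (\<Sum>i\<le>k - b. q choose i)) = (\<Sum>i\<le>k. (p + q) choose i)"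
proof -
  have "(\<Sum>i\<le>k. (p + q) choose i) = (\<Sum>i\<le>k. \<Sum>b\<le>i. (p choose b) * (q choose (i - b)))"
    by (simp add: vandermonde)
  also have "\<dots> = (\<Sum>(b, i)\<in>{(b, i). b + i \<le> k}. (p choose b) * (q choose i))"
    by (simp add: sum.triangle_reindex_eq)
  also have "{(b, i). b + i \<le> k} = Sigma {..k} (\<lambda>b. {..k - b})"
    by auto
  also have "(\<Sum>(b, i)\<in>Sigma {..k} (\<lambda>b. {..k - b}). (p choose b) * (q choose i))
      = (\<Sum>b\<le>k. (p choose b) * (\<Sum>i\<le>k - b. q choose i))"
    by (simp add: sum.Sigma[symmetric] sum_distrib_left)
  finally show ?thesis ..
qed

text \<open>Lets a walk pay for the quadratic loading: the subsets of size at most 2 alone number at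
  least half the square of \<open>q\<close>.\<close>

lemma square_le_sum_binomial:
  assumes "p \<le> q" "2 \<le> s"
  shows "p\<^sup>2 \<le> 2 * (\<Sum>i\<le>s. q choose i)"
proof -
  have "(\<Sum>i\<le>2. q choose i) \<le> (\<Sum>i\<le>s. q choose i)"
    using assms(2) by (intro sum_mono2) auto
  moreover have "(\<Sum>i\<le>2. q choose i) = 1 + q + (q choose 2)"
    by (simp add: numeral_2_eq_2)
  moreover have "q * (q - 1) = 2 * (q choose 2)"
    using times_binomial_minus1_eq[of 2 q] by simp
  moreover have "p\<^sup>2 \<le> q\<^sup>2"
    using assms(1) by (simp add: power2_eq_square mult_le_mono)
  moreover have "q\<^sup>2 = q * (q - 1) + q"
    by (cases q) (auto simp: power2_eq_square)
  ultimately show ?thesis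
    by linarith
qed

abbreviation crossing :: "nat \<Rightarrow> 'a set \<Rightarrow> 'a set \<Rightarrow> 'a set set" where
  "crossing k R B \<equiv> {T. T \<subseteq> R \<and> card T \<le> k \<and> T \<inter> B \<noteq> {} \<and> 2 \<le> card (T - B)}"

text \<open>Sets are sorted by the size \<open>b\<close> of their trace on \<open>B\<close>. Roughly
  \<open>(card B choose b) / card B\<close> families suffice for each \<open>b\<close>, and by
  \<open>sum_binomial_split\<close> the walks of depth \<open>k - b\<close> add up to the number of
  all small sets, divided by \<open>card B\<close>.\<close>

lemma loopable_window:
  fixes R B :: "'a set"
  assumes R: "finite R" "B \<subseteq> R" and B: "card B = 2 ^ r" "card B \<le> card (R - B)" and k: "2 \<le> k"
  shows "\<exists>l. loopable R (crossing k R B) l \<and>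
    card B * l \<le> 24 * (\<Sum>i\<le>k. card R choose i)"
proof -
  let ?p = "card B" and ?q = "card (R - B)"
  let ?W = "\<lambda>s. \<Sum>i\<le>s. ?q choose i"
  \<comment> \<open>\<open>b \<ge> 1\<close> because \<open>T\<close> meets \<open>B\<close>, and
    \<open>b \<le> k - 2\<close> because two elements lie outside.\<close>
  let ?b = "{1..k - 2}"
  let ?\<S> = "\<lambda>\<V> s. {V \<union> W | V W. V \<in> \<V> \<and> W \<subseteq> R - B \<and> card W \<le> s}"
  have finB: "finite B"
    using R finite_subset by blast
  have R_card: "card R = ?p + ?q"
    using R finB by (metis card_Diff_subset card_mono le_add_diff_inverse)
  have "\<forall>b\<in>?b. \<exists>\<F>. finite \<F> \<and> (\<forall>\<V>\<in>\<F>. indep \<V>) \<and> \<Union>\<F> = {T. T \<subseteq> B \<and> card T = b} \<and>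
      ?p * card \<F> \<le> 3 * (?p choose b) + (?p choose (b - 1))"
    using indep_cover[of _ B r] B(1) by auto
  from bchoice[OF this] obtain \<F> where "\<forall>b\<in>?b. finite (\<F> b) \<and> (\<forall>\<V>\<in>\<F> b. indep \<V>) \<and>
      \<Union>(\<F> b) = {T. T \<subseteq> B \<and> card T = b} \<and> ?p * card (\<F> b) \<le> 3 * (?p choose b) + (?p choose (b - 1))" ..
  then have \<F>: "\<And>b. b \<in> ?b \<Longrightarrow> finite (\<F> b)" "\<And>b \<V>. b \<in> ?b \<Longrightarrow> \<V> \<in> \<F> b \<Longrightarrow> indep \<V>"
      "\<And>b. b \<in> ?b \<Longrightarrow> \<Union>(\<F> b) = {T. T \<subseteq> B \<and> card T = b}"
      "\<And>b. b \<in> ?b \<Longrightarrow> ?p * card (\<F> b) \<le> 3 * (?p choose b) + (?p choose (b - 1))"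
    by simp_all
  \<comment> \<open>\<open>6 = 4 + 2\<close>: since \<open>k - b \<ge> 2\<close>, the loading term
    \<open>2 * ?p\<^sup>2\<close> is at most \<open>4 * ?W (k - b)\<close>.\<close>
  have sweep: "loopable R (?\<S> \<V> (k - b)) (6 * ?W (k - b))" if b: "b \<in> ?b" and \<V>: "\<V> \<in> \<F> b" for b \<V>
  proof -
    have "v \<subseteq> B" if "v \<in> \<V>" for v
      using \<F>(3)[OF b] \<V> that by blast
    then have "loopable R (?\<S> \<V> (k - b)) (2 * ?p\<^sup>2 + 2 * ?W (k - b))"
      using \<F>(2)[OF b \<V>] R B(2) by (intro loopable_indep_sweep) auto
    moreover have "?p\<^sup>2 \<le> 2 * ?W (k - b)"
      using b B(2) by (intro square_le_sum_binomial) auto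
    ultimately show ?thesis
      by (elim loopable_mono) auto
  qed
  let ?l = "\<Sum>b\<in>?b. card (\<F> b) * (6 * ?W (k - b))"
  have "loopable R (\<Union>b\<in>?b. \<Union>\<V>\<in>\<F> b. ?\<S> \<V> (k - b)) ?l"
  proof (rule loopable_UN)
    fix b assume b: "b \<in> ?b"
    have "loopable R (\<Union>\<V>\<in>\<F> b. ?\<S> \<V> (k - b)) (\<Sum>\<V>\<in>\<F> b. 6 * ?W (k - b))"
      using \<F>(1)[OF b] sweep[OF b] by (rule loopable_UN)
    then show "loopable R (\<Union>\<V>\<in>\<F> b. ?\<S> \<V> (k - b)) (card (\<F> b) * (6 * ?W (k - b)))"
      by simp
  qed simp
  moreover have "(crossing k R B)
      \<subseteq> (\<Union>b\<in>?b. \<Union>\<V>\<in>\<F> b. ?\<S> \<V> (k - b))"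
  proof
    fix T assume T: "T \<in> (crossing k R B)"
    let ?c = "card (T \<inter> B)"
    have finT: "finite T"
      using T R(1) finite_subset by auto
    then have sum: "?c + card (T - B) \<le> k" and "?c \<noteq> 0"
      using T card_Int_Diff[of T B] by auto
    then have b: "?c \<in> ?b"
      using T by auto
    then obtain \<V> where \<V>: "\<V> \<in> \<F> ?c" "T \<inter> B \<in> \<V>"
      using \<F>(3)[OF b] by blast
    have "T = (T \<inter> B) \<union> (T - B)" "T - B \<subseteq> R - B" "card (T - B) \<le> k - ?c"
      using T sum by auto
    then have "T \<in> ?\<S> \<V> (k - ?c)"
      using \<V>(2) by blast
    then show "T \<in> (\<Union>b\<in>?b. \<Union>\<V>\<in>\<F> b. ?\<S> \<V> (k - b))"
      using b \<V>(1) by blast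
  qed
  ultimately have "loopable R (crossing k R B) ?l"
    by (elim loopable_mono) auto
  moreover have "?p * ?l \<le> 24 * (\<Sum>i\<le>k. card R choose i)"
  proof -
    let ?f = "\<lambda>b. (?p choose b) * ?W (k - b)"
    have "?p * ?l = (\<Sum>b\<in>?b. (?p * card (\<F> b)) * (6 * ?W (k - b)))"
      by (simp add: sum_distrib_left mult.assoc)
    also have "\<dots> \<le> (\<Sum>b\<in>?b. (3 * (?p choose b) + (?p choose (b - 1))) * (6 * ?W (k - b)))"
      using \<F>(4) by (intro sum_mono mult_le_mono1)
    \<comment> \<open>Deepening the walk from \<open>k - b\<close> to \<open>k - (b - 1)\<close>
      makes the second part a term of the same sum with index \<open>b - 1\<close>; this yields
      \<open>24 = 18 + 6\<close>.\<close>
    also have "\<dots> \<le> (\<Sum>b\<in>?b. 18 * ?f b + 6 * ?f (b - 1))"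
    proof (intro sum_mono)
      fix b assume "b \<in> ?b"
      have "?W (k - b) \<le> ?W (k - (b - 1))"
        by (intro sum_mono2) auto
      then have "(?p choose (b - 1)) * ?W (k - b) \<le> ?f (b - 1)"
        by (rule mult_le_mono2)
      then show "(3 * (?p choose b) + (?p choose (b - 1))) * (6 * ?W (k - b)) \<le> 18 * ?f b + 6 * ?f (b - 1)"
        by (simp add: algebra_simps)
    qed
    also have "\<dots> = 18 * (\<Sum>b\<in>?b. ?f b) + 6 * (\<Sum>b\<in>?b. ?f (b - 1))"
      by (simp add: sum.distrib sum_distrib_left)
    also have "(\<Sum>b\<in>?b. ?f b) \<le> (\<Sum>b\<le>k. ?f b)"
      by (intro sum_mono2) auto
    also have "(\<Sum>b\<in>?b. ?f (b - 1)) = (\<Sum>b\<in>(\<lambda>b. b - 1) ` ?b. ?f b)"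
      by (subst sum.reindex) (auto simp: inj_on_def)
    also have "\<dots> \<le> (\<Sum>b\<le>k. ?f b)"
      by (intro sum_mono2) auto
    finally show ?thesis
      using sum_binomial_split[of ?p ?q k] R_card by simp
  qed
  ultimately show ?thesis
    by blast
qed

text \<open>In a disjoint union of parts of sizes \<open>a\<close> and \<open>b\<close>, the
  \<open>j\<close>-sets inside one part are matched by those with exactly one element in the first
  part: for \<open>j \<ge> 2\<close> and nearly equal parts there are at least
  \<open>2 * (b choose j)\<close> of the latter.\<close>

lemma binomial_add_le_half:
  fixes a b j :: nat
  assumes "2 \<le> j" "a \<le> b" "b \<le> Suc a"
  shows "2 * ((a choose j) + (b choose j)) \<le> (Suc (a + b) choose j)"
proof -
  obtain i where j: "j = Suc (Suc i)"
    using assms(1) by (metis Suc_le_D numeral_2_eq_2 le_Suc_ex add_Suc)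
  have split: "(a choose j) + (b choose j) + a * (b choose (j - 1)) \<le> (a + b) choose j"
  proof -
    let ?f = "\<lambda>l. (a choose l) * (b choose (j - l))"
    have "sum ?f {0, 1, j} \<le> sum ?f {..j}"
      using assms(1) by (intro sum_mono2) auto
    moreover have "sum ?f {0, 1, j} = (b choose j) + a * (b choose (j - 1)) + (a choose j)"
      using assms(1) by simp
    ultimately show ?thesis
      by (simp add: vandermonde)
  qed
  have "(a choose j) \<le> (b choose j)"
    using assms(2) by (rule binomial_right_mono)
  moreover have "2 * (b choose j) \<le> a * (b choose (j - 1))"
  proof -
    have "2 * (b choose j) \<le> j * (b choose j)"
      using assms(1) by (rule mult_le_mono1)
    also have "\<dots> = (b - (j - 1)) * (b choose (j - 1))"
      using times_binomial_minus1_eq[of j b] binomial_absorb_comp[of b "j - 1"] assms(1) by simp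
    also have "\<dots> \<le> a * (b choose (j - 1))"
      using assms by (intro mult_le_mono1) linarith
    finally show ?thesis .
  qed
  moreover have "2 * (x + y) \<le> s" if "x \<le> y" "2 * y \<le> z" "x + y + z \<le> s" for x y z s :: nat
    using that by simp
  ultimately have "2 * ((a choose j) + (b choose j)) \<le> (a + b) choose j"
    using split by blast
  also have "\<dots> \<le> Suc (a + b) choose j"
    by (rule binomial_right_mono) simp
  finally show ?thesis .
qed

text \<open>Division by the register size turns \<open>m choose i\<close> into
  \<open>(m - 1 choose (i - 1)) / i\<close>, so \<open>binomial_add_le_half\<close> applies with
  \<open>j = i - 1\<close>. Its condition \<open>2 \<le> j\<close> is where the lower limit 3
  enters. The factor one half is the geometric ratio of the recursion.\<close>

lemma sum_binomial_halves:
  fixes h k :: nat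
  assumes "3 \<le> h"
  defines "G \<equiv> \<lambda>h. \<Sum>i=3..k. real (h choose i)"
  shows "G (h div 2) / real (h div 2) + G (h - h div 2) / real (h - h div 2) \<le> G h / real h / 2"
proof -
  note [simp del] = of_nat_diff
  have G: "G m / real m = (\<Sum>i=3..k. real (m - 1 choose (i - 1)) / real i)" if "0 < m" for m
  proof -
    have "real (m choose i) / real m = real (m - 1 choose (i - 1)) / real i" if "i \<in> {3..k}" for i
    proof -
      have "real (i * (m choose i)) = real (m * (m - 1 choose (i - 1)))"
        using that by (subst times_binomial_minus1_eq) auto
      then show ?thesis
        using \<open>0 < m\<close> that by (simp add: field_simps)
    qed
    then show ?thesis
      unfolding G_def by (simp add: sum_divide_distrib)
  qed
  let ?a = "h div 2" and ?b = "h - h div 2"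
  have "G ?a / real ?a + G ?b / real ?b
      = (\<Sum>i=3..k. (real (?a - 1 choose (i - 1)) + real (?b - 1 choose (i - 1))) / real i)"
    using assms(1) by (simp add: G sum.distrib add_divide_distrib del: of_nat_diff)
  also have "\<dots> \<le> (\<Sum>i=3..k. real (h - 1 choose (i - 1)) / real i / 2)"
  proof (intro sum_mono)
    fix i assume i: "i \<in> {3..k}"
    have "2 * ((?a - 1 choose (i - 1)) + (?b - 1 choose (i - 1))) \<le> (Suc (?a - 1 + (?b - 1)) choose (i - 1))"
      using i assms(1) by (intro binomial_add_le_half) auto
    moreover have "Suc (?a - 1 + (?b - 1)) = h - 1"
      using assms(1) by simp
    ultimately have "2 * (real (?a - 1 choose (i - 1)) + real (?b - 1 choose (i - 1))) \<le> real (h - 1 choose (i - 1))"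
      by (metis (mono_tags) of_nat_add of_nat_le_iff of_nat_mult of_nat_numeral)
    then have "real (?a - 1 choose (i - 1)) + real (?b - 1 choose (i - 1)) \<le> real (h - 1 choose (i - 1)) / 2"
      by simp
    from divide_right_mono[OF this, of "real i"]
    show "(real (?a - 1 choose (i - 1)) + real (?b - 1 choose (i - 1))) / real i
        \<le> real (h - 1 choose (i - 1)) / real i / 2"
      by simp
  qed
  also have "\<dots> = G h / real h / 2"
    using assms(1) by (simp add: G sum_divide_distrib)
  finally show ?thesis .
qed

text \<open>Sizes 0, 1 and 2 are absorbed by size 3, with the factor 7 attained at
  \<open>h = 3\<close>, where \<open>1 + 3 + 3 = 7\<close>.\<close>

lemma sum_binomial_le_from_3:
  assumes "3 \<le> h" "3 \<le> k"
  shows "(\<Sum>i\<le>k. h choose i) \<le> 8 * (\<Sum>i=3..k. h choose i)"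
proof -
  have "{..k} = {0, 1, 2} \<union> {3..k}"
    using assms(2) by auto
  then have "(\<Sum>i\<le>k. h choose i) = (\<Sum>i\<in>{0, 1, 2}. h choose i) + (\<Sum>i=3..k. h choose i)"
    by (simp only:) (subst sum.union_disjoint; auto)
  moreover have "(\<Sum>i\<in>{0, 1, 2}. h choose i) \<le> 7 * (h choose 3)"
  proof -
    obtain n where n: "h = n + 3"
      using assms(1) by (metis le_add_diff_inverse2)
    have "1 + h + (h choose 2) \<le> 7 * (h choose 3)"
      unfolding n
    proof (induction n)
      case 0
      show ?case by (simp add: numeral_eq_Suc)
    next
      case (Suc n)
      have "Suc n + 3 choose 3 = (n + 3 choose 2) + (n + 3 choose 3)"
        "Suc n + 3 choose 2 = (n + 3) + (n + 3 choose 2)"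
        by (simp_all add: numeral_eq_Suc)
      moreover have "n + 3 \<le> (n + 3 choose 2)"
        by (simp add: choose_two algebra_simps)
      ultimately show ?case
        using Suc by linarith
    qed
    then show ?thesis
      by simp
  qed
  moreover have "(h choose 3) \<le> (\<Sum>i=3..k. h choose i)"
    using assms(2) by (intro member_le_sum) auto
  ultimately show ?thesis
    by linarith
qed

lemma power_of_two_below:
  assumes "1 \<le> (n :: nat)"
  shows "\<exists>r. 2 ^ r \<le> n \<and> n < 2 * 2 ^ r"
proof -
  define r where "r = (LEAST r. n < 2 ^ r)"
  have r: "n < 2 ^ r" "\<And>s. s < r \<Longrightarrow> 2 ^ s \<le> n"
    unfolding r_def using LeastI[of "\<lambda>r. n < 2 ^ r" n] not_less_Least[of _ "\<lambda>r. n < 2 ^ r"]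
    by (auto simp: not_less)
  with assms obtain s where "r = Suc s"
    by (cases r) auto
  then show ?thesis
    using r by (intro exI[of _ s]) auto
qed

text \<open>Windows need an exact size, a power of two, but may overlap;
  \<open>card P \<le> 2 * p\<close> lets two of them cover \<open>P\<close>.\<close>

lemma ex_windows:
  assumes "finite P" "p \<le> card P" "card P \<le> 2 * p"
  shows "\<exists>B1 B2. B1 \<subseteq> P \<and> B2 \<subseteq> P \<and> card B1 = p \<and> card B2 = p \<and> P = B1 \<union> B2"
proof -
  obtain B1 where B1: "B1 \<subseteq> P" "card B1 = p"
    using obtain_subset_with_card_n[OF assms(2)] by blast
  have "card (P - B1) \<le> p"
    using assms B1 by (simp add: card_Diff_subset finite_subset)
  then obtain B2 where "P - B1 \<subseteq> B2" "B2 \<subseteq> P" "card B2 = p"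
    using exists_subset_between[of "P - B1" p P] assms by blast
  then show ?thesis
    using B1 by blast
qed

text \<open>The constant solves \<open>C = C / 2 + 4 * 768\<close>: by
  \<open>sum_binomial_halves\<close> the two halves together use at most half of the bound, and four
  windows, two in each half, use 768 units each.\<close>

lemma loopable_triples:
  fixes R :: "'a set"
  assumes "finite R"
  shows "\<exists>l. loopable R {T. T \<subseteq> R \<and> 3 \<le> card T \<and> card T \<le> k} l \<and>
    real l \<le> 6144 * (\<Sum>i=3..k. real (card R choose i)) / real (card R)"
  using assms
proof (induction "card R" arbitrary: R rule: less_induct)
  case less
  let ?h = "card R"
  let ?G = "\<lambda>h. \<Sum>i=3..k. real (h choose i)"
  show ?case
  proof (cases "3 \<le> ?h \<and> 3 \<le> k")
    case False
    have "\<not> (T \<subseteq> R \<and> 3 \<le> card T \<and> card T \<le> k)" for T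
      using False card_mono[OF less.prems, of T] by linarith
    then have empty: "{T. T \<subseteq> R \<and> 3 \<le> card T \<and> card T \<le> k} = {}"
      by blast
    have "loopable R {T. T \<subseteq> R \<and> 3 \<le> card T \<and> card T \<le> k} 0"
      unfolding empty by (rule loopable_empty)
    then show ?thesis
      by (intro exI[of _ 0]) (simp add: sum_nonneg)
  next
    case True
    then have h: "3 \<le> ?h" and k: "3 \<le> k"
      by auto
    obtain P where P: "P \<subseteq> R" "card P = ?h div 2"
      using obtain_subset_with_card_n[of "?h div 2" R] by auto
    let ?Q = "R - P"
    have finP: "finite P" "finite ?Q"
      using P(1) less.prems finite_subset by auto
    have Q: "card ?Q = ?h - ?h div 2"
      using P finP by (simp add: card_Diff_subset)
    obtain r where r: "2 ^ r \<le> ?h div 2" "?h div 2 < 2 * 2 ^ r"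
    proof -
      have "1 \<le> ?h div 2"
        using h by linarith
      then show ?thesis
        using power_of_two_below that by blast
    qed
    let ?p = "2 ^ r :: nat"
    obtain B1 B2 where B12: "B1 \<subseteq> P" "B2 \<subseteq> P" "card B1 = ?p" "card B2 = ?p" "P = B1 \<union> B2"
      using ex_windows[OF finP(1), of ?p] P(2) r by auto
    obtain B3 B4 where B34: "B3 \<subseteq> ?Q" "B4 \<subseteq> ?Q" "card B3 = ?p" "card B4 = ?p" "?Q = B3 \<union> B4"
    proof -
      \<comment> \<open>The second half has at most one qubit more than \<open>P\<close>; the strict
        inequality \<open>?h div 2 < 2 * ?p\<close> leaves room for it, so the same window size
        serves both halves.\<close>
      have "?p \<le> card ?Q" "card ?Q \<le> 2 * ?p"
        unfolding Q using r by linarith+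
      then show ?thesis
        using ex_windows[OF finP(2), of ?p] that by blast
    qed
    let ?\<T> = "\<lambda>B. (crossing k R B)"
    have window: "\<exists>l. loopable R (?\<T> B) l \<and> real l \<le> 768 * ?G ?h / real ?h"
      if B: "B \<subseteq> R" "card B = ?p" for B
    proof -
      have "card (R - B) = ?h - ?p"
        using B less.prems by (simp add: card_Diff_subset finite_subset)
      then have "card B \<le> card (R - B)"
        using B(2) r(1) by linarith
      then obtain l where l: "loopable R (?\<T> B) l" "card B * l \<le> 24 * (\<Sum>i\<le>k. ?h choose i)"
        using loopable_window[OF less.prems B(1,2), of k] k by auto
      \<comment> \<open>\<open>768 = 4 * 24 * 8\<close>: a window holds more than a quarter of
        \<open>R\<close>, 24 comes from \<open>loopable_window\<close> and 8 from
        \<open>sum_binomial_le_from_3\<close>.\<close>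
      have "?h * l \<le> 4 * ?p * l"
        using r(2) by (intro mult_le_mono1) linarith
      also have "\<dots> = 4 * (card B * l)"
        by (simp add: B(2))
      also have "\<dots> \<le> 4 * (24 * (8 * (\<Sum>i=3..k. ?h choose i)))"
        by (intro mult_le_mono2 order_trans[OF l(2)] sum_binomial_le_from_3[OF h k])
      finally have "?h * l \<le> 768 * (\<Sum>i=3..k. ?h choose i)"
        by simp
      then have "real ?h * real l \<le> 768 * ?G ?h"
        using of_nat_mono[of "?h * l" "768 * (\<Sum>i=3..k. ?h choose i)", where 'a = real] by simp
      then have "real l \<le> 768 * ?G ?h / real ?h"
        using h by (simp add: field_simps)
      then show ?thesis
        using l(1) by blast
    qed
    obtain l1 where l1: "loopable R (?\<T> B1) l1" "real l1 \<le> 768 * ?G ?h / real ?h"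
      using window[of B1] B12 P(1) by blast
    obtain l2 where l2: "loopable R (?\<T> B2) l2" "real l2 \<le> 768 * ?G ?h / real ?h"
      using window[of B2] B12 P(1) by blast
    obtain l3 where l3: "loopable R (?\<T> B3) l3" "real l3 \<le> 768 * ?G ?h / real ?h"
      using window[of B3] B34 by blast
    obtain l4 where l4: "loopable R (?\<T> B4) l4" "real l4 \<le> 768 * ?G ?h / real ?h"
      using window[of B4] B34 by blast
    let ?\<D> = "\<lambda>R. {T. T \<subseteq> R \<and> 3 \<le> card T \<and> card T \<le> k}"
    obtain lP where lP: "loopable P (?\<D> P) lP" "real lP \<le> 6144 * ?G (card P) / real (card P)"
      using less.hyps[of P] P(2) h finP(1) by auto
    obtain lQ where lQ: "loopable ?Q (?\<D> ?Q) lQ" "real lQ \<le> 6144 * ?G (card ?Q) / real (card ?Q)"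
      using less.hyps[of ?Q] Q h finP(2) by auto
    let ?l = "lP + (lQ + (l1 + (l2 + (l3 + l4))))"
    have "loopable R (?\<D> P \<union> (?\<D> ?Q \<union> (?\<T> B1 \<union> (?\<T> B2 \<union> (?\<T> B3 \<union> ?\<T> B4))))) ?l"
      using loopable_mono[OF lP(1) P(1)] loopable_mono[OF lQ(1), of R] l1(1) l2(1) l3(1) l4(1)
      by (intro loopable_Un) auto
    moreover have "?\<D> R \<subseteq> ?\<D> P \<union> (?\<D> ?Q \<union> (?\<T> B1 \<union> (?\<T> B2 \<union> (?\<T> B3 \<union> ?\<T> B4))))"
    proof
      fix T assume T: "T \<in> ?\<D> R"
      then have finT: "finite T"
        using less.prems finite_subset by auto
      have sum: "card T = card (T \<inter> P) + card (T - P)"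
        using finT by (rule card_Int_Diff)
      show "T \<in> ?\<D> P \<union> (?\<D> ?Q \<union> (?\<T> B1 \<union> (?\<T> B2 \<union> (?\<T> B3 \<union> ?\<T> B4))))"
      proof (cases "T \<subseteq> P \<or> T \<subseteq> ?Q")
        case True
        then show ?thesis
          using T by blast
      next
        case False
        have mem: "T \<in> ?\<T> B" if "T \<inter> B \<noteq> {}" "X \<subseteq> T - B" "2 \<le> card X" for B X
        proof -
          have "card X \<le> card (T - B)"
            using finT that(2) by (intro card_mono) auto
          then show ?thesis
            using T that by auto
        qed
        show ?thesis
        \<comment> \<open>The half with the larger share has at least two of the three or more
          elements of \<open>T\<close>; the window is taken in the other half, which
          \<open>T\<close> meets.\<close>
        proof (cases "card (T \<inter> P) \<le> card (T - P)")
          case True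
          then have two: "2 \<le> card (T - P)"
            using sum T by auto
          have "T \<inter> B1 \<noteq> {} \<or> T \<inter> B2 \<noteq> {}"
            using False T B12(5) by blast
          then show ?thesis
          proof
            assume "T \<inter> B1 \<noteq> {}"
            then have "T \<in> ?\<T> B1"
              by (rule mem[of _ "T - P"]) (use B12(1,2) two in blast)+
            then show ?thesis
              by (simp only: Un_iff simp_thms)
          next
            assume "T \<inter> B2 \<noteq> {}"
            then have "T \<in> ?\<T> B2"
              by (rule mem[of _ "T - P"]) (use B12(1,2) two in blast)+
            then show ?thesis
              by (simp only: Un_iff simp_thms)
          qed
        next
          case c: False
          then have two: "2 \<le> card (T \<inter> P)"
            using sum T by auto
          have "T \<inter> B3 \<noteq> {} \<or> T \<inter> B4 \<noteq> {}"
            using False T B34(5) by blast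
          then show ?thesis
          proof
            assume "T \<inter> B3 \<noteq> {}"
            then have "T \<in> ?\<T> B3"
              by (rule mem[of _ "T \<inter> P"]) (use B34(1,2) two in blast)+
            then show ?thesis
              by (simp only: Un_iff simp_thms)
          next
            assume "T \<inter> B4 \<noteq> {}"
            then have "T \<in> ?\<T> B4"
              by (rule mem[of _ "T \<inter> P"]) (use B34(1,2) two in blast)+
            then show ?thesis
              by (simp only: Un_iff simp_thms)
          qed
        qed
      qed
    qed
    ultimately have "loopable R (?\<D> R) ?l"
      by (elim loopable_mono) auto
    moreover have "real ?l \<le> 6144 * ?G ?h / real ?h"
    proof -
      have "real lP + real lQ \<le> 6144 * (?G (?h div 2) / real (?h div 2) + ?G (?h - ?h div 2) / real (?h - ?h div 2))"
        using lP(2) lQ(2) P(2) Q by (simp add: algebra_simps)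
      also have "\<dots> \<le> 6144 * (?G ?h / real ?h / 2)"
        using sum_binomial_halves[OF h, of k] by (intro mult_left_mono) auto
      finally have "real lP + real lQ \<le> 3072 * (?G ?h / real ?h)"
        by simp
      then show ?thesis
        using l1(2) l2(2) l3(2) l4(2) by simp
    qed
    ultimately show ?thesis
      by blast
  qed
qed

section \<open>Singletons, pairs and the total number of layers\<close>

lemma loopable_singletons: "loopable R {{q} | q. q \<in> R} 1"
proof -
  \<comment> \<open>An empty layer suffices: the stage behind it sees the initial bits.\<close>
  have "loop R [[]]"
    by (simp add: loop_def cnot_layers_def cnots_on_def)
  moreover have "{{q} | q. q \<in> R} \<subseteq> visited R [[]]"
  proof clarify
    fix q assume "q \<in> R"
    then show "{q} \<in> visited R [[]]"
      unfolding visited_def by (intro CollectI exI[of _ 1] exI[of _ q]) simp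
  qed
  ultimately show ?thesis
    unfolding loopable_def by (intro exI[of _ "[[]]"]) auto
qed

abbreviation sum_class :: "nat \<Rightarrow> nat \<Rightarrow> nat set set" where
  "sum_class n s \<equiv> {{i, j} | i j. i < j \<and> j < n \<and> (i + j) mod n = s}"

text \<open>The pairs with a fixed sum modulo \<open>n\<close> are pairwise disjoint.\<close>

lemma loopable_sum_class:
  fixes n s :: nat
  shows "loopable {..<n} (sum_class n s) 2"
proof -
  let ?js = "filter (\<lambda>j. \<exists>i<j. (i + j) mod n = s) [0..<n]"
  let ?partner = "\<lambda>j. THE i. i < n \<and> (i + j) mod n = s"
  have unique: "i = i'" if "(i + j) mod n = (i' + j) mod n" "i < n" "i' < n" for i i' j
    using inj_onD[OF inj_on_add_mod that(1)] that by simp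
  have partner: "?partner j = i" if "i < n" "(i + j) mod n = s" for i j
  proof (rule the_equality)
    fix i' assume "i' < n \<and> (i' + j) mod n = s"
    then have "(i' + j) mod n = (i + j) mod n" "i' < n"
      using that by simp_all
    then show "i' = i"
      using that(1) by (rule unique)
  qed (use that in blast)
  let ?L = "map (\<lambda>j. (?partner j, j)) ?js"
  have elim: "\<exists>i<j. j < n \<and> (i + j) mod n = s \<and> ?partner j = i" if "j \<in> set ?js" for j
  proof -
    have "j < n \<and> (\<exists>i<j. (i + j) mod n = s)"
      using that by simp
    then obtain i where "i < j" "j < n" "(i + j) mod n = s"
      by blast
    then show ?thesis
      using partner[of i j] by auto
  qed
  have on: "cnots_on {..<n} ?L"
    unfolding cnots_on_def using elim by fastforce
  have "sorted_wrt (\<lambda>j j'. {?partner j, j} \<inter> {?partner j', j'} = {}) ?js"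
  proof -
    have "{?partner j, j} \<inter> {?partner j', j'} = {}" if j: "j \<in> set ?js" "j' \<in> set ?js" "j < j'" for j j'
    proof -
      obtain i where i: "i < j" "j < n" "(i + j) mod n = s" "?partner j = i"
        using elim[OF j(1)] by blast
      obtain i' where i': "i' < j'" "j' < n" "(i' + j') mod n = s" "?partner j' = i'"
        using elim[OF j(2)] by blast
      have "i \<noteq> i'"
        using unique[of j i j'] i i' j(3) by (auto simp: add.commute)
      moreover have "j \<noteq> i'"
        using unique[of i j j'] i i' j(3) by (auto simp: add.commute)
      ultimately show ?thesis
        using i i' j(3) by auto
    qed
    moreover have "sorted_wrt (<) ?js"
      by (intro sorted_wrt_filter) simp
    ultimately show ?thesis
      by (rule sorted_wrt_mono_rel)
  qed
  then have disj: "disjoint_cnots ?L"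
    by (simp add: sorted_wrt_map)
  have run: "run_cnots ?L init j = {i, j}" if "i < j" "j < n" "(i + j) mod n = s" for i j
  proof -
    have "j \<in> set ?js"
      using that by auto
    from this[unfolded in_set_conv_nth] obtain l where l: "l < length ?js" "?js ! l = j"
      by blast
    have L: "?L = map (\<lambda>l. (?partner (?js ! l), ?js ! l)) [0..<length ?js]"
      by (intro nth_equalityI) auto
    have "run_cnots ?L init (?js ! l) = init (?js ! l) \<triangle> init (?partner (?js ! l))"
      unfolding L
    \<comment> \<open>A control \<open>i\<close> that is itself a target would have a partner
      \<open>i' < i\<close> with the same sum; uniqueness forces \<open>i'\<close> to be the larger
      qubit paired with \<open>i\<close>.\<close>
    proof (rule run_parallel_cnots)
      show "?partner (?js ! l) \<notin> set ?js" if l: "l < length ?js" for l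
      proof
        assume "?partner (?js ! l) \<in> set ?js"
        moreover obtain i where i: "i < ?js ! l" "?js ! l < n" "(i + ?js ! l) mod n = s" "?partner (?js ! l) = i"
          using elim[OF nth_mem[OF l]] by blast
        ultimately obtain i' where "i' < i" "i < n" "(i' + i) mod n = s"
          using elim[of i] by auto
        then show False
          using unique[of i' i "?js ! l"] i by (auto simp: add.commute)
      qed
    qed (use l in auto)
    then show ?thesis
      using l(2) partner[of i j] that by (auto simp: symdiff_def)
  qed
  have "loop {..<n} [?L, rev ?L]"
  proof -
    have "disjoint_cnots (rev ?L)"
      using disj unfolding sorted_wrt_rev by (simp add: Int_commute)
    moreover have "cnots_on {..<n} (rev ?L)"
      using on by (simp add: cnots_on_def)
    ultimately show ?thesis
      using on disj run_cnots_rev[OF on, of init] by (simp add: loop_def cnot_layers_def)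
  qed
  moreover have "(sum_class n s) \<subseteq> visited {..<n} [?L, rev ?L]"
  proof
    fix T assume "T \<in> (sum_class n s)"
    then obtain i j where ij: "T = {i, j}" "i < j" "j < n" "(i + j) mod n = s"
      by blast
    then show "T \<in> visited {..<n} [?L, rev ?L]"
      unfolding visited_def using run[of i j] by (intro CollectI exI[of _ 1] exI[of _ j]) simp
  qed
  ultimately show ?thesis
    unfolding loopable_def by (intro exI[of _ "[?L, rev ?L]"]) simp
qed

lemma loopable_pairs:
  shows "loopable {..<n :: nat} {T. T \<subseteq> {..<n} \<and> card T = 2} (2 * n)"
proof -
  have "loopable {..<n} (\<Union>s\<in>{..<n}. (sum_class n s)) (\<Sum>s\<in>{..<n}. 2)"
    by (intro loopable_UN loopable_sum_class) simp
  moreover have "{T. T \<subseteq> {..<n} \<and> card T = 2}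
      \<subseteq> (\<Union>s\<in>{..<n}. (sum_class n s))"
  proof
    fix T assume T: "T \<in> {T. T \<subseteq> {..<n} \<and> card T = 2}"
    then obtain x y where xy: "T = {x, y}" "x \<noteq> y"
      by (auto simp: card_2_iff)
    then have "T = {min x y, max x y}" "min x y < max x y" "max x y < n"
      using T by (auto simp: min_def max_def)
    moreover from this have "(min x y + max x y) mod n < n"
      by (intro mod_less_divisor) linarith
    ultimately show "T \<in> (\<Union>s\<in>{..<n}. (sum_class n s))"
      by blast
  qed
  ultimately show ?thesis
    by (elim loopable_mono) auto
qed

abbreviation small_subsets :: "nat \<Rightarrow> nat \<Rightarrow> nat set set" where
  "small_subsets n k \<equiv> {T. T \<subseteq> {..<n} \<and> T \<noteq> {} \<and> card T \<le> k}"

theorem loopable_bounded_subsets: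
  fixes n k :: nat
  assumes "2 \<le> n" "1 \<le> k"
  shows "\<exists>l. loopable {..<n} (small_subsets n k) l \<and>
    real l \<le> 6153 / real n * (\<Sum>i=0..k. real (n choose i))"
proof -
  let ?G = "\<Sum>i=0..k. real (n choose i)"
  let ?\<T> = "(small_subsets n k)"
  obtain l where l: "loopable {..<n} {T. T \<subseteq> {..<n} \<and> 3 \<le> card T \<and> card T \<le> k} l"
      "real l \<le> 6144 * (\<Sum>i=3..k. real (n choose i)) / real n"
    using loopable_triples[of "{..<n}" k] by auto
  have "(\<Sum>i=3..k. real (n choose i)) \<le> ?G"
    by (intro sum_mono2) auto
  then have "6144 * (\<Sum>i=3..k. real (n choose i)) / real n \<le> 6144 * ?G / real n"
    by (intro divide_right_mono mult_left_mono) auto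
  then have l_le: "real l \<le> 6144 / real n * ?G"
    using l(2) by simp
  have "real (n choose 1) \<le> ?G"
    using assms(2) by (intro member_le_sum) auto
  then have one_le: "1 \<le> 1 / real n * ?G"
    using assms(1) by (simp add: field_simps)
  have cases: "T \<in> {{q} | q. q \<in> {..<n}} \<or> T \<in> {T. T \<subseteq> {..<n} \<and> card T = 2} \<or>
      T \<in> {T. T \<subseteq> {..<n} \<and> 3 \<le> card T \<and> card T \<le> k}" if "T \<in> ?\<T>" for T
  proof -
    have "finite T" "T \<noteq> {}"
      using that finite_subset by auto
    then have "card T \<noteq> 0"
      by simp
    then consider "card T = 1" | "card T = 2" | "3 \<le> card T"
      by linarith
    then show ?thesis
      using that by cases (auto simp: card_1_singleton_iff)
  qed
  show ?thesis
  \<comment> \<open>The \<open>2 * n\<close> layers for pairs fit the budget only if pairs are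
    counted in it. For \<open>k = 1\<close> the budget is bounded, and one layer has to do.\<close>
  proof (cases "2 \<le> k")
    case True
    have "loopable {..<n} ({{q} | q. q \<in> {..<n}} \<union> ({T. T \<subseteq> {..<n} \<and> card T = 2} \<union>
        {T. T \<subseteq> {..<n} \<and> 3 \<le> card T \<and> card T \<le> k})) (1 + (2 * n + l))"
      by (intro loopable_Un loopable_singletons loopable_pairs l(1))
    then have "loopable {..<n} ?\<T> (1 + (2 * n + l))"
      by (rule loopable_mono) (use cases in blast)+
    \<comment> \<open>\<open>6153 = 1 + 8 + 6144\<close> for singletons, pairs and larger sets. The
      8 arises from \<open>n * n \<le> 2 * n * (n - 1)\<close>, valid for
      \<open>n \<ge> 2\<close>.\<close>
    moreover have "real (1 + (2 * n + l)) \<le> 6153 / real n * ?G"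
    proof -
      have "real (n choose 2) \<le> ?G"
        using True by (intro member_le_sum) auto
      moreover have "real n * (real n - 1) = 2 * real (n choose 2)"
      proof -
        have "real (2 * (n choose 2)) = real (n * (n - 1))"
          using times_binomial_minus1_eq[of 2 n] by simp
        then show ?thesis
          using assms(1) by (simp add: of_nat_diff)
      qed
      moreover have "2 * real n * real n \<le> 4 * (real n * (real n - 1))"
        using assms(1) by (simp add: algebra_simps)
      ultimately have "2 * real n * real n \<le> 8 * ?G"
        by linarith
      then have "2 * real n \<le> 8 / real n * ?G"
        using assms(1) by (simp add: field_simps)
      then have "real (1 + (2 * n + l)) \<le> 1 / real n * ?G + (8 / real n * ?G + 6144 / real n * ?G)"
        using l_le one_le by simp
      also have "\<dots> = 6153 / real n * ?G"
        by (simp add: algebra_simps add_divide_distrib[symmetric])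
      finally show ?thesis .
    qed
    ultimately show ?thesis
      by blast
  next
    case False
    then have "k = 1"
      using assms(2) by simp
    then have "?\<T> \<subseteq> {{q} | q. q \<in> {..<n}}"
      using cases by auto
    then have "loopable {..<n} ?\<T> 1"
      using loopable_mono[OF loopable_singletons] by blast
    moreover have "real 1 \<le> 6153 / real n * ?G"
    proof -
      have "1 / real n * ?G \<le> 6153 / real n * ?G"
        by (intro mult_right_mono divide_right_mono sum_nonneg) auto
      then show ?thesis
        using one_le by simp
    qed
    ultimately show ?thesis
      by blast
  qed
qed

section \<open>Realizable phases\<close>

definition parity :: "'a set \<Rightarrow> 'a set \<Rightarrow> bool" where
  "parity T x \<longleftrightarrow> odd (card (T \<inter> x))"

lemma parity_singleton [simp]: "parity {q} x \<longleftrightarrow> q \<in> x"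
  by (simp add: parity_def Int_insert_left)

lemma parity_insert:
  assumes "finite T" "q \<notin> T"
  shows "parity (insert q T) x \<longleftrightarrow> (q \<in> x) \<noteq> parity T x"
  using assms by (auto simp: parity_def Int_insert_left card_insert_if)

lemma parity_symdiff:
  assumes "finite S" "finite T"
  shows "parity (S \<triangle> T) x \<longleftrightarrow> parity S x \<noteq> parity T x"
proof -
  have "(S \<triangle> T) \<inter> x = (S \<inter> x) \<triangle> (T \<inter> x)"
    by (auto simp: mem_symdiff)
  then show ?thesis
    using assms odd_card_symdiff[of "S \<inter> x" "T \<inter> x"] by (simp add: parity_def)
qed

text \<open>A circuit reduced to group theory: \<open>st i q\<close> is the parity on qubit
  \<open>q\<close> at stage \<open>i\<close>, there are \<open>l\<close> stages, and each stage may
  attach one group element to every qubit.\<close>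

locale phase_schedule = comm_group G for G (structure) +
  fixes st :: "nat \<Rightarrow> nat \<Rightarrow> nat set" and n l :: nat
begin

text \<open>The index \<open>q = n\<close> stands for the uncontrolled factor of a stage.\<close>

definition stage_phase :: "nat \<Rightarrow> (nat \<Rightarrow> 'a) \<Rightarrow> nat set \<Rightarrow> 'a" where
  "stage_phase i v x = (\<Otimes>q\<in>{..n}. if q = n \<or> parity (st i q) x then v q else \<one>)"

definition phase :: "(nat \<Rightarrow> nat \<Rightarrow> 'a) \<Rightarrow> nat set \<Rightarrow> 'a" where
  "phase v x = (\<Otimes>i\<in>{..<l}. stage_phase i (v i) x)"

definition realizable :: "(nat set \<Rightarrow> 'a) \<Rightarrow> bool" where
  "realizable \<chi> \<longleftrightarrow> (\<exists>v. (\<forall>i q. v i q \<in> carrier G) \<and> phase v = \<chi>)"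

lemma stage_phase_closed: "(\<And>q. v q \<in> carrier G) \<Longrightarrow> stage_phase i v x \<in> carrier G"
  unfolding stage_phase_def by (intro finprod_closed) auto

lemma stage_phase_mult:
  assumes "\<And>q. v q \<in> carrier G" "\<And>q. w q \<in> carrier G"
  shows "stage_phase i (\<lambda>q. v q \<otimes> w q) x = stage_phase i v x \<otimes> stage_phase i w x"
proof -
  have "(if b then v q \<otimes> w q else \<one>) = (if b then v q else \<one>) \<otimes> (if b then w q else \<one>)" for b q
    using assms by simp
  then show ?thesis
    unfolding stage_phase_def using assms by (simp only:) (rule finprod_multf; simp)
qed

text \<open>By commutativity the group elements of two assignments are multiplied slot by slot, so a
  product needs no further stages.\<close>

lemma realizable_mult:
  assumes "realizable \<chi>" "realizable \<psi>"
  shows "realizable (\<lambda>x. \<chi> x \<otimes> \<psi> x)"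
proof -
  obtain v w where vw: "\<And>i q. v i q \<in> carrier G" "phase v = \<chi>" "\<And>i q. w i q \<in> carrier G" "phase w = \<psi>"
    using assms unfolding realizable_def by blast
  have "phase (\<lambda>i q. v i q \<otimes> w i q) x = phase v x \<otimes> phase w x" for x
    unfolding phase_def using vw
    by (subst finprod_multf[symmetric]) (auto simp: stage_phase_mult stage_phase_closed)
  then show ?thesis
    unfolding realizable_def using vw by (intro exI[of _ "\<lambda>i q. v i q \<otimes> w i q"]) auto
qed

lemma stage_phase_one [simp]: "stage_phase i (\<lambda>q. \<one>) x = \<one>"
  unfolding stage_phase_def by (intro finprod_one_eqI) simp

lemma realizable_one: "realizable (\<lambda>x. \<one>)"
  unfolding realizable_def phase_def
  by (intro exI[of _ "\<lambda>i q. \<one>"]) (auto intro!: finprod_one_eqI)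

lemma realizable_single:
  assumes "i < l" "q \<le> n" "g \<in> carrier G"
  shows "realizable (\<lambda>x. if q = n \<or> parity (st i q) x then g else \<one>)"
proof -
  let ?v = "\<lambda>j r. if j = i \<and> r = q then g else \<one>"
  have stage: "stage_phase j (?v j) x = (if i = j then (if q = n \<or> parity (st i q) x then g else \<one>) else \<one>)" for j x
  proof (cases "i = j")
    case True
    have "stage_phase j (?v j) x = (\<Otimes>r\<in>{..n}. if q = r then (if r = n \<or> parity (st i r) x then g else \<one>) else \<one>)"
      unfolding stage_phase_def using True assms(3) by (intro finprod_cong') auto
    also have "\<dots> = (if q = n \<or> parity (st i q) x then g else \<one>)"
      using assms by (subst finprod_singleton) auto
    finally show ?thesis
      using True by simp
  qed simp
  have "phase ?v x = (if q = n \<or> parity (st i q) x then g else \<one>)" for x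
    unfolding phase_def stage using assms by (subst finprod_singleton) auto
  then show ?thesis
    unfolding realizable_def using assms(3) by (intro exI[of _ ?v]) auto
qed

text \<open>With \<open>w \<otimes> w = g\<close>, the identity \<open>2 x y = x + y - (x \<oplus> y)\<close> for bits removes one control
  at the price of one more qubit in the parity.\<close>

lemma realizable_controlled_parity:
  assumes div: "two_divisible G"
    and par: "\<And>T g. T \<subseteq> {..<n} \<Longrightarrow> T \<noteq> {} \<Longrightarrow> card T \<le> k \<Longrightarrow> g \<in> carrier G \<Longrightarrow>
      realizable (\<lambda>x. if parity T x then g else \<one>)"
    and "finite Q" "Q \<subseteq> {..<n}" "T \<subseteq> {..<n}" "T \<noteq> {}" "Q \<inter> T = {}" "card Q + card T \<le> k" "g \<in> carrier G"
  shows "realizable (\<lambda>x. if Q \<subseteq> x \<and> parity T x then g else \<one>)"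
  using assms(3-)
proof (induction Q arbitrary: T g rule: finite_induct)
  case empty
  then show ?case
    using par by simp
next
  case (insert q Q)
  have finT: "finite T"
    using insert.prems(2) finite_subset by blast
  then have "card T \<noteq> 0"
    using insert.prems(3) by simp
  \<comment> \<open>Moving \<open>q\<close> from the controls into the parity keeps the total size,
    so all three uses of the induction hypothesis stay within \<open>k\<close>.\<close>
  then have le: "card Q + card {q} \<le> k" "card Q + card T \<le> k" "card Q + card (insert q T) \<le> k"
    using insert finT by auto
  obtain w where w: "w \<in> carrier G" "w \<otimes> w = g"
    using div insert.prems unfolding two_divisible_def by blast
  let ?f = "\<lambda>S h x. if Q \<subseteq> x \<and> parity S x then h else \<one>"
  \<comment> \<open>\<open>w\<close> for the bit \<open>q\<close>, \<open>w\<close> for the parity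
    of \<open>T\<close>, \<open>inv w\<close> for their sum: if both bits are 1 this gives
    \<open>w \<otimes> w = g\<close>; if exactly one is, \<open>w\<close> and \<open>inv w\<close>
    cancel.\<close>
  have "realizable (\<lambda>x. ?f {q} w x \<otimes> (?f T w x \<otimes> ?f (insert q T) (inv w) x))"
    using insert.hyps insert.prems le w(1)
    by (intro realizable_mult insert.IH) auto
  moreover have "?f {q} w x \<otimes> (?f T w x \<otimes> ?f (insert q T) (inv w) x)
      = (if insert q Q \<subseteq> x \<and> parity T x then g else \<one>)" for x
    using w parity_insert[OF finT, of q x] insert.prems(4) by auto
  ultimately show ?case
    by simp
qed

text \<open>One control is read as the parity of a singleton, which starts the reduction. A factor
  without controls goes into the uncontrolled slot of stage 0, hence \<open>0 < l\<close>.\<close>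

lemma realizable_controlled:
  assumes "two_divisible G" "0 < l"
    and visits: "\<And>T. T \<subseteq> {..<n} \<Longrightarrow> T \<noteq> {} \<Longrightarrow> card T \<le> k \<Longrightarrow> \<exists>i<l. \<exists>q<n. st i q = T"
    and Q: "Q \<subseteq> {..<n}" "card Q \<le> k" and g: "g \<in> carrier G"
  shows "realizable (\<lambda>x. if Q \<subseteq> x then g else \<one>)"
proof (cases "Q = {}")
  case True
  then show ?thesis
    using realizable_single[of 0 n g] assms(2) g by simp
next
  case False
  then obtain q where q: "q \<in> Q"
    by blast
  have finQ: "finite Q"
    using Q(1) finite_subset by blast
  have "realizable (\<lambda>x. if parity T x then h else \<one>)"
    if T: "T \<subseteq> {..<n}" "T \<noteq> {}" "card T \<le> k" "h \<in> carrier G" for T h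
  proof -
    obtain i r where "i < l" "r < n" "st i r = T"
      using visits[OF T(1-3)] by auto
    then show ?thesis
      using realizable_single[of i r h] T(4) by simp
  qed
  then have "realizable (\<lambda>x. if Q - {q} \<subseteq> x \<and> parity {q} x then g else \<one>)"
    using assms(1) Q g q finQ card_Suc_Diff1[OF finQ q]
    by (intro realizable_controlled_parity) auto
  moreover have "(Q - {q} \<subseteq> x \<and> parity {q} x) \<longleftrightarrow> Q \<subseteq> x" for x
    using q by auto
  ultimately show ?thesis
    by simp
qed

end

section \<open>Simultaneous diagonalization\<close>

lemma adjoint_carrier [simp]: "A \<in> carrier_mat n m \<Longrightarrow> mat_adjoint A \<in> carrier_mat m n"
  unfolding mat_adjoint_def by (auto simp: mat_of_rows_def)

lemma adjoint_dim [simp]: "dim_row (mat_adjoint A) = dim_col A" "dim_col (mat_adjoint A) = dim_row A"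
  unfolding mat_adjoint_def by (auto simp: mat_of_rows_def)

lemma adjoint_index:
  fixes A :: "complex mat"
  shows "i < dim_col A \<Longrightarrow> j < dim_row A \<Longrightarrow> mat_adjoint A $$ (i, j) = cnj (A $$ (j, i))"
  unfolding mat_adjoint_def by (simp add: mat_of_rows_index conjugate_complex_def)

lemma adjoint_adjoint [simp]: "mat_adjoint (mat_adjoint A) = (A :: complex mat)"
  by (intro eq_matI) (auto simp: adjoint_index)

lemma adjoint_one [simp]: "mat_adjoint (1\<^sub>m n) = (1\<^sub>m n :: complex mat)"
  by (intro eq_matI) (auto simp: adjoint_index)

lemma adjoint_zero [simp]: "mat_adjoint (0\<^sub>m n m) = (0\<^sub>m m n :: complex mat)"
  by (intro eq_matI) (auto simp: adjoint_index)

lemma adjoint_mult: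
  fixes A B :: "complex mat"
  assumes "A \<in> carrier_mat n k" "B \<in> carrier_mat k m"
  shows "mat_adjoint (A * B) = mat_adjoint B * mat_adjoint A"
  by (intro eq_matI) (use assms in \<open>auto simp: adjoint_index scalar_prod_def mult.commute intro!: sum.cong\<close>)

lemma adjoint_four_block:
  fixes A B C D :: "complex mat"
  assumes "A \<in> carrier_mat n1 m1" "B \<in> carrier_mat n1 m2" "C \<in> carrier_mat n2 m1" "D \<in> carrier_mat n2 m2"
  shows "mat_adjoint (four_block_mat A B C D)
    = four_block_mat (mat_adjoint A) (mat_adjoint C) (mat_adjoint B) (mat_adjoint D)"
  by (intro eq_matI) (use assms in \<open>auto simp: adjoint_index\<close>)

lemma unitaryD:
  assumes "unitary d V"
  shows "V \<in> carrier_mat d d" "V * mat_adjoint V = 1\<^sub>m d" "mat_adjoint V * V = 1\<^sub>m d"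
  using assms unfolding unitary_def by auto

lemma unitaryI:
  assumes "V \<in> carrier_mat d d" "mat_adjoint V * V = 1\<^sub>m d"
  shows "unitary d V"
  using assms mat_mult_left_right_inverse[of "mat_adjoint V" d V] unfolding unitary_def by simp

lemma unitary_one [simp]: "unitary d (1\<^sub>m d)"
  by (simp add: unitary_def)

lemma unitary_adjoint: "unitary d V \<Longrightarrow> unitary d (mat_adjoint V)"
  by (simp add: unitary_def)

lemma unitary_mult:
  assumes "unitary d V" "unitary d W"
  shows "unitary d (V * W)"
proof (rule unitaryI)
  note V = unitaryD[OF assms(1)] and W = unitaryD[OF assms(2)]
  show "V * W \<in> carrier_mat d d"
    using V W by simp
  have "mat_adjoint (V * W) * (V * W) = mat_adjoint W * mat_adjoint V * (V * W)"
    using V W by (simp add: adjoint_mult)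
  also have "\<dots> = mat_adjoint W * (mat_adjoint V * (V * W))"
    using V W by (intro assoc_mult_mat[of _ d d _ d _ d]) auto
  also have "mat_adjoint V * (V * W) = mat_adjoint V * V * W"
    using V W by (intro assoc_mult_mat[symmetric, of _ d d _ d _ d]) auto
  finally show "mat_adjoint (V * W) * (V * W) = 1\<^sub>m d"
    using V W by simp
qed

lemma four_block_inject:
  assumes "A \<in> carrier_mat n n'" "A' \<in> carrier_mat n n'" "B \<in> carrier_mat n m'" "B' \<in> carrier_mat n m'"
    "C \<in> carrier_mat m n'" "C' \<in> carrier_mat m n'" "D \<in> carrier_mat m m'" "D' \<in> carrier_mat m m'"
    and "four_block_mat A B C D = four_block_mat A' B' C' D'"
  shows "A = A'" "B = B'" "C = C'" "D = D'"
proof -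
  have eq: "four_block_mat A B C D $$ (i, j) = four_block_mat A' B' C' D' $$ (i, j)" for i j
    using assms(9) by simp
  show "A = A'"
  proof (rule eq_matI)
    fix i j assume "i < dim_row A'" "j < dim_col A'"
    then show "A $$ (i, j) = A' $$ (i, j)"
      using eq[of i j] assms(1-8) by simp
  qed (use assms in auto)
  show "B = B'"
  proof (rule eq_matI)
    fix i j assume "i < dim_row B'" "j < dim_col B'"
    then show "B $$ (i, j) = B' $$ (i, j)"
      using eq[of i "n' + j"] assms(1-8) by simp
  qed (use assms in auto)
  show "C = C'"
  proof (rule eq_matI)
    fix i j assume "i < dim_row C'" "j < dim_col C'"
    then show "C $$ (i, j) = C' $$ (i, j)"
      using eq[of "n + i" j] assms(1-8) by simp
  qed (use assms in auto)
  show "D = D'"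
  proof (rule eq_matI)
    fix i j assume "i < dim_row D'" "j < dim_col D'"
    then show "D $$ (i, j) = D' $$ (i, j)"
      using eq[of "n + i" "n' + j"] assms(1-8) by simp
  qed (use assms in auto)
qed

definition blocks :: "complex mat \<Rightarrow> complex mat \<Rightarrow> complex mat" where
  "blocks A D = four_block_mat A (0\<^sub>m (dim_row A) (dim_col D)) (0\<^sub>m (dim_row D) (dim_col A)) D"

lemma blocks_carrier [simp]:
  "A \<in> carrier_mat n m \<Longrightarrow> D \<in> carrier_mat n' m' \<Longrightarrow> blocks A D \<in> carrier_mat (n + n') (m + m')"
  by (simp add: blocks_def)

lemma blocks_mult:
  assumes "A \<in> carrier_mat n n" "A' \<in> carrier_mat n n" "D \<in> carrier_mat m m" "D' \<in> carrier_mat m m"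
  shows "blocks A D * blocks A' D' = blocks (A * A') (D * D')"
  using assms unfolding blocks_def
  by (subst mult_four_block_mat[of _ n n _ m _ m _ _ n _ m]) auto

lemma adjoint_blocks:
  assumes "A \<in> carrier_mat n n" "D \<in> carrier_mat m m"
  shows "mat_adjoint (blocks A D) = blocks (mat_adjoint A) (mat_adjoint D)"
  using assms unfolding blocks_def by (subst adjoint_four_block[of _ n n _ m _ m]) auto

lemma blocks_one: "blocks (1\<^sub>m n) (1\<^sub>m m) = 1\<^sub>m (n + m)"
  unfolding blocks_def by (intro eq_matI) auto

lemma blocks_inject:
  assumes "A \<in> carrier_mat n n" "A' \<in> carrier_mat n n" "D \<in> carrier_mat m m" "D' \<in> carrier_mat m m"
    and "blocks A D = blocks A' D'"
  shows "A = A'" "D = D'"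
proof -
  have eq: "four_block_mat A (0\<^sub>m n m) (0\<^sub>m m n) D = four_block_mat A' (0\<^sub>m n m) (0\<^sub>m m n) D'"
    using assms by (simp add: blocks_def)
  show "A = A'" "D = D'"
    by (rule four_block_inject[OF assms(1,2) _ _ _ _ assms(3,4) eq]; simp)+
qed

lemma unitary_blocks_iff:
  assumes "A \<in> carrier_mat n n" "D \<in> carrier_mat m m"
  shows "unitary (n + m) (blocks A D) \<longleftrightarrow> unitary n A \<and> unitary m D"
proof
  assume U: "unitary (n + m) (blocks A D)"
  have "blocks (mat_adjoint A * A) (mat_adjoint D * D) = blocks (1\<^sub>m n) (1\<^sub>m m)"
    using unitaryD(3)[OF U] assms unfolding adjoint_blocks[OF assms]
    by (subst (asm) blocks_mult[of _ n _ _ m]) (auto simp: blocks_one)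
  from blocks_inject[OF _ _ _ _ this, of n m]
  have "mat_adjoint A * A = 1\<^sub>m n" "mat_adjoint D * D = 1\<^sub>m m"
    using assms mult_carrier_mat[of "mat_adjoint A" n n A n] mult_carrier_mat[of "mat_adjoint D" m m D m] by auto
  then show "unitary n A \<and> unitary m D"
    using assms by (auto intro: unitaryI)
next
  assume "unitary n A \<and> unitary m D"
  then have "mat_adjoint (blocks A D) * blocks A D = 1\<^sub>m (n + m)"
    using assms unitaryD unfolding adjoint_blocks[OF assms]
    by (subst blocks_mult[of _ n _ _ m]) (auto simp: blocks_one)
  then show "unitary (n + m) (blocks A D)"
    using assms by (intro unitaryI) auto
qed

text \<open>A unitary that leaves the span of the first \<open>n\<close> basis vectors invariant also leaves its
  orthogonal complement invariant.\<close>

lemma unitary_upper_block: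
  assumes U: "unitary (n + m) (four_block_mat A B (0\<^sub>m m n) D)"
    and dims: "A \<in> carrier_mat n n" "B \<in> carrier_mat n m" "D \<in> carrier_mat m m"
  shows "four_block_mat A B (0\<^sub>m m n) D = blocks A D"
proof -
  let ?V = "four_block_mat A B (0\<^sub>m m n) D"
  have adj: "mat_adjoint ?V = four_block_mat (mat_adjoint A) (0\<^sub>m n m) (mat_adjoint B) (mat_adjoint D)"
    using dims by (subst adjoint_four_block[of _ n n _ m _ m]) auto
  have one: "1\<^sub>m (n + m) = four_block_mat (1\<^sub>m n) (0\<^sub>m n m) (0\<^sub>m m n) (1\<^sub>m m :: complex mat)"
    by (intro eq_matI) auto
  have carr: "mat_adjoint A * A \<in> carrier_mat n n" "mat_adjoint A * B \<in> carrier_mat n m"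
    "mat_adjoint B * A \<in> carrier_mat m n" "mat_adjoint B * B \<in> carrier_mat m m"
    "mat_adjoint D * D \<in> carrier_mat m m"
    using dims by (meson adjoint_carrier mult_carrier_mat)+
  have "four_block_mat (mat_adjoint A) (0\<^sub>m n m) (mat_adjoint B) (mat_adjoint D) * ?V
      = four_block_mat (mat_adjoint A * A + 0\<^sub>m n m * 0\<^sub>m m n) (mat_adjoint A * B + 0\<^sub>m n m * D)
        (mat_adjoint B * A + mat_adjoint D * 0\<^sub>m m n) (mat_adjoint B * B + mat_adjoint D * D)"
    using dims by (intro mult_four_block_mat) auto
  also have "\<dots> = four_block_mat (mat_adjoint A * A) (mat_adjoint A * B) (mat_adjoint B * A)
      (mat_adjoint B * B + mat_adjoint D * D)"
    using dims carr by simp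
  finally have eq: "four_block_mat (mat_adjoint A * A) (mat_adjoint A * B) (mat_adjoint B * A)
      (mat_adjoint B * B + mat_adjoint D * D) = four_block_mat (1\<^sub>m n) (0\<^sub>m n m) (0\<^sub>m m n) (1\<^sub>m m)"
    using unitaryD(3)[OF U] unfolding adj one by simp
  have AA: "mat_adjoint A * A = 1\<^sub>m n" and AB: "mat_adjoint A * B = 0\<^sub>m n m"
    using four_block_inject(1,2)[OF carr(1) _ carr(2) _ carr(3) _ _ _ eq] carr by auto
  have "unitary n A"
    using dims AA by (intro unitaryI)
  then have "B = A * mat_adjoint A * B"
    using dims unitaryD(2)[of n A] by simp
  also have "\<dots> = A * (mat_adjoint A * B)"
    using dims by (intro assoc_mult_mat[of _ n n _ n _ m]) auto
  also have "\<dots> = 0\<^sub>m n m"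
    unfolding AB using dims by simp
  finally show ?thesis
    using dims by (simp add: blocks_def)
qed

text \<open>The adjoint stands on the left, opposite to \<open>diagonalizes\<close>, so that the
  columns of \<open>W\<close> are the new basis.\<close>

abbreviation conj_by :: "complex mat \<Rightarrow> complex mat \<Rightarrow> complex mat" where
  "conj_by W V \<equiv> mat_adjoint W * V * W"

lemma conj_by_carrier:
  "W \<in> carrier_mat d d \<Longrightarrow> V \<in> carrier_mat d d \<Longrightarrow> conj_by W V \<in> carrier_mat d d"
  by (meson adjoint_carrier mult_carrier_mat)

lemma conj_by_mult:
  assumes W: "unitary d W" and V: "V \<in> carrier_mat d d" "V' \<in> carrier_mat d d"
  shows "conj_by W V * conj_by W V' = conj_by W (V * V')"
proof -
  note W' = unitaryD[OF W]
  note [simp] = assoc_mult_mat[of _ d d _ d _ d] and [simp] = mult_carrier_mat[of _ d d _ d]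
  have "W * (mat_adjoint W * (V' * W)) = (W * mat_adjoint W) * (V' * W)"
    using W'(1) V by simp
  also have "\<dots> = V' * W"
    unfolding W'(2) using W'(1) V by (intro left_mult_one_mat[of _ d d]) simp
  finally have "W * (mat_adjoint W * (V' * W)) = V' * W" .
  then show ?thesis
    using W'(1) V by simp
qed

lemma conj_by_conj_by:
  assumes "W \<in> carrier_mat d d" "W' \<in> carrier_mat d d" "V \<in> carrier_mat d d"
  shows "conj_by W' (conj_by W V) = conj_by (W * W') V"
proof -
  note [simp] = assoc_mult_mat[of _ d d _ d _ d] and [simp] = mult_carrier_mat[of _ d d _ d]
  show ?thesis
    using assms by (simp add: adjoint_mult[of _ d d _ d])
qed

lemma conj_by_cancel:
  assumes "unitary d W" "V \<in> carrier_mat d d"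
  shows "conj_by (mat_adjoint W) (conj_by W V) = V"
proof -
  note W' = unitaryD[OF assms(1)]
  have "conj_by (mat_adjoint W) (conj_by W V) = conj_by (W * mat_adjoint W) V"
    using W'(1) assms(2) by (intro conj_by_conj_by) auto
  then show ?thesis
    unfolding W'(2) using assms(2) by simp
qed

lemma unitary_conj_by: "unitary d W \<Longrightarrow> unitary d V \<Longrightarrow> unitary d (conj_by W V)"
  by (intro unitary_mult unitary_adjoint)

lemma conj_by_blocks:
  assumes "P \<in> carrier_mat n n" "Q \<in> carrier_mat m m" "A \<in> carrier_mat n n" "D \<in> carrier_mat m m"
  shows "conj_by (blocks P Q) (blocks A D) = blocks (conj_by P A) (conj_by Q D)"
proof -
  have "mat_adjoint P * A \<in> carrier_mat n n" "mat_adjoint Q * D \<in> carrier_mat m m"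
    using assms by (meson adjoint_carrier mult_carrier_mat)+
  then show ?thesis
    using assms by (simp add: adjoint_blocks blocks_mult[of _ n _ _ m])
qed

section \<open>Splitting off eigenspaces of unitary matrices\<close>

lemma ex_unitary_first_column:
  fixes v :: "complex vec"
  assumes v: "v \<in> carrier_vec d" "v \<noteq> 0\<^sub>v d"
  shows "\<exists>W c. unitary d W \<and> col W 0 = c \<cdot>\<^sub>v v"
proof -
  interpret cof_vec_space d "TYPE(complex)" .
  note bc = basis_completion[OF v]
  define ws where "ws = gram_schmidt d (basis_completion v)"
  from gram_schmidt_result[OF bc(2) bc(4) bc(5) ws_def]
  have ws: "set ws \<subseteq> carrier_vec d" "corthogonal ws" "length ws = d"
    using bc(6) by auto
  have d: "0 < d"
    using v by (cases d) auto
  obtain vs where "basis_completion v = v # vs"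
    using bc(6,7) d by (cases "basis_completion v") auto
  then have "hd ws = v"
    unfolding ws_def using v(1) by simp
  then have ws0: "ws ! 0 = v"
    using ws(3) d by (metis hd_conv_nth length_0_conv less_numeral_extra(3))
  have wsc: "ws ! i \<in> carrier_vec d" if "i < d" for i
    using ws that by auto
  \<comment> \<open>Gram-Schmidt keeps the first vector \<open>v\<close>, but the vectors obtained
    are only orthogonal; \<open>r i\<close> is the norm by which the \<open>i\<close>-th is
    divided.\<close>
  define r where "r i = sqrt (\<Sum>k<d. (cmod (ws ! i $ k))\<^sup>2)" for i
  have dot: "ws ! j \<bullet>c ws ! i = (\<Sum>k<d. ws ! j $ k * cnj (ws ! i $ k))" if "i < d" "j < d" for i j
    using carrier_vecD[OF wsc[OF that(1)]] carrier_vecD[OF wsc[OF that(2)]] that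
    by (auto simp: scalar_prod_def conjugate_complex_def lessThan_atLeast0 intro!: sum.cong)
  have self: "(\<Sum>k<d. ws ! i $ k * cnj (ws ! i $ k)) = of_real ((r i)\<^sup>2)" for i
    unfolding r_def by (simp add: sum_nonneg complex_norm_square[symmetric])
  have r: "r i \<noteq> 0" if "i < d" for i
    using corthogonalD[OF ws(2), of i i] dot[of i i] self[of i] ws(3) that by auto
  define W where "W = mat d d (\<lambda>(k, i). ws ! i $ k / of_real (r i))"
  have W: "W \<in> carrier_mat d d"
    by (simp add: W_def)
  have "mat_adjoint W * W = 1\<^sub>m d"
  proof (rule eq_matI)
    fix i j assume "i < dim_row (1\<^sub>m d :: complex mat)" "j < dim_col (1\<^sub>m d :: complex mat)"
    then have ij: "i < d" "j < d"
      by auto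
    have "(mat_adjoint W * W) $$ (i, j) = (\<Sum>k<d. cnj (W $$ (k, i)) * W $$ (k, j))"
      using W ij by (auto simp: scalar_prod_def adjoint_index lessThan_atLeast0 intro!: sum.cong)
    also have "\<dots> = (\<Sum>k<d. ws ! j $ k * cnj (ws ! i $ k)) / of_real (r i * r j)"
      unfolding sum_divide_distrib using ij by (intro sum.cong) (auto simp: W_def mult.commute)
    also have "\<dots> = 1\<^sub>m d $$ (i, j)"
    proof (cases "i = j")
      case True
      then show ?thesis
        using self[of i] r[OF ij(1)] ij by (simp add: power2_eq_square)
    next
      case False
      then show ?thesis
        using corthogonalD[OF ws(2), of j i] dot[OF ij] ij ws(3) by simp
    qed
    finally show "(mat_adjoint W * W) $$ (i, j) = 1\<^sub>m d $$ (i, j)" .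
  qed (use W in auto)
  then have "unitary d W"
    using W by (intro unitaryI)
  moreover have "col W 0 = (1 / of_real (r 0)) \<cdot>\<^sub>v v"
    using d v(1) ws0 by (intro eq_vecI) (auto simp: W_def)
  ultimately show ?thesis
    by blast
qed

text \<open>With an eigenvector as first basis vector, the first column becomes \<open>z\<close>
  times the first unit vector; \<open>unitary_upper_block\<close> then clears the rest of the first
  row.\<close>

lemma unitary_deflate:
  assumes V: "unitary (Suc m) V" and ev: "eigenvalue V z"
  shows "\<exists>W D. unitary (Suc m) W \<and> unitary m D \<and> conj_by W V = blocks (z \<cdot>\<^sub>m 1\<^sub>m 1) D"
proof -
  let ?d = "Suc m"
  note V' = unitaryD[OF V]
  obtain v where v: "v \<in> carrier_vec ?d" "v \<noteq> 0\<^sub>v ?d" "V *\<^sub>v v = z \<cdot>\<^sub>v v"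
    using ev V'(1) unfolding eigenvalue_def eigenvector_def by auto
  obtain W c where W: "unitary ?d W" "col W 0 = c \<cdot>\<^sub>v v"
    using ex_unitary_first_column[OF v(1,2)] by blast
  note W' = unitaryD[OF W(1)]
  let ?Y = "conj_by W V"
  have Y: "?Y \<in> carrier_mat ?d ?d"
    using W'(1) V'(1) by (rule conj_by_carrier)
  have "col ?Y 0 = col (mat_adjoint W * (V * W)) 0"
    using W'(1) V'(1) by (simp add: assoc_mult_mat[of _ ?d ?d _ ?d _ ?d])
  also have "\<dots> = mat_adjoint W *\<^sub>v col (V * W) 0"
    using W'(1) V'(1) by (intro col_mult2[of _ ?d ?d _ ?d]) auto
  also have "col (V * W) 0 = V *\<^sub>v col W 0"
    using W'(1) V'(1) by (intro col_mult2[of _ ?d ?d _ ?d]) auto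
  also have "\<dots> = z \<cdot>\<^sub>v col W 0"
    unfolding W(2) using v V'(1) by (simp add: mult_mat_vec[of _ ?d ?d] smult_smult_assoc mult.commute)
  also have "mat_adjoint W *\<^sub>v (z \<cdot>\<^sub>v col W 0) = z \<cdot>\<^sub>v (mat_adjoint W *\<^sub>v col W 0)"
    using W'(1) v(1) W(2) by (intro mult_mat_vec[of _ ?d ?d]) auto
  also have "mat_adjoint W *\<^sub>v col W 0 = col (mat_adjoint W * W) 0"
    using W'(1) by (intro col_mult2[symmetric, of _ ?d ?d _ ?d]) auto
  finally have col: "col ?Y 0 = z \<cdot>\<^sub>v unit_vec ?d 0"
    unfolding W'(3) by simp
  define B where "B = mat 1 m (\<lambda>(i, j). ?Y $$ (i, Suc j))"
  define D where "D = mat m m (\<lambda>(i, j). ?Y $$ (Suc i, Suc j))"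
  have carr: "B \<in> carrier_mat 1 m" "D \<in> carrier_mat m m"
    by (simp_all add: B_def D_def)
  have dims: "dim_row ?Y = ?d" "dim_col ?Y = ?d"
    using Y by auto
  have Yeq: "?Y = four_block_mat (z \<cdot>\<^sub>m 1\<^sub>m 1) B (0\<^sub>m m 1) D"
  proof (rule eq_matI)
    fix i j assume "i < dim_row (four_block_mat (z \<cdot>\<^sub>m 1\<^sub>m 1) B (0\<^sub>m m 1) D)"
      "j < dim_col (four_block_mat (z \<cdot>\<^sub>m 1\<^sub>m 1) B (0\<^sub>m m 1) D)"
    then have ij: "i < ?d" "j < ?d"
      using carr by auto
    have "?Y $$ (i, 0) = col ?Y 0 $ i"
      using ij dims by (simp only: index_col)
    then have "?Y $$ (i, 0) = (if i = 0 then z else 0)"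
      unfolding col using ij by simp
    then show "?Y $$ (i, j) = four_block_mat (z \<cdot>\<^sub>m 1\<^sub>m 1) B (0\<^sub>m m 1) D $$ (i, j)"
      using ij by (cases i; cases j) (auto simp: B_def D_def simp del: index_mult_mat)
  qed (use dims carr in \<open>simp_all del: index_mult_mat\<close>)
  have "unitary (1 + m) (four_block_mat (z \<cdot>\<^sub>m 1\<^sub>m 1) B (0\<^sub>m m 1) D)"
    using unitary_conj_by[OF W(1) V] unfolding Yeq by simp
  then have "?Y = blocks (z \<cdot>\<^sub>m 1\<^sub>m 1) D"
    unfolding Yeq using carr by (intro unitary_upper_block) auto
  moreover from this have "unitary (1 + m) (blocks (z \<cdot>\<^sub>m 1\<^sub>m 1) D)"
    using unitary_conj_by[OF W(1) V] by simp
  then have "unitary m D"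
    using carr by (subst (asm) unitary_blocks_iff) auto
  ultimately show ?thesis
    using W(1) by blast
qed

lemma blocks_scalar_assoc:
  assumes "D \<in> carrier_mat m m"
  shows "blocks (z \<cdot>\<^sub>m 1\<^sub>m 1) (blocks (z \<cdot>\<^sub>m 1\<^sub>m e) D) = blocks (z \<cdot>\<^sub>m 1\<^sub>m (Suc e)) D"
  using assms by (intro eq_matI) (auto simp: blocks_def)

text \<open>Deflation is repeated with the same \<open>z\<close> until the remaining block has lost
  this eigenvalue. That property of \<open>D\<close> is what later forces commuting matrices to
  respect the blocks.\<close>

lemma unitary_isolate_eigenvalue:
  assumes "unitary d V"
  shows "\<exists>W D e m. unitary d W \<and> d = e + m \<and> D \<in> carrier_mat m m \<and> \<not> eigenvalue D z \<and>
    conj_by W V = blocks (z \<cdot>\<^sub>m 1\<^sub>m e) D \<and> (eigenvalue V z \<longrightarrow> 0 < e)"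
  using assms
proof (induction d arbitrary: V)
  case 0
  then have V: "V \<in> carrier_mat 0 0"
    by (rule unitaryD)
  have "\<not> eigenvalue V z"
    using V unfolding eigenvalue_def eigenvector_def by auto
  moreover have "conj_by (1\<^sub>m 0) V = blocks (z \<cdot>\<^sub>m 1\<^sub>m 0) V"
    using V by (intro eq_matI) (auto simp: blocks_def)
  ultimately show ?case
    using V by (intro exI[of _ "1\<^sub>m 0"] exI[of _ V] exI[of _ 0]) auto
next
  case (Suc d)
  show ?case
  proof (cases "eigenvalue V z")
    case False
    have V: "V \<in> carrier_mat (Suc d) (Suc d)"
      using Suc.prems by (rule unitaryD)
    have "conj_by (1\<^sub>m (Suc d)) V = blocks (z \<cdot>\<^sub>m 1\<^sub>m 0) V"
      using V by (intro eq_matI) (auto simp: blocks_def)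
    then show ?thesis
      using V False
      by (intro exI[of _ "1\<^sub>m (Suc d)"] exI[of _ V] exI[of _ 0] exI[of _ "Suc d"]) auto
  next
    case True
    obtain W D where W: "unitary (Suc d) W" "unitary d D" "conj_by W V = blocks (z \<cdot>\<^sub>m 1\<^sub>m 1) D"
      using unitary_deflate[OF Suc.prems True] by blast
    obtain W' D' e m where W': "unitary d W'" "d = e + m" "D' \<in> carrier_mat m m" "\<not> eigenvalue D' z"
      "conj_by W' D = blocks (z \<cdot>\<^sub>m 1\<^sub>m e) D'"
      using Suc.IH[OF W(2)] by blast
    note c = unitaryD(1)[OF W(1)] unitaryD(1)[OF W(2)] unitaryD(1)[OF W'(1)] unitaryD(1)[OF Suc.prems]
    let ?B = "blocks (1\<^sub>m 1) W'"
    have B: "unitary (Suc d) ?B"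
      using unitary_blocks_iff[of "1\<^sub>m 1" 1 W' d] W'(1) c(3) by simp
    have "conj_by (W * ?B) V = conj_by ?B (conj_by W V)"
      using unitaryD(1)[OF B] c by (intro conj_by_conj_by[symmetric])
    also have "\<dots> = blocks (conj_by (1\<^sub>m 1) (z \<cdot>\<^sub>m 1\<^sub>m 1)) (conj_by W' D)"
      unfolding W(3) using c by (intro conj_by_blocks) auto
    also have "conj_by (1\<^sub>m 1) (z \<cdot>\<^sub>m 1\<^sub>m 1) = z \<cdot>\<^sub>m (1\<^sub>m 1 :: complex mat)"
      by (simp add: left_mult_one_mat[of _ 1 1] right_mult_one_mat[of _ 1 1])
    also have "blocks \<dots> (conj_by W' D) = blocks (z \<cdot>\<^sub>m 1\<^sub>m (Suc e)) D'"
      unfolding W'(5) using W'(3) by (rule blocks_scalar_assoc)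
    finally have "conj_by (W * ?B) V = blocks (z \<cdot>\<^sub>m 1\<^sub>m (Suc e)) D'" .
    then show ?thesis
      using unitary_mult[OF W(1) B] W'(2-4)
      by (intro exI[of _ "W * ?B"] exI[of _ D'] exI[of _ "Suc e"] exI[of _ m]) auto
  qed
qed

lemma diagonal_blocks:
  "A \<in> carrier_mat n n \<Longrightarrow> D \<in> carrier_mat m m \<Longrightarrow> diagonal_mat A \<Longrightarrow> diagonal_mat D \<Longrightarrow> diagonal_mat (blocks A D)"
  unfolding diagonal_mat_def blocks_def by auto

text \<open>Comparing lower left blocks gives \<open>D * C = z C\<close>, so a nonzero column of
  \<open>C\<close> would be an eigenvector of \<open>D\<close> for \<open>z\<close>. Unitarity then
  removes the upper right block.\<close>

lemma commuting_block_form: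
  assumes Y: "unitary (e + m) Y" and D: "D \<in> carrier_mat m m" "\<not> eigenvalue D z"
    and comm: "Y * blocks (z \<cdot>\<^sub>m 1\<^sub>m e) D = blocks (z \<cdot>\<^sub>m 1\<^sub>m e) D * Y"
  shows "\<exists>A F. A \<in> carrier_mat e e \<and> F \<in> carrier_mat m m \<and> Y = blocks A F"
proof -
  let ?A = "mat e e (\<lambda>(i, j). Y $$ (i, j))" and ?B = "mat e m (\<lambda>(i, j). Y $$ (i, e + j))"
  let ?C = "mat m e (\<lambda>(i, j). Y $$ (e + i, j))" and ?F = "mat m m (\<lambda>(i, j). Y $$ (e + i, e + j))"
  have carr: "?A \<in> carrier_mat e e" "?B \<in> carrier_mat e m" "?C \<in> carrier_mat m e" "?F \<in> carrier_mat m m"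
    by auto
  have Yeq: "Y = four_block_mat ?A ?B ?C ?F"
    using unitaryD(1)[OF Y] by (intro eq_matI) auto
  let ?Z = "z \<cdot>\<^sub>m 1\<^sub>m e :: complex mat"
  have Zeq: "blocks ?Z D = four_block_mat ?Z (0\<^sub>m e m) (0\<^sub>m m e) D"
    using D by (simp add: blocks_def)
  have "four_block_mat (?A * ?Z + ?B * 0\<^sub>m m e) (?A * 0\<^sub>m e m + ?B * D) (?C * ?Z + ?F * 0\<^sub>m m e) (?C * 0\<^sub>m e m + ?F * D)
      = four_block_mat (?Z * ?A + 0\<^sub>m e m * ?C) (?Z * ?B + 0\<^sub>m e m * ?F) (0\<^sub>m m e * ?A + D * ?C) (0\<^sub>m m e * ?B + D * ?F)"
    using comm unfolding Zeq
    by (subst (asm) (1 2) Yeq)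
      (use D in \<open>subst (asm) (1 2) mult_four_block_mat[of _ e e _ m _ m _ _ e _ m]; auto\<close>)
  then have "?C * ?Z + ?F * 0\<^sub>m m e = 0\<^sub>m m e * ?A + D * ?C"
    by (rule four_block_inject(3)[rotated -1]) (use D in \<open>auto intro!: add_carrier_mat mult_carrier_mat\<close>)
  then have CD: "z \<cdot>\<^sub>m ?C = D * ?C"
    using D by (simp add: mult_smult_distrib[of _ m e _ e] mult_carrier_mat[of _ m m _ e])
  have "?C = 0\<^sub>m m e"
  proof (rule ccontr)
    assume "?C \<noteq> 0\<^sub>m m e"
    then obtain j where j: "j < e" "col ?C j \<noteq> 0\<^sub>v m"
      by (metis (no_types, lifting) carr(3) carrier_matD eq_matI index_col index_zero_mat index_zero_vec(1))
    have "D *\<^sub>v col ?C j = col (D * ?C) j"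
      using D j by (intro col_mult2[symmetric, of _ m m _ e]) auto
    also have "\<dots> = z \<cdot>\<^sub>v col ?C j"
      unfolding CD[symmetric] using j by (intro eq_vecI) auto
    finally have "eigenvector D (col ?C j) z"
      using D j unfolding eigenvector_def by auto
    then show False
      using D(2) unfolding eigenvalue_def by blast
  qed
  then have "Y = four_block_mat ?A ?B (0\<^sub>m m e) ?F"
    using Yeq by simp
  then have "Y = blocks ?A ?F"
    using unitary_upper_block[of e m ?A ?B ?F] Y carr by simp
  then show ?thesis
    using carr by blast
qed

text \<open>An eigenspace of a member that is not diagonal splits the space, and all other members respect
  the splitting.\<close>

theorem simultaneous_diagonalization:
  assumes "\<And>V. V \<in> \<U> \<Longrightarrow> unitary d V" "\<And>V W. V \<in> \<U> \<Longrightarrow> W \<in> \<U> \<Longrightarrow> V * W = W * V"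
  shows "\<exists>P. unitary d P \<and> (\<forall>V\<in>\<U>. diagonal_mat (conj_by P V))"
  using assms
proof (induction d arbitrary: \<U> rule: less_induct)
  case (less d)
  note carr = unitaryD(1)[OF less.prems(1)]
  show ?case
  proof (cases "\<forall>V\<in>\<U>. diagonal_mat V")
    case True
    have "conj_by (1\<^sub>m d) V = V" if "V \<in> \<U>" for V
      using carr[OF that] by simp
    then show ?thesis
      using True by (intro exI[of _ "1\<^sub>m d"]) auto
  next
    case False
    then obtain V where V: "V \<in> \<U>" "\<not> diagonal_mat V"
      by blast
    have "0 < d"
      using V carr[OF V(1)] by (auto simp: diagonal_mat_def)
    then obtain z where z: "eigenvalue V z"
      using spectrum_non_empty[OF carr[OF V(1)]] unfolding spectrum_def by blast
    obtain W D e m where W: "unitary d W" "d = e + m" "D \<in> carrier_mat m m" "\<not> eigenvalue D z"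
      "conj_by W V = blocks (z \<cdot>\<^sub>m 1\<^sub>m e) D" "0 < e"
      using unitary_isolate_eigenvalue[OF less.prems(1)[OF V(1)], of z] z by blast
    note Wc = unitaryD(1)[OF W(1)]
    \<comment> \<open>Both blocks must be smaller than \<open>d\<close> for the induction. An empty
      second block would make \<open>V\<close> a scalar matrix, hence diagonal.\<close>
    have "0 < m"
    proof (rule ccontr)
      assume "\<not> 0 < m"
      then have "conj_by W V = z \<cdot>\<^sub>m 1\<^sub>m d"
        using W(2,3,5) by (auto simp: blocks_def)
      then have "V = conj_by (mat_adjoint W) (z \<cdot>\<^sub>m 1\<^sub>m d)"
        using conj_by_cancel[OF W(1) carr[OF V(1)]] by simp
      also have "\<dots> = z \<cdot>\<^sub>m (W * mat_adjoint W)"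
        using Wc by (simp add: mult_smult_distrib[of _ d d _ d] mult_smult_assoc_mat[of _ d d _ d])
      finally have "V = z \<cdot>\<^sub>m 1\<^sub>m d"
        unfolding unitaryD(2)[OF W(1)] .
      then show False
        using V(2) by (auto simp: diagonal_mat_def)
    qed
    let ?Y = "conj_by W"
    have Yu: "unitary d (?Y X)" if "X \<in> \<U>" for X
      using unitary_conj_by[OF W(1) less.prems(1)[OF that]] .
    have Ycomm: "?Y X * ?Y X' = ?Y X' * ?Y X" if "X \<in> \<U>" "X' \<in> \<U>" for X X'
      using conj_by_mult[OF W(1) carr carr] less.prems(2) that by metis
    have "\<forall>X\<in>\<U>. \<exists>AF. fst AF \<in> carrier_mat e e \<and> snd AF \<in> carrier_mat m m \<and> ?Y X = blocks (fst AF) (snd AF)"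
    proof
      fix X assume X: "X \<in> \<U>"
      obtain A F where "A \<in> carrier_mat e e" "F \<in> carrier_mat m m" "?Y X = blocks A F"
        using commuting_block_form[of e m "?Y X" D z] Yu[OF X] Ycomm[OF X V(1)] W by auto
      then show "\<exists>AF. fst AF \<in> carrier_mat e e \<and> snd AF \<in> carrier_mat m m \<and> ?Y X = blocks (fst AF) (snd AF)"
        by (intro exI[of _ "(A, F)"]) simp
    qed
    from bchoice[OF this] obtain AF where "\<forall>X\<in>\<U>. fst (AF X) \<in> carrier_mat e e \<and>
      snd (AF X) \<in> carrier_mat m m \<and> ?Y X = blocks (fst (AF X)) (snd (AF X))" ..
    then have AF: "\<And>X. X \<in> \<U> \<Longrightarrow> fst (AF X) \<in> carrier_mat e e"
      "\<And>X. X \<in> \<U> \<Longrightarrow> snd (AF X) \<in> carrier_mat m m"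
      "\<And>X. X \<in> \<U> \<Longrightarrow> ?Y X = blocks (fst (AF X)) (snd (AF X))"
      by simp_all
    have un: "unitary e (fst (AF X))" "unitary m (snd (AF X))" if "X \<in> \<U>" for X
      using Yu[OF that] AF[OF that] W(2) unitary_blocks_iff by auto
    have comm: "fst (AF X) * fst (AF X') = fst (AF X') * fst (AF X)"
      "snd (AF X) * snd (AF X') = snd (AF X') * snd (AF X)" if X: "X \<in> \<U>" "X' \<in> \<U>" for X X'
    proof -
      note c = AF(1,2)[OF X(1)] AF(1,2)[OF X(2)]
      have "blocks (fst (AF X) * fst (AF X')) (snd (AF X) * snd (AF X'))
          = blocks (fst (AF X') * fst (AF X)) (snd (AF X') * snd (AF X))"
        using Ycomm[OF X] unfolding AF(3)[OF X(1)] AF(3)[OF X(2)]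
        by (simp only: blocks_mult[OF c(1,3,2,4)] blocks_mult[OF c(3,1,4,2)])
      note inj = blocks_inject[OF mult_carrier_mat[OF c(1,3)] mult_carrier_mat[OF c(3,1)]
          mult_carrier_mat[OF c(2,4)] mult_carrier_mat[OF c(4,2)] this]
      show "fst (AF X) * fst (AF X') = fst (AF X') * fst (AF X)"
        "snd (AF X) * snd (AF X') = snd (AF X') * snd (AF X)"
        by (rule inj)+
    qed
    have "\<exists>P. unitary e P \<and> (\<forall>A\<in>(\<lambda>X. fst (AF X)) ` \<U>. diagonal_mat (conj_by P A))"
      by (rule less.IH) (use W(2) \<open>0 < m\<close> un(1) comm(1) in auto)
    then obtain P where P: "unitary e P" "\<And>X. X \<in> \<U> \<Longrightarrow> diagonal_mat (conj_by P (fst (AF X)))"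
      by blast
    have "\<exists>Q. unitary m Q \<and> (\<forall>A\<in>(\<lambda>X. snd (AF X)) ` \<U>. diagonal_mat (conj_by Q A))"
      by (rule less.IH) (use W(2,6) un(2) comm(2) in auto)
    then obtain Q where Q: "unitary m Q" "\<And>X. X \<in> \<U> \<Longrightarrow> diagonal_mat (conj_by Q (snd (AF X)))"
      by blast
    note PQ = unitaryD(1)[OF P(1)] unitaryD(1)[OF Q(1)]
    have B: "unitary d (blocks P Q)"
      unfolding W(2) using unitary_blocks_iff[OF PQ] P(1) Q(1) by simp
    have "diagonal_mat (conj_by (W * blocks P Q) X)" if X: "X \<in> \<U>" for X
    proof -
      have "conj_by (W * blocks P Q) X = conj_by (blocks P Q) (?Y X)"
        using conj_by_conj_by[OF Wc unitaryD(1)[OF B] carr[OF X]] by simp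
      also have "\<dots> = blocks (conj_by P (fst (AF X))) (conj_by Q (snd (AF X)))"
        unfolding AF(3)[OF X] using PQ AF(1,2)[OF X] by (intro conj_by_blocks)
      finally show ?thesis
        using diagonal_blocks[OF conj_by_carrier conj_by_carrier] PQ AF(1,2)[OF X] P(2)[OF X] Q(2)[OF X] by simp
    qed
    then show ?thesis
      using unitary_mult[OF W(1) B] by blast
  qed
qed

section \<open>Matrices of circuits\<close>

lemma gate_mat_carrier [simp]: "gate_mat N g \<in> carrier_mat (2 ^ N) (2 ^ N)"
  by (simp add: gate_mat_def)

lemma gates_mat_Nil [simp]: "gates_mat N [] = 1\<^sub>m (2 ^ N)"
  by (simp add: gates_mat_def)

lemma gates_mat_snoc: "gates_mat N (gs @ [g]) = gate_mat N g * gates_mat N gs"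
  by (simp add: gates_mat_def)

lemma gates_mat_carrier [simp]: "gates_mat N gs \<in> carrier_mat (2 ^ N) (2 ^ N)"
proof (induction gs rule: rev_induct)
  case (snoc g gs)
  then show ?case
    unfolding gates_mat_snoc by (rule mult_carrier_mat[OF gate_mat_carrier])
qed simp

lemma gates_mat_append: "gates_mat N (gs @ hs) = gates_mat N hs * gates_mat N gs"
proof (induction hs rule: rev_induct)
  case Nil
  show ?case
    by (simp add: left_mult_one_mat[OF gates_mat_carrier])
next
  case (snoc h hs)
  have "gates_mat N (gs @ hs @ [h]) = gate_mat N h * (gates_mat N hs * gates_mat N gs)"
    using gates_mat_snoc[of N "gs @ hs" h] snoc by simp
  also have "\<dots> = gate_mat N h * gates_mat N hs * gates_mat N gs"
    by (rule assoc_mult_mat[symmetric, OF gate_mat_carrier gates_mat_carrier gates_mat_carrier])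
  finally show ?case
    unfolding gates_mat_snoc .
qed

lemma gates_mat_single [simp]: "gates_mat N [g] = gate_mat N g"
  using gates_mat_snoc[of N "[]" g] gate_mat_carrier[of N g] by simp

lemma mult_index:
  assumes "A \<in> carrier_mat n k" "B \<in> carrier_mat k m" "i < n" "j < m"
  shows "(A * B) $$ (i, j) = (\<Sum>l<k. A $$ (i, l) * B $$ (l, j))"
  using assms by (auto simp: scalar_prod_def lessThan_atLeast0 intro!: sum.cong)

text \<open>The list form of \<open>implements\<close>, which composes regardless of the division
  into layers.\<close>

definition implements_gates :: "nat \<Rightarrow> nat \<Rightarrow> gate list \<Rightarrow> complex mat \<Rightarrow> bool" where
  "implements_gates w a gs M \<longleftrightarrow> (\<forall>x < 2 ^ (w + a). \<forall>y < 2 ^ w.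
     gates_mat (w + a) gs $$ (x, y) = (if x < 2 ^ w then M $$ (x, y) else 0))"

lemma implements_iff: "implements w a c M \<longleftrightarrow> implements_gates w a (concat c) M"
  by (simp add: implements_def implements_gates_def)

text \<open>The first circuit returns its ancillae to 0, so the sum over intermediate states
  collapses to indices below \<open>2 ^ w\<close>.\<close>

lemma implements_gates_append:
  assumes gs: "implements_gates w a gs M" and hs: "implements_gates w a hs M'"
    and M: "M \<in> carrier_mat (2 ^ w) (2 ^ w)" "M' \<in> carrier_mat (2 ^ w) (2 ^ w)"
  shows "implements_gates w a (gs @ hs) (M' * M)"
  unfolding implements_gates_def
proof (intro allI impI)
  fix x y :: nat assume x: "x < 2 ^ (w + a)" and y: "y < 2 ^ w"
  have le: "(2 :: nat) ^ w \<le> 2 ^ (w + a)"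
    by (intro power_increasing) auto
  have "gates_mat (w + a) (gs @ hs) $$ (x, y)
      = (\<Sum>z<2 ^ (w + a). gates_mat (w + a) hs $$ (x, z) * gates_mat (w + a) gs $$ (z, y))"
    unfolding gates_mat_append using x less_le_trans[OF y le]
    by (intro mult_index[OF gates_mat_carrier gates_mat_carrier])
  also have "\<dots> = (\<Sum>z<2 ^ (w + a). gates_mat (w + a) hs $$ (x, z) * (if z < 2 ^ w then M $$ (z, y) else 0))"
    using gs y unfolding implements_gates_def by (intro sum.cong) auto
  also have "\<dots> = (\<Sum>z<2 ^ w. gates_mat (w + a) hs $$ (x, z) * M $$ (z, y))"
    using le by (intro sum.mono_neutral_cong_right) auto
  also have "\<dots> = (\<Sum>z<2 ^ w. (if x < 2 ^ w then M' $$ (x, z) else 0) * M $$ (z, y))"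
    using hs x unfolding implements_gates_def by (intro sum.cong) auto
  also have "\<dots> = (if x < 2 ^ w then (M' * M) $$ (x, y) else 0)"
    using mult_index[OF M(2,1), of x y] y by simp
  finally show "gates_mat (w + a) (gs @ hs) $$ (x, y) = (if x < 2 ^ w then (M' * M) $$ (x, y) else 0)" .
qed

lemma nat_less_power_iff_bit: "(x :: nat) < 2 ^ N \<longleftrightarrow> (\<forall>q\<ge>N. \<not> bit x q)"
proof
  assume "x < 2 ^ N"
  then have "take_bit N x = x"
    by (simp add: take_bit_nat_eq_self_iff)
  then show "\<forall>q\<ge>N. \<not> bit x q"
    by (metis bit_take_bit_iff not_le)
next
  assume *: "\<forall>q\<ge>N. \<not> bit x q"
  have "take_bit N x = x"
    by (rule bit_eqI) (use * not_le in \<open>auto simp: bit_take_bit_iff\<close>)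
  then show "x < 2 ^ N"
    by (simp add: take_bit_nat_eq_self_iff)
qed

lemma implements_gates_local:
  assumes "\<And>g. g \<in> set gs \<Longrightarrow> qubits g \<subseteq> {..<w}"
  shows "implements_gates w a gs (gates_mat w gs)"
  using assms
proof (induction gs rule: rev_induct)
  case Nil
  have le: "(2 :: nat) ^ w \<le> 2 ^ (w + a)"
    by (intro power_increasing) auto
  show ?case
    unfolding implements_gates_def using less_le_trans[OF _ le] by simp
next
  case (snoc g gs)
  have g: "qubits g \<subseteq> {..<w}"
    using snoc.prems by simp
  have "implements_gates w a [g] (gate_mat w g)"
    unfolding implements_gates_def
  proof (intro allI impI)
    fix x y :: nat assume x: "x < 2 ^ (w + a)" and y: "y < 2 ^ w"
    have le: "(2 :: nat) ^ w \<le> 2 ^ (w + a)"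
      by (intro power_increasing) auto
    have out: "\<not> bit y q" "q \<notin> set (targets g)" if "w \<le> q" for q
      using y g that unfolding nat_less_power_iff_bit qubits_def by auto
    \<comment> \<open>Ancillae are not targets here, so agreement off the targets forces the ancilla
      bits of \<open>x\<close> to equal those of \<open>y\<close>, which are 0.\<close>
    have agree: "(\<forall>q < w + a. q \<notin> set (targets g) \<longrightarrow> bit x q = bit y q) \<longleftrightarrow>
        x < 2 ^ w \<and> (\<forall>q < w. q \<notin> set (targets g) \<longrightarrow> bit x q = bit y q)"
    proof
      assume L: "\<forall>q < w + a. q \<notin> set (targets g) \<longrightarrow> bit x q = bit y q"
      have "\<not> bit x q" if "w \<le> q" for q
      proof (cases "q < w + a")
        case True
        then show ?thesis
          using L out[OF that] by blast
      next
        case False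
        then show ?thesis
          using x unfolding nat_less_power_iff_bit by simp
      qed
      then show "x < 2 ^ w \<and> (\<forall>q < w. q \<notin> set (targets g) \<longrightarrow> bit x q = bit y q)"
        using L unfolding nat_less_power_iff_bit by simp
    next
      assume "x < 2 ^ w \<and> (\<forall>q < w. q \<notin> set (targets g) \<longrightarrow> bit x q = bit y q)"
      then show "\<forall>q < w + a. q \<notin> set (targets g) \<longrightarrow> bit x q = bit y q"
        using out unfolding nat_less_power_iff_bit by (metis not_le)
    qed
    show "gates_mat (w + a) [g] $$ (x, y) = (if x < 2 ^ w then gate_mat w g $$ (x, y) else 0)"
    proof (cases "x < 2 ^ w")
      case True
      then show ?thesis
        using agree x y less_le_trans[OF y le] by (simp add: gate_mat_def)
    next
      case False
      then have "\<not> (\<forall>q < w + a. q \<notin> set (targets g) \<longrightarrow> bit x q = bit y q)" "x \<noteq> y"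
        using agree y by auto
      then show ?thesis
        using False x less_le_trans[OF y le] unfolding gates_mat_single gate_mat_def by auto
    qed
  qed
  then show ?case
    unfolding gates_mat_snoc using snoc by (intro implements_gates_append) auto
qed

text \<open>Controls are the low \<open>n\<close> bits, hence \<open>mod\<close>; targets are the
  high bits, hence \<open>div\<close>. \<open>f\<close> moves the control state, and
  \<open>V\<close> is chosen by the control state before the move.\<close>

definition block_op :: "nat \<Rightarrow> nat \<Rightarrow> (nat \<Rightarrow> nat) \<Rightarrow> (nat \<Rightarrow> complex mat) \<Rightarrow> complex mat" where
  "block_op n m f V = mat (2 ^ (n + m)) (2 ^ (n + m)) (\<lambda>(x, y).
     if x mod 2 ^ n = f (y mod 2 ^ n) then V (y mod 2 ^ n) $$ (x div 2 ^ n, y div 2 ^ n) else 0)"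

lemma block_op_carrier [simp]: "block_op n m f V \<in> carrier_mat (2 ^ (n + m)) (2 ^ (n + m))"
  by (simp add: block_op_def)

lemma div_less_power: "x < 2 ^ (n + m) \<Longrightarrow> x div 2 ^ n < (2 ^ m :: nat)"
  by (simp add: less_mult_imp_div_less power_add mult.commute)

lemma block_op_cong:
  assumes "\<And>c. c < 2 ^ n \<Longrightarrow> f c = g c" "\<And>c. c < 2 ^ n \<Longrightarrow> V c = W c"
  shows "block_op n m f V = block_op n m g W"
  unfolding block_op_def using assms by (intro cong_mat) auto

lemma block_op_mult:
  assumes g: "\<And>c. c < 2 ^ n \<Longrightarrow> g c < 2 ^ n"
    and V: "\<And>c. c < 2 ^ n \<Longrightarrow> V c \<in> carrier_mat (2 ^ m) (2 ^ m)"
    and W: "\<And>c. c < 2 ^ n \<Longrightarrow> W c \<in> carrier_mat (2 ^ m) (2 ^ m)"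
  shows "block_op n m f V * block_op n m g W = block_op n m (\<lambda>c. f (g c)) (\<lambda>c. V (g c) * W c)"
proof (rule eq_matI)
  let ?N = "2 ^ (n + m) :: nat"
  fix x y assume "x < dim_row (block_op n m (\<lambda>c. f (g c)) (\<lambda>c. V (g c) * W c))"
    "y < dim_col (block_op n m (\<lambda>c. f (g c)) (\<lambda>c. V (g c) * W c))"
  then have xy: "x < ?N" "y < ?N"
    by (simp_all add: block_op_def)
  let ?c = "g (y mod 2 ^ n)"
  have c: "?c < 2 ^ n"
    by (intro g) simp
  \<comment> \<open>Enumerates the intermediate indices with control part \<open>?c\<close>; all
    others contribute 0 to the matrix product.\<close>
  let ?h = "\<lambda>t. ?c + 2 ^ n * t"
  have h: "?h t < ?N" if "t < 2 ^ m" for t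
  proof -
    have "?h t < 2 ^ n * Suc t"
      using c by simp
    also have "\<dots> \<le> 2 ^ n * 2 ^ m"
      using that by (intro mult_le_mono2) simp
    finally show ?thesis
      by (simp add: power_add)
  qed
  have im: "?h ` {..<2 ^ m} = {z \<in> {..<?N}. z mod 2 ^ n = ?c}"
  proof
    show "?h ` {..<2 ^ m} \<subseteq> {z \<in> {..<?N}. z mod 2 ^ n = ?c}"
      using h c by auto
    show "{z \<in> {..<?N}. z mod 2 ^ n = ?c} \<subseteq> ?h ` {..<2 ^ m}"
    proof
      fix z assume z: "z \<in> {z \<in> {..<?N}. z mod 2 ^ n = ?c}"
      then have "z = ?h (z div 2 ^ n)" "z div 2 ^ n < 2 ^ m"
        using div_less_power mod_mult_div_eq[of z "2 ^ n"] by auto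
      then show "z \<in> ?h ` {..<2 ^ m}"
        by blast
    qed
  qed
  let ?F = "\<lambda>z. block_op n m f V $$ (x, z) * block_op n m g W $$ (z, y)"
  have "(block_op n m f V * block_op n m g W) $$ (x, y) = (\<Sum>z<?N. ?F z)"
    using xy by (intro mult_index) auto
  also have "\<dots> = (\<Sum>z\<in>{z \<in> {..<?N}. z mod 2 ^ n = ?c}. ?F z)"
    using xy by (intro sum.mono_neutral_right) (auto simp: block_op_def)
  also have "\<dots> = (\<Sum>t<2 ^ m. ?F (?h t))"
    unfolding im[symmetric] by (subst sum.reindex) (auto simp: inj_on_def)
  also have "\<dots> = (\<Sum>t<2 ^ m. if x mod 2 ^ n = f ?c
      then V ?c $$ (x div 2 ^ n, t) * W (y mod 2 ^ n) $$ (t, y div 2 ^ n) else 0)"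
    using xy h c by (intro sum.cong) (auto simp: block_op_def)
  also have "\<dots> = (if x mod 2 ^ n = f ?c then (V ?c * W (y mod 2 ^ n)) $$ (x div 2 ^ n, y div 2 ^ n) else 0)"
    using mult_index[OF V[OF c] W[of "y mod 2 ^ n"], of "x div 2 ^ n" "y div 2 ^ n"]
      div_less_power[OF xy(1)] div_less_power[OF xy(2)] by simp
  finally show "(block_op n m f V * block_op n m g W) $$ (x, y)
      = block_op n m (\<lambda>c. f (g c)) (\<lambda>c. V (g c) * W c) $$ (x, y)"
    using xy by (simp add: block_op_def)
qed (auto simp: block_op_def)

lemma mod_div_eq_iff: "x mod k = y mod k \<and> x div k = y div k \<longleftrightarrow> x = (y :: nat)"
  by (metis mod_mult_div_eq)

abbreviation diag_block :: "nat \<Rightarrow> nat \<Rightarrow> (nat \<Rightarrow> complex mat) \<Rightarrow> complex mat" where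
  "diag_block n m \<equiv> block_op n m (\<lambda>c. c)"

lemma block_op_one: "diag_block n m (\<lambda>c. 1\<^sub>m (2 ^ m)) = 1\<^sub>m (2 ^ (n + m))"
proof (rule eq_matI)
  fix x y assume "x < dim_row (1\<^sub>m (2 ^ (n + m)) :: complex mat)" "y < dim_col (1\<^sub>m (2 ^ (n + m)) :: complex mat)"
  then show "diag_block n m (\<lambda>c. 1\<^sub>m (2 ^ m)) $$ (x, y) = 1\<^sub>m (2 ^ (n + m)) $$ (x, y)"
    using div_less_power[of x n m] div_less_power[of y n m] mod_div_eq_iff[of x "2 ^ n" y]
    by (auto simp: block_op_def)
qed (auto simp: block_op_def)

lemma bit_sub_index: "bit (sub_index ts x) k \<longleftrightarrow> k < length ts \<and> bit x (ts ! k)"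
  unfolding sub_index_def by (auto simp: bit_horner_sum_bit_iff)

lemma sub_index_less: "sub_index ts x < 2 ^ length ts"
  unfolding nat_less_power_iff_bit bit_sub_index by simp

lemma sub_index_target:
  assumes "x < 2 ^ (n + m)"
  shows "sub_index [n..<n + m] x = x div 2 ^ n"
proof (rule bit_eqI)
  fix k
  have "bit (x div 2 ^ n) k \<longleftrightarrow> bit x (n + k)"
    by (simp add: drop_bit_eq_div[symmetric] bit_drop_bit_eq)
  moreover have "k < m" if "bit x (n + k)"
    using assms that unfolding nat_less_power_iff_bit by (metis add_le_cancel_left not_le)
  ultimately show "bit (sub_index [n..<n + m] x) k = bit (x div 2 ^ n) k"
    by (auto simp: bit_sub_index)
qed

lemma mod_power_eq_iff: "x mod 2 ^ n = (y :: nat) mod 2 ^ n \<longleftrightarrow> (\<forall>q<n. bit x q = bit y q)"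
  unfolding take_bit_eq_mod[symmetric] bit_eq_iff[of "take_bit n x"] bit_take_bit_iff by auto

lemma bit_mod_power: "q < n \<Longrightarrow> bit (x mod 2 ^ n) q \<longleftrightarrow> bit (x :: nat) q"
  by (simp add: take_bit_eq_mod[symmetric] bit_take_bit_iff)

lemma C_gate_block_op:
  assumes "Q \<subseteq> {..<n}"
  shows "gate_mat (n + m) (C_gate n m Q V) = diag_block n m (\<lambda>c. if \<forall>q\<in>Q. bit c q then V else 1\<^sub>m (2 ^ m))"
proof (rule eq_matI)
  fix x y assume "x < dim_row (diag_block n m (\<lambda>c. if \<forall>q\<in>Q. bit c q then V else 1\<^sub>m (2 ^ m)))"
    "y < dim_col (diag_block n m (\<lambda>c. if \<forall>q\<in>Q. bit c q then V else 1\<^sub>m (2 ^ m)))"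
  then have xy: "x < 2 ^ (n + m)" "y < 2 ^ (n + m)"
    by (simp_all add: block_op_def)
  have 1: "(\<forall>q\<in>Q. bit (y mod 2 ^ n) q) \<longleftrightarrow> (\<forall>q\<in>Q. bit y q)"
    using assms bit_mod_power by blast
  have 2: "(\<forall>q<n + m. q \<notin> set [n..<n + m] \<longrightarrow> bit x q = bit y q) \<longleftrightarrow> x mod 2 ^ n = y mod 2 ^ n"
    unfolding mod_power_eq_iff by auto
  show "gate_mat (n + m) (C_gate n m Q V) $$ (x, y)
      = diag_block n m (\<lambda>c. if \<forall>q\<in>Q. bit c q then V else 1\<^sub>m (2 ^ m)) $$ (x, y)"
    using xy 1 2 div_less_power[OF xy(1)] div_less_power[OF xy(2)] mod_div_eq_iff[of x "2 ^ n" y]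
    by (auto simp: gate_mat_def C_gate_def block_op_def sub_index_target simp del: set_upt)
qed (auto simp: block_op_def gate_mat_def)

section \<open>CNOTs as permutations of basis states\<close>

definition cnot_act :: "nat \<times> nat \<Rightarrow> nat \<Rightarrow> nat" where
  "cnot_act g x = (if bit x (fst g) then flip_bit (snd g) x else x)"

lemma bit_cnot_act: "bit (cnot_act (c, t) x) q \<longleftrightarrow> bit x q \<noteq> (q = t \<and> bit x c)"
  by (auto simp: cnot_act_def bit_flip_bit_iff)

text \<open>The link between symbolic states and basis states: XOR of bits is symmetric difference
  of the sets of initial bits.\<close>

lemma bit_run_cnots:
  "bit (fold cnot_act gs x) q \<longleftrightarrow> parity (run_cnots gs init q) {q. bit x q}"
  "finite (run_cnots gs init q)"
proof (induction gs arbitrary: q rule: rev_induct)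
  case (snoc g gs)
  obtain c t where g: "g = (c, t)"
    by fastforce
  {
    case 1
    show ?case
      using snoc by (simp add: g bit_cnot_act add_parity_apply parity_symdiff)
  next
    case 2
    show ?case
      using snoc by (simp add: g add_parity_apply)
  }
qed simp_all

lemma cnot_act_less: "t < N \<Longrightarrow> x < 2 ^ N \<Longrightarrow> cnot_act (c, t) x < 2 ^ N"
  unfolding nat_less_power_iff_bit bit_cnot_act by auto

lemma fold_cnot_act_less:
  "(\<And>g. g \<in> set gs \<Longrightarrow> snd g < N) \<Longrightarrow> x < 2 ^ N \<Longrightarrow> fold cnot_act gs x < 2 ^ N"
proof (induction gs arbitrary: x)
  case (Cons g gs)
  then show ?case
    using cnot_act_less[of "snd g" N x "fst g"] by simp
qed simp

abbreviation cnot_gate :: "nat \<times> nat \<Rightarrow> gate" where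
  "cnot_gate g \<equiv> cnot (fst g) (snd g)"

lemma gate_mat_cnot:
  assumes "t < N" "x < 2 ^ N" "y < 2 ^ N"
  shows "gate_mat N (cnot c t) $$ (x, y) = of_bool (x = cnot_act (c, t) y)"
proof -
  have sub: "sub_index [t] z = of_bool (bit z t)" for z
    by (simp add: sub_index_def)
  have X: "mat_of_rows_list 2 [[0, 1], [1, 0]] $$ (of_bool p, of_bool q) = (of_bool (p \<noteq> q) :: complex)" for p q
    by (cases p; cases q) (simp_all add: mat_of_rows_list_def)
  have "x = cnot_act (c, t) y \<longleftrightarrow> (\<forall>q<N. bit x q = bit (cnot_act (c, t) y) q)"
    using assms(2) cnot_act_less[OF assms(1,3), of c] unfolding nat_less_power_iff_bit
    by (metis bit_eq_iff not_le)
  also have "\<dots> \<longleftrightarrow> (if bit y c then (\<forall>q<N. q \<noteq> t \<longrightarrow> bit x q = bit y q) \<and> bit x t \<noteq> bit y t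
      else \<forall>q<N. bit x q = bit y q)"
    unfolding bit_cnot_act using assms(1) by auto
  also have "(\<forall>q<N. bit x q = bit y q) \<longleftrightarrow> x = y"
    using assms(2,3) unfolding nat_less_power_iff_bit by (metis bit_eq_iff not_le)
  finally show ?thesis
    using assms by (auto simp: gate_mat_def cnot_def sub X)
qed

lemma gates_mat_cnots:
  assumes "\<And>g. g \<in> set gs \<Longrightarrow> snd g < N" "x < 2 ^ N" "y < 2 ^ N"
  shows "gates_mat N (map cnot_gate gs) $$ (x, y) = of_bool (x = fold cnot_act gs y)"
  using assms
proof (induction gs arbitrary: x rule: rev_induct)
  case (snoc g gs)
  let ?y = "fold cnot_act gs y"
  have y: "?y < 2 ^ N"
    using snoc.prems by (intro fold_cnot_act_less) auto
  have "gates_mat N (map cnot_gate (gs @ [g])) $$ (x, y)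
      = (\<Sum>z<2 ^ N. gate_mat N (cnot_gate g) $$ (x, z) * gates_mat N (map cnot_gate gs) $$ (z, y))"
    using snoc.prems by (simp add: gates_mat_snoc) (intro mult_index; simp)
  also have "\<dots> = (\<Sum>z<2 ^ N. of_bool (x = cnot_act g z) * of_bool (z = ?y))"
    using snoc by (intro sum.cong) (simp_all add: gate_mat_cnot)
  also have "\<dots> = (\<Sum>z<2 ^ N. if z = ?y then of_bool (x = cnot_act g ?y) else 0)"
    by (intro sum.cong) auto
  also have "\<dots> = of_bool (x = fold cnot_act (gs @ [g]) y)"
    using y by simp
  finally show ?case .
qed simp

lemma gates_mat_control_cnots:
  assumes "\<And>g. g \<in> set gs \<Longrightarrow> fst g < n \<and> snd g < n"
  shows "gates_mat (n + m) (map cnot_gate gs) = block_op n m (fold cnot_act gs) (\<lambda>c. 1\<^sub>m (2 ^ m))"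
proof (rule eq_matI)
  fix x y assume "x < dim_row (block_op n m (fold cnot_act gs) (\<lambda>c. 1\<^sub>m (2 ^ m)))"
    "y < dim_col (block_op n m (fold cnot_act gs) (\<lambda>c. 1\<^sub>m (2 ^ m)))"
  then have xy: "x < 2 ^ (n + m)" "y < 2 ^ (n + m)"
    by (simp_all add: block_op_def)
  have "fold cnot_act gs y mod 2 ^ n = fold cnot_act gs (y mod 2 ^ n) \<and>
      fold cnot_act gs y div 2 ^ n = y div 2 ^ n"
    using assms
  proof (induction gs arbitrary: y)
    case (Cons g gs)
    obtain c t where g: "g = (c, t)" "c < n" "t < n"
      using Cons.prems by (metis list.set_intros(1) prod.collapse)
    have "cnot_act (c, t) y mod 2 ^ n = cnot_act (c, t) (y mod 2 ^ n)"
      unfolding take_bit_eq_mod[symmetric] using g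
      by (intro bit_eqI) (auto simp: bit_cnot_act bit_take_bit_iff)
    moreover have "cnot_act (c, t) y div 2 ^ n = y div 2 ^ n"
      unfolding drop_bit_eq_div[symmetric] using g
      by (intro bit_eqI) (auto simp: bit_cnot_act bit_drop_bit_eq)
    ultimately show ?case
      using Cons.IH[of "cnot_act (c, t) y"] Cons.prems g(1) by simp
  qed simp
  moreover have "gates_mat (n + m) (map cnot_gate gs) $$ (x, y) = of_bool (x = fold cnot_act gs y)"
    using assms xy by (intro gates_mat_cnots) (auto intro: trans_less_add1)
  ultimately show "gates_mat (n + m) (map cnot_gate gs) $$ (x, y)
      = block_op n m (fold cnot_act gs) (\<lambda>c. 1\<^sub>m (2 ^ m)) $$ (x, y)"
    using xy mod_div_eq_iff[of x "2 ^ n" "fold cnot_act gs y"] div_less_power[OF xy(1)] div_less_power[OF xy(2)]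
    by (auto simp: block_op_def)
qed (auto simp: block_op_def carrier_matD[OF gates_mat_carrier])

section \<open>Diagonal gates and fan-out of the target register\<close>

definition diag_op :: "nat \<Rightarrow> (nat \<Rightarrow> complex) \<Rightarrow> complex mat" where
  "diag_op N d = mat (2 ^ N) (2 ^ N) (\<lambda>(x, y). if x = y then d x else 0)"

lemma diag_op_carrier [simp]: "diag_op N d \<in> carrier_mat (2 ^ N) (2 ^ N)"
  by (simp add: diag_op_def)

definition gate_phase :: "gate \<Rightarrow> nat \<Rightarrow> complex" where
  "gate_phase g x = (if \<forall>q\<in>controls g. bit x q
     then action g $$ (sub_index (targets g) x, sub_index (targets g) x) else 1)"

definition diagonal_gate :: "gate \<Rightarrow> bool" where
  "diagonal_gate g \<longleftrightarrow> diagonal_mat (action g) \<and>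
     action g \<in> carrier_mat (2 ^ length (targets g)) (2 ^ length (targets g))"

lemma gate_mat_diagonal:
  assumes "diagonal_gate g"
  shows "gate_mat N g = diag_op N (gate_phase g)"
proof (rule eq_matI)
  fix x y assume "x < dim_row (diag_op N (gate_phase g))" "y < dim_col (diag_op N (gate_phase g))"
  then have xy: "x < 2 ^ N" "y < 2 ^ N"
    by (simp_all add: diag_op_def)
  let ?s = "sub_index (targets g)"
  have "action g $$ (?s x, ?s y) = 0" if agree: "\<forall>q < N. q \<notin> set (targets g) \<longrightarrow> bit x q = bit y q" and "x \<noteq> y"
  proof -
    have "?s x \<noteq> ?s y"
    proof
      assume eq: "?s x = ?s y"
      have "bit x q = bit y q" if "q \<in> set (targets g)" for q
      proof -
        obtain k where "k < length (targets g)" "targets g ! k = q"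
          using \<open>q \<in> set (targets g)\<close> by (auto simp: in_set_conv_nth)
        then show ?thesis
          using bit_sub_index[of "targets g" x k] bit_sub_index[of "targets g" y k] eq by simp
      qed
      then have "bit x q = bit y q" for q
        using agree xy unfolding nat_less_power_iff_bit by (metis not_le)
      then show False
        using \<open>x \<noteq> y\<close> bit_eq_iff by blast
    qed
    then show ?thesis
      using assms sub_index_less[of "targets g" x] sub_index_less[of "targets g" y]
      unfolding diagonal_gate_def diagonal_mat_def by auto
  qed
  then show "gate_mat N g $$ (x, y) = diag_op N (gate_phase g) $$ (x, y)"
    using xy by (auto simp: gate_mat_def diag_op_def gate_phase_def)
qed (auto simp: gate_mat_def diag_op_def)

lemma gates_mat_diagonal:
  assumes "\<And>g. g \<in> set gs \<Longrightarrow> diagonal_gate g"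
  shows "gates_mat N gs = diag_op N (\<lambda>x. \<Prod>g\<leftarrow>gs. gate_phase g x)"
  using assms
proof (induction gs rule: rev_induct)
  case Nil
  show ?case
    by (intro eq_matI) (auto simp: diag_op_def)
next
  case (snoc g gs)
  let ?d = "\<lambda>gs. diag_op N (\<lambda>x. \<Prod>g\<leftarrow>gs. gate_phase g x)"
  have "diag_op N (gate_phase g) * ?d gs
      = ?d (gs @ [g])"
  proof (rule eq_matI)
    fix x y assume "x < dim_row (?d (gs @ [g]))"
      "y < dim_col (?d (gs @ [g]))"
    then have xy: "x < 2 ^ N" "y < 2 ^ N"
      by (simp_all add: diag_op_def)
    have "(diag_op N (gate_phase g) * ?d gs) $$ (x, y)
        = (\<Sum>z<2 ^ N. diag_op N (gate_phase g) $$ (x, z) * ?d gs $$ (z, y))"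
      using xy by (intro mult_index) auto
    also have "\<dots> = (\<Sum>z<2 ^ N. if z = x then gate_phase g x * (if x = y then \<Prod>g\<leftarrow>gs. gate_phase g x else 0) else 0)"
      using xy by (intro sum.cong) (auto simp: diag_op_def)
    finally show "(diag_op N (gate_phase g) * ?d gs) $$ (x, y)
        = ?d (gs @ [g]) $$ (x, y)"
      using xy by (simp add: diag_op_def mult.commute)
  qed (auto simp: diag_op_def)
  then show ?case
    using snoc by (simp add: gates_mat_snoc gate_mat_diagonal)
qed

lemma fold_cnot_act_rev: "fold cnot_act (rev gs) (fold cnot_act gs x) = x"
  if "\<And>g. g \<in> set gs \<Longrightarrow> fst g \<noteq> snd g"
  using that
proof (induction gs arbitrary: x)
  case (Cons g gs)
  have "cnot_act g (cnot_act g x) = x"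
    using Cons.prems[of g] by (intro bit_eqI) (cases g, auto simp: bit_cnot_act)
  then show ?case
    using Cons by simp
qed simp

text \<open>Conjugating a diagonal operator by a permutation of basis states keeps it diagonal and
  reads the phase at the permuted index. Thus undoing the fan-out after the phases also clears the
  ancillae.\<close>

lemma gates_mat_conjugated_diagonal:
  assumes gs: "\<And>g. g \<in> set gs \<Longrightarrow> fst g \<noteq> snd g \<and> snd g < N"
    and hs: "\<And>h. h \<in> set hs \<Longrightarrow> diagonal_gate h" and xy: "x < 2 ^ N" "y < 2 ^ N"
  shows "gates_mat N (map cnot_gate gs @ hs @ map cnot_gate (rev gs)) $$ (x, y)
    = (if x = y then \<Prod>h\<leftarrow>hs. gate_phase h (fold cnot_act gs x) else 0)"
proof -
  let ?y = "fold cnot_act gs y" and ?d = "\<lambda>x. \<Prod>h\<leftarrow>hs. gate_phase h x"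
  have y: "?y < 2 ^ N"
    using gs xy by (intro fold_cnot_act_less) auto
  have inner: "gates_mat N (map cnot_gate gs @ hs) $$ (z, y) = (if z = ?y then ?d ?y else 0)" if z: "z < 2 ^ N" for z
  proof -
    have "gates_mat N (map cnot_gate gs @ hs) $$ (z, y)
        = (\<Sum>u<2 ^ N. gates_mat N hs $$ (z, u) * gates_mat N (map cnot_gate gs) $$ (u, y))"
      unfolding gates_mat_append using z xy by (intro mult_index) auto
    also have "\<dots> = (\<Sum>u<2 ^ N. if u = ?y then (if z = ?y then ?d ?y else 0) else 0)"
      using gs hs z xy by (intro sum.cong) (auto simp: gates_mat_cnots gates_mat_diagonal diag_op_def)
    finally show ?thesis
      using y by simp
  qed
  have "gates_mat N (map cnot_gate gs @ hs @ map cnot_gate (rev gs)) $$ (x, y)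
      = (\<Sum>z<2 ^ N. gates_mat N (map cnot_gate (rev gs)) $$ (x, z) * gates_mat N (map cnot_gate gs @ hs) $$ (z, y))"
    using gates_mat_append[of N "map cnot_gate gs @ hs" "map cnot_gate (rev gs)"] xy
    by (simp del: gates_mat_append) (intro mult_index; simp)
  also have "\<dots> = (\<Sum>z<2 ^ N. if z = ?y then of_bool (x = fold cnot_act (rev gs) ?y) * ?d ?y else 0)"
    using gs xy inner by (intro sum.cong refl, subst gates_mat_cnots) auto
  also have "\<dots> = of_bool (x = y) * ?d ?y"
    using y fold_cnot_act_rev[of gs y] gs by simp
  finally show ?thesis
    by simp
qed

text \<open>Copy \<open>i\<close> of the target register starts at qubit \<open>n + i * m\<close>, copy 0 being the register itself;
  layer \<open>s\<close> doubles the number \<open>2 ^ s\<close> of copies.\<close>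

definition fan_layer :: "nat \<Rightarrow> nat \<Rightarrow> nat \<Rightarrow> (nat \<times> nat) list" where
  "fan_layer n m s = map (\<lambda>k. (n + k, n + k + 2 ^ s * m)) [0..<min (2 ^ s * m) (n * m - 2 ^ s * m)]"

text \<open>The natural subtraction in \<open>fan_layer\<close>, mirrored by \<open>min\<close>
  here, cuts the last doubling at \<open>n\<close> copies; later layers are empty.\<close>

lemma bit_fan_layer:
  "bit (fold cnot_act (fan_layer n m s) y) q \<longleftrightarrow>
    (if n + 2 ^ s * m \<le> q \<and> q < n + min (2 ^ Suc s * m) (n * m) then bit y q \<noteq> bit y (q - 2 ^ s * m) else bit y q)"
proof -
  let ?w = "2 ^ s * m" and ?l = "min (2 ^ s * m) (n * m - 2 ^ s * m)"
  let ?bs = "map (\<lambda>k. n + k + ?w) [0..<?l]"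
  have L: "fan_layer n m s = map (\<lambda>i. (n + i, ?bs ! i)) [0..<length ?bs]"
    unfolding fan_layer_def by (intro nth_equalityI) auto
  have double: "2 ^ Suc s * m = ?w + ?w"
    by simp
  show ?thesis
  proof (cases "n + ?w \<le> q \<and> q < n + min (?w + ?w) (n * m)")
    case True
    then have j: "q - n - ?w < ?l" "q = n + (q - n - ?w) + ?w"
      by auto
    have "run_cnots (fan_layer n m s) init (?bs ! (q - n - ?w))
        = init (?bs ! (q - n - ?w)) \<triangle> init (n + (q - n - ?w))"
      unfolding L by (rule run_parallel_cnots) (use j in \<open>auto simp: distinct_map inj_on_def\<close>)
    moreover have "?bs ! (q - n - ?w) = q"
      using j by simp
    moreover have "n + (q - n - ?w) = q - ?w"
      using True by simp
    ultimately have "run_cnots (fan_layer n m s) init q = {q} \<triangle> {q - ?w}"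
      by simp
    then show ?thesis
      unfolding double bit_run_cnots(1) using True by (simp add: parity_symdiff)
  next
    case False
    have range: "n + w \<le> n + k + w \<and> n + k + w < n + min (w + w) N" if "k < min w (N - w)" for k w N :: nat
      using that by auto
    have "q \<notin> snd ` set (fan_layer n m s)"
    proof
      assume "q \<in> snd ` set (fan_layer n m s)"
      then obtain k where "k < ?l" "q = n + k + ?w"
        unfolding fan_layer_def by auto
      then show False
        using False range by blast
    qed
    then have "run_cnots (fan_layer n m s) init q = {q}"
      by (rule run_cnots_outside)
    then show ?thesis
      unfolding double bit_run_cnots(1) using False by auto
  qed
qed

text \<open>Every layer shifts by a multiple of \<open>m\<close>, so the position within a copy, a
  residue modulo \<open>m\<close>, is preserved.\<close>

lemma bit_fan_layers:
  assumes x: "x < 2 ^ (n + m)" and n: "1 \<le> n"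
  shows "bit (fold cnot_act (concat (map (fan_layer n m) [0..<s])) x) q \<longleftrightarrow>
    (if n \<le> q then q < n + min (2 ^ s * m) (n * m) \<and> bit x (n + (q - n) mod m) else bit x q)"
proof (induction s arbitrary: q)
  case 0
  have "min m (n * m) = m"
    using n by simp
  moreover have "q < n + m" if "bit x q"
    using x that unfolding nat_less_power_iff_bit by (meson not_le)
  ultimately show ?case
    by auto
next
  case (Suc s)
  let ?w = "2 ^ s * m"
  have step: "bit (fold cnot_act (concat (map (fan_layer n m) [0..<Suc s])) x) q
      \<longleftrightarrow> bit (fold cnot_act (fan_layer n m s) (fold cnot_act (concat (map (fan_layer n m) [0..<s])) x)) q"
    by simp
  show ?case
  proof (cases "n + ?w \<le> q \<and> q < n + min (2 ^ Suc s * m) (n * m)")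
    case True
    then have "(q - ?w - n) mod m = (q - n) mod m"
    proof -
      have "q - n = (q - ?w - n) + m * 2 ^ s"
        using True by simp
      then show ?thesis
        by (metis mod_mult_self2)
    qed
    then show ?thesis
      unfolding step bit_fan_layer Suc using True by auto
  next
    case False
    have "q < n + min (2 ^ Suc s * m) (n * m) \<longleftrightarrow> q < n + min ?w (n * m)" if "n \<le> q"
      using False that by auto
    then show ?thesis
      unfolding step bit_fan_layer Suc using False by auto
  qed
qed

section \<open>Controlled stages\<close>

definition fan :: "nat \<Rightarrow> nat \<Rightarrow> nat \<Rightarrow> (nat \<times> nat) list list" where
  "fan n m r = map (fan_layer n m) [0..<r]"

lemma fan_mem:
  assumes "g \<in> set (concat (fan n m r))"
  shows "n \<le> fst g" "fst g < snd g" "snd g < n + n * m"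
  using assms by (cases "m = 0"; auto simp: fan_def fan_layer_def)+

abbreviation disjoint_gates :: "gate list \<Rightarrow> bool" where
  "disjoint_gates \<equiv> sorted_wrt (\<lambda>g h. qubits g \<inter> qubits h = {})"

lemma layered_iff:
  "layered N c \<longleftrightarrow> (\<forall>L\<in>set c. (\<forall>g\<in>set L. qubits g \<subseteq> {..<N}) \<and> disjoint_gates L)"
proof -
  have "disjoint_family_on (\<lambda>i. qubits (L ! i)) {..<length L} \<longleftrightarrow> disjoint_gates L" for L
  proof
    assume "disjoint_family_on (\<lambda>i. qubits (L ! i)) {..<length L}"
    then show "disjoint_gates L"
      unfolding disjoint_family_on_def sorted_wrt_iff_nth_less by auto
  next
    assume L: "disjoint_gates L"
    show "disjoint_family_on (\<lambda>i. qubits (L ! i)) {..<length L}"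
      unfolding disjoint_family_on_def
    proof (intro ballI impI)
      fix i j assume "i \<in> {..<length L}" "j \<in> {..<length L}" "i \<noteq> j"
      then show "qubits (L ! i) \<inter> qubits (L ! j) = {}"
        using L[unfolded sorted_wrt_iff_nth_less, rule_format, of i j]
          L[unfolded sorted_wrt_iff_nth_less, rule_format, of j i]
        by (cases "i < j") (auto simp: Int_commute)
    qed
  qed
  then show ?thesis
    unfolding layered_def by simp
qed

lemma disjoint_gates_rev: "disjoint_gates (rev L) \<longleftrightarrow> disjoint_gates L"
  unfolding sorted_wrt_rev by (simp add: Int_commute)

lemma qubits_cnot [simp]: "qubits (cnot c t) = {c, t}"
  by (auto simp: qubits_def cnot_def)

lemma disjoint_gates_cnots:
  "disjoint_gates (map cnot_gate L) \<longleftrightarrow> disjoint_cnots L"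
  unfolding sorted_wrt_map qubits_cnot ..

lemma fan_layer_disjoint: "disjoint_gates (map cnot_gate (fan_layer n m s))"
  unfolding disjoint_gates_cnots fan_layer_def sorted_wrt_map sorted_wrt_iff_nth_less by auto

definition stage_controls :: "nat \<Rightarrow> (nat \<Rightarrow> complex mat) \<Rightarrow> (nat set \<times> complex mat) list" where
  "stage_controls n V = map (\<lambda>q. ({q}, V q)) [0..<n] @ [({}, V n)]"

abbreviation C_gates :: "nat \<Rightarrow> nat \<Rightarrow> (nat set \<times> complex mat) list \<Rightarrow> gate list" where
  "C_gates n m \<equiv> map (\<lambda>(Q, V). C_gate n m Q V)"

definition stage_op :: "nat \<Rightarrow> nat \<Rightarrow> (nat \<Rightarrow> complex mat) \<Rightarrow> complex mat" where
  "stage_op n m V = gates_mat (n + m) (C_gates n m (stage_controls n V))"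

lemma stage_op_CU_operator:
  assumes "\<And>q. V q \<in> \<U>"
  shows "CU_operator n m \<U> (stage_op n m V)"
  unfolding CU_operator_def
proof (intro exI[of _ "stage_controls n V"] conjI)
  show "distinct (map fst (stage_controls n V))"
    unfolding stage_controls_def by (auto simp: comp_def distinct_map inj_on_def)
qed (use assms in \<open>auto simp: stage_controls_def stage_op_def\<close>)

text \<open>The branch with inactive controls is the identity, which conjugation fixes; so the
  change of basis itself can be applied without controls.\<close>

lemma block_op_conj:
  assumes A: "unitary (2 ^ m) A" and V: "V \<in> carrier_mat (2 ^ m) (2 ^ m)" and Q: "Q \<subseteq> {..<n}"
  shows "gate_mat (n + m) (C_gate n m Q (A * V * mat_adjoint A)) = diag_block n m (\<lambda>c. A) *
    gate_mat (n + m) (C_gate n m Q V) * diag_block n m (\<lambda>c. mat_adjoint A)"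
proof -
  note A' = unitaryD[OF A]
  let ?W = "\<lambda>c :: nat. if \<forall>q\<in>Q. bit c q then V else 1\<^sub>m (2 ^ m)"
  have W: "?W c \<in> carrier_mat (2 ^ m) (2 ^ m)" for c
    using V by simp
  have AW: "A * ?W c \<in> carrier_mat (2 ^ m) (2 ^ m)" for c
    using A'(1) W by (rule mult_carrier_mat)
  have "diag_block n m (\<lambda>c. A) * diag_block n m ?W * diag_block n m (\<lambda>c. mat_adjoint A)
      = diag_block n m (\<lambda>c. A * ?W c * mat_adjoint A)"
    using A'(1) W AW by (simp add: block_op_mult)
  also have "\<dots> = diag_block n m (\<lambda>c. if \<forall>q\<in>Q. bit c q then A * V * mat_adjoint A else 1\<^sub>m (2 ^ m))"
    using A' by (intro block_op_cong) auto
  finally show ?thesis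
    unfolding C_gate_block_op[OF Q] ..
qed

text \<open>Between consecutive gates the adjoint of \<open>A\<close> cancels against
  \<open>A\<close>, so one change of basis at either end serves the whole stage.\<close>

lemma gates_mat_block_conj:
  assumes A: "unitary (2 ^ m) A"
    and cs: "\<And>Q V. (Q, V) \<in> set cs \<Longrightarrow> Q \<subseteq> {..<n} \<and> V \<in> carrier_mat (2 ^ m) (2 ^ m)"
  shows "gates_mat (n + m) (map (\<lambda>(Q, V). C_gate n m Q (A * V * mat_adjoint A)) cs) = diag_block n m (\<lambda>c. A) *
    gates_mat (n + m) (C_gates n m cs) * diag_block n m (\<lambda>c. mat_adjoint A)"
  using cs
proof (induction cs rule: rev_induct)
  case Nil
  have "diag_block n m (\<lambda>c. A) * diag_block n m (\<lambda>c. mat_adjoint A) = 1\<^sub>m (2 ^ (n + m))"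
    using unitaryD[OF A] block_op_one[of n m] by (simp add: block_op_mult)
  then show ?case
    by (simp add: right_mult_one_mat[OF block_op_carrier])
next
  case (snoc c cs)
  obtain Q V where c: "c = (Q, V)"
    by fastforce
  have QV: "Q \<subseteq> {..<n}" "V \<in> carrier_mat (2 ^ m) (2 ^ m)"
    using snoc.prems[of Q V] c by auto
  let ?d = "2 ^ (n + m)"
  let ?A = "diag_block n m (\<lambda>c. A)" and ?B = "diag_block n m (\<lambda>c. mat_adjoint A)"
  let ?G = "gate_mat (n + m) (C_gate n m Q V)" and ?M = "gates_mat (n + m) (C_gates n m cs)"
  note [simp] = assoc_mult_mat[of _ ?d ?d _ ?d _ ?d] and [simp] = mult_carrier_mat[of _ ?d ?d _ ?d]
  have BA: "?B * ?A = 1\<^sub>m ?d"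
    using unitaryD[OF A] block_op_one[of n m] by (simp add: block_op_mult)
  have "?A * ?G * ?B * (?A * ?M * ?B) = ?A * (?G * (?B * ?A * (?M * ?B)))"
    by simp
  also have "\<dots> = ?A * (?G * ?M) * ?B"
    unfolding BA by (simp add: left_mult_one_mat[of _ ?d ?d])
  finally have eq: "?A * ?G * ?B * (?A * ?M * ?B) = ?A * (?G * ?M) * ?B" .
  have "gates_mat (n + m) (map (\<lambda>(Q, V). C_gate n m Q (A * V * mat_adjoint A)) cs) = ?A * ?M * ?B"
    using snoc by auto
  then show ?case
    by (simp only: c map_append list.map prod.case gates_mat_snoc block_op_conj[OF A QV(2,1)] eq)
qed

lemma C_gate_all: "gate_mat (n + m) (Gate {} [n..<n + m] A) = diag_block n m (\<lambda>c. A)"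
  using C_gate_block_op[of "{}" n m A] by (simp add: C_gate_def)

text \<open>The fanned-out copies of the target basis state let all controlled phases of a stage act in
  a single layer.\<close>

lemma implements_fanned_phases:
  assumes n: "1 \<le> n" "n \<le> 2 ^ r"
    and D: "\<And>q. diagonal_mat (D q)" "\<And>q. D q \<in> carrier_mat (2 ^ m) (2 ^ m)"
  defines "F \<equiv> concat (fan n m r)"
  shows "implements_gates (n + m) ((n - 1) * m)
    (map cnot_gate F @ (map (\<lambda>q. Gate {q} [n + q * m..<n + q * m + m] (D q)) [0..<n] @ [Gate {} [n..<n + m] (D n)])
      @ map cnot_gate (rev F))
    (gates_mat (n + m) (C_gates n m (stage_controls n D)))"
proof -
  let ?N = "n + m + (n - 1) * m"
  let ?hs = "map (\<lambda>q. Gate {q} [n + q * m..<n + q * m + m] (D q)) [0..<n] @ [Gate {} [n..<n + m] (D n)]"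
  let ?cs = "C_gates n m (stage_controls n D)"
  \<comment> \<open>Copy 0 is the target register itself, so \<open>n\<close> copies take
    \<open>n - 1\<close> blocks of ancillae.\<close>
  have N: "?N = n + n * m"
    using n(1) by (cases n) auto
  have bitF: "bit (fold cnot_act F x) q \<longleftrightarrow>
      (if n \<le> q then q < n + n * m \<and> bit x (n + (q - n) mod m) else bit x q)" if "x < 2 ^ (n + m)" for x q
  proof -
    have "min (2 ^ r * m) (n * m) = n * m"
      by (intro min_absorb2 mult_le_mono1 n(2))
    then show ?thesis
      unfolding F_def fan_def bit_fan_layers[OF that n(1)] by simp
  qed
  have phase: "(\<Prod>h\<leftarrow>?hs. gate_phase h (fold cnot_act F x)) = (\<Prod>h\<leftarrow>?cs. gate_phase h x)" if x: "x < 2 ^ (n + m)" for x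
  proof -
    have sub: "sub_index [n + q * m..<n + q * m + m] (fold cnot_act F x) = sub_index [n..<n + m] x" if "q < n" for q
    proof (rule bit_eqI)
      fix k
      have "q * m + k < n * m" if "k < m"
      proof -
        have "q * m + k < Suc q * m"
          using that by simp
        also have "\<dots> \<le> n * m"
          using \<open>q < n\<close> by (intro mult_le_mono1) simp
        finally show ?thesis .
      qed
      then show "bit (sub_index [n + q * m..<n + q * m + m] (fold cnot_act F x)) k = bit (sub_index [n..<n + m] x) k"
        by (auto simp: bit_sub_index bitF[OF x] add.assoc)
    qed
    have "gate_phase (Gate {q} [n + q * m..<n + q * m + m] (D q)) (fold cnot_act F x) = gate_phase (C_gate n m {q} (D q)) x"
      if "q < n" for q
      using that sub[OF that] bitF[OF x, of q] by (simp add: gate_phase_def C_gate_def)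
    moreover have "gate_phase (Gate {} [n..<n + m] (D n)) (fold cnot_act F x) = gate_phase (C_gate n m {} (D n)) x"
      using sub[of 0] n(1) by (simp add: gate_phase_def C_gate_def)
    ultimately have "map (\<lambda>h. gate_phase h (fold cnot_act F x)) ?hs = map (\<lambda>h. gate_phase h x) ?cs"
      by (simp add: stage_controls_def)
    then show ?thesis
      by simp
  qed
  have diag: "diagonal_gate h" if "h \<in> set ?hs \<union> set ?cs" for h
    using that D by (auto simp: diagonal_gate_def stage_controls_def C_gate_def)
  show ?thesis
    unfolding implements_gates_def
  proof (intro allI impI)
    fix x y :: nat assume xy: "x < 2 ^ ?N" "y < 2 ^ (n + m)"
    have y: "y < 2 ^ ?N"
      using xy(2) by (rule less_le_trans) (intro power_increasing; simp)
    have gs: "fst g \<noteq> snd g \<and> snd g < ?N" if "g \<in> set F" for g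
      using fan_mem[of g n m r] that N unfolding F_def by auto
    have "gates_mat ?N (map cnot_gate F @ ?hs @ map cnot_gate (rev F)) $$ (x, y)
        = (if x = y then \<Prod>h\<leftarrow>?hs. gate_phase h (fold cnot_act F x) else 0)"
      by (rule gates_mat_conjugated_diagonal) (use gs diag xy y in auto)
    also have "\<dots> = (if x = y then \<Prod>h\<leftarrow>?cs. gate_phase h x else 0)"
      using phase xy(2) by auto
    also have "\<dots> = (if x < 2 ^ (n + m) then gates_mat (n + m) ?cs $$ (x, y) else 0)"
      using diag xy by (subst gates_mat_diagonal) (auto simp: diag_op_def)
    finally show "gates_mat ?N (map cnot_gate F @ ?hs @ map cnot_gate (rev F)) $$ (x, y)
        = (if x < 2 ^ (n + m) then gates_mat (n + m) ?cs $$ (x, y) else 0)" .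
  qed
qed

text \<open>The depth consists of \<open>r\<close> layers of fan-out and \<open>r\<close> of its
  inverse, \<open>A\<close> and its adjoint, the layer of controlled phases, and a separate layer
  for the uncontrolled phase, since copy 0 is already occupied by the phase controlled on qubit
  0.\<close>

lemma ex_stage_circuit:
  assumes A: "diagonalizes m A \<U>" and V: "\<And>q. V q \<in> \<U>" and \<U>: "\<And>W. W \<in> \<U> \<Longrightarrow> W \<in> carrier_mat (2 ^ m) (2 ^ m)"
    and n: "1 \<le> n" "n \<le> 2 ^ r" and m: "1 \<le> m"
  defines "a \<equiv> (n - 1) * m"
  shows "\<exists>T. layered (n + m + a) T \<and> (\<forall>g\<in>set (concat T). unit_gate n m a \<U> A g) \<and>
    implements (n + m) a T (stage_op n m V) \<and> length T = 2 * r + 4"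
proof -
  let ?N = "n + m + a"
  have N: "?N = n + n * m"
    unfolding a_def using n(1) by (cases n) auto
  have Au: "unitary (2 ^ m) A" and diag: "\<And>W. W \<in> \<U> \<Longrightarrow> diagonal_mat (A * W * mat_adjoint A)"
    using A unfolding diagonalizes_def by auto
  note A' = unitaryD[OF Au]
  let ?D = "\<lambda>q. A * V q * mat_adjoint A"
  have D: "?D q \<in> carrier_mat (2 ^ m) (2 ^ m)" for q
    using A'(1) \<U>[OF V[of q]] by (meson adjoint_carrier mult_carrier_mat)
  let ?F = "map (map cnot_gate) (fan n m r)"
  let ?L = "map (\<lambda>q. Gate {q} [n + q * m..<n + q * m + m] (?D q)) [0..<n]"
  let ?T = "[[Gate {} [n..<n + m] A]] @ (?F @ [?L, [Gate {} [n..<n + m] (?D n)]] @ rev (map rev ?F))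
    @ [[Gate {} [n..<n + m] (mat_adjoint A)]]"
  have block: "{n + q * m..<n + q * m + m} \<subseteq> {n..<?N}" if "q < n" for q
  proof -
    have "Suc q * m \<le> n * m"
      using that by (intro mult_le_mono1) simp
    then show ?thesis
      unfolding N by auto
  qed
  have target: "{n..<n + m} \<subseteq> {n..<?N}"
    by auto
  have "layered ?N ?T"
  proof -
    have F: "(\<forall>g\<in>set L. qubits g \<subseteq> {..<?N}) \<and> disjoint_gates L" if L: "L \<in> set ?F" for L
    proof -
      obtain s where s: "s < r" "L = map cnot_gate (fan_layer n m s)"
        using L by (auto simp: fan_def)
      have "qubits g \<subseteq> {..<?N}" if g: "g \<in> set L" for g
      proof -
        obtain h where h: "h \<in> set (fan_layer n m s)" "g = cnot_gate h"
          using g s by auto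
        then have "h \<in> set (concat (fan n m r))"
          using s by (auto simp: fan_def)
        from fan_mem[OF this] show ?thesis
          using h N by auto
      qed
      then show ?thesis
        using s fan_layer_disjoint by blast
    qed
    then have "(\<forall>g\<in>set L. qubits g \<subseteq> {..<?N}) \<and> disjoint_gates L" if "L \<in> set (rev (map rev ?F))" for L
      using that disjoint_gates_rev by fastforce
    moreover have "(\<forall>g\<in>set ?L. qubits g \<subseteq> {..<?N}) \<and> disjoint_gates ?L"
    proof
      show "\<forall>g\<in>set ?L. qubits g \<subseteq> {..<?N}"
        using block by (fastforce simp: qubits_def)
      have "{n + p * m..<n + p * m + m} \<inter> {n + q * m..<n + q * m + m} = {}" if "p < q" for p q
      proof -
        have "Suc p * m \<le> q * m"
          using that by (intro mult_le_mono1) simp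
        then show ?thesis
          by auto
      qed
      then show "disjoint_gates ?L"
        unfolding sorted_wrt_map by (auto simp: sorted_wrt_iff_nth_less qubits_def)
    qed
    moreover have "qubits (Gate {} [n..<n + m] X) \<subseteq> {..<?N}" for X
      using target by (auto simp: qubits_def)
    ultimately show ?thesis
      unfolding layered_iff using F
      by (simp only: set_append list.set Un_iff insert_iff empty_iff) fastforce
  qed
  moreover have "\<forall>g\<in>set (concat ?T). unit_gate n m a \<U> A g"
  proof
    fix g assume "g \<in> set (concat ?T)"
    then consider "g = Gate {} [n..<n + m] A" | "g = Gate {} [n..<n + m] (mat_adjoint A)" |
      "g = Gate {} [n..<n + m] (?D n)" | "\<exists>h\<in>set (concat (fan n m r)). g = cnot_gate h" |
      "\<exists>q<n. g = Gate {q} [n + q * m..<n + q * m + m] (?D q)"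
      by auto
    then show "unit_gate n m a \<U> A g"
    proof cases
      case 4
      then obtain h where h: "h \<in> set (concat (fan n m r))" "g = cnot_gate h"
        by blast
      have "fst h \<in> {..<?N}" "snd h \<in> {..<?N}" "fst h \<noteq> snd h"
        using fan_mem[OF h(1)] N by auto
      then show ?thesis
        unfolding unit_gate_def cnot_on_def h(2) by blast
    next
      case 5
      then obtain q where q: "q < n" "g = Gate {q} [n + q * m..<n + q * m + m] (?D q)"
        by blast
      have "q \<in> {..<?N} - set [n + q * m..<n + q * m + m]"
        using q(1) by auto
      then show ?thesis
        unfolding unit_gate_def q(2) using block[OF q(1)] V by fastforce
    qed (use V target in \<open>auto simp: unit_gate_def\<close>)
  qed
  moreover have "implements (n + m) a ?T (stage_op n m V)"
  proof -
    let ?A = "diag_block n m (\<lambda>c. A)" and ?B = "diag_block n m (\<lambda>c. mat_adjoint A)"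
    let ?M = "gates_mat (n + m) (C_gates n m (stage_controls n ?D))"
    let ?F' = "concat (fan n m r)"
    let ?mid = "map cnot_gate ?F' @ (?L @ [Gate {} [n..<n + m] (?D n)]) @ map cnot_gate (rev ?F')"
    have conc: "concat ?T = [Gate {} [n..<n + m] A] @ (?mid @ [Gate {} [n..<n + m] (mat_adjoint A)])"
      by (simp add: map_concat rev_concat rev_map comp_def)
    have loc: "implements_gates (n + m) a [Gate {} [n..<n + m] X] (diag_block n m (\<lambda>c. X))" for X
    proof -
      have "{n..<n + m} \<subseteq> {..<n + m}"
        by auto
      then show ?thesis
        using implements_gates_local[of "[Gate {} [n..<n + m] X]" "n + m" a]
        by (simp add: C_gate_all qubits_def)
    qed
    have mid: "implements_gates (n + m) a ?mid ?M"
      unfolding a_def by (rule implements_fanned_phases[OF n]) (use diag V D in auto)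
    have "implements_gates (n + m) a (?mid @ [Gate {} [n..<n + m] (mat_adjoint A)]) (?B * ?M)"
      by (rule implements_gates_append[OF mid loc gates_mat_carrier block_op_carrier])
    from implements_gates_append[OF loc this block_op_carrier mult_carrier_mat[OF block_op_carrier gates_mat_carrier]]
    have "implements_gates (n + m) a (concat ?T) (?B * ?M * ?A)"
      unfolding conc .
    moreover have "?B * ?M * ?A = stage_op n m V"
    proof -
      let ?d = "2 ^ (n + m)"
      note [simp] = assoc_mult_mat[of _ ?d ?d _ ?d _ ?d] and [simp] = mult_carrier_mat[of _ ?d ?d _ ?d]
      have "C_gates n m (stage_controls n ?D)
          = map (\<lambda>(Q, V). C_gate n m Q (A * V * mat_adjoint A)) (stage_controls n V)"
        by (simp add: stage_controls_def)
      then have M: "?M = ?A * stage_op n m V * ?B"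
        unfolding stage_op_def using \<U> V
        by (simp only:) (rule gates_mat_block_conj[OF Au]; auto simp: stage_controls_def)
      have BA: "?B * ?A = 1\<^sub>m ?d"
        using A' block_op_one[of n m] by (simp add: block_op_mult)
      have S: "stage_op n m V \<in> carrier_mat ?d ?d"
        by (simp add: stage_op_def)
      have "?B * ?M * ?A = ?B * ?A * (stage_op n m V * (?B * ?A))"
        unfolding M using S by simp
      then show ?thesis
        unfolding BA using S by simp
    qed
    ultimately show ?thesis
      unfolding implements_iff by simp
  qed
  moreover have "length ?T = 2 * r + 4"
    by (simp add: fan_def)
  ultimately show ?thesis
    by blast
qed

section \<open>Assembling the circuit over a target family\<close>

locale unitary_family =
  fixes m :: nat and \<U> :: "complex mat set"
  assumes family: "target_family m \<U>"
begin

abbreviation "G \<equiv> family_group m \<U>"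

sublocale comm_group G
  using family by (simp add: target_family_def)

lemma mult_unitary_group [simp]: "V \<otimes>\<^bsub>unitary_group m\<^esub> W = V * W"
  by (simp add: unitary_group_def)

lemma one_unitary_group [simp]: "\<one>\<^bsub>unitary_group m\<^esub> = 1\<^sub>m (2 ^ m)"
  by (simp add: unitary_group_def)

lemma one_mem [simp]: "1\<^sub>m (2 ^ m) \<in> \<U>"
  using one_closed by simp

lemma unitary_mem: "V \<in> \<U> \<Longrightarrow> unitary (2 ^ m) V"
  using family subgroup.subset unfolding target_family_def unitary_group_def by fastforce

lemma mem_carrier: "V \<in> \<U> \<Longrightarrow> V \<in> carrier_mat (2 ^ m) (2 ^ m)"
  using unitary_mem unitaryD(1) by blast

lemma commute: "V \<in> \<U> \<Longrightarrow> W \<in> \<U> \<Longrightarrow> V * W = W * V"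
  using m_comm[of V W] by simp

lemma ex_diagonalizing: "\<exists>A. diagonalizes m A \<U>"
proof -
  obtain P where "unitary (2 ^ m) P" "\<And>V. V \<in> \<U> \<Longrightarrow> diagonal_mat (mat_adjoint P * V * P)"
    using simultaneous_diagonalization[of \<U> "2 ^ m"] unitary_mem commute by blast
  then show ?thesis
    unfolding diagonalizes_def by (intro exI[of _ "mat_adjoint P"]) (simp add: unitary_adjoint)
qed

text \<open>Turns the ordered product of gate matrices into a product in the commutative group, the
  form in which \<open>phase_schedule\<close> describes a stage.\<close>

lemma stage_op_block:
  assumes V: "\<And>q. V q \<in> \<U>"
  shows "stage_op n m V = diag_block n m
    (\<lambda>c. finprod G (\<lambda>q. if q = n \<or> bit c q then V q else \<one>\<^bsub>G\<^esub>) {..n})"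
proof -
  let ?f = "\<lambda>(c :: nat) q. if q = n \<or> bit c q then V q else \<one>\<^bsub>G\<^esub>"
  let ?g = "\<lambda>(Q, V). C_gate n m Q V"
  have f: "?f c \<in> X \<rightarrow> carrier G" for c X
    using V one_closed by auto
  have fin: "finprod G (?f c) X \<in> carrier_mat (2 ^ m) (2 ^ m)" for c X
    using finprod_closed[OF f[where X = X]] mem_carrier by simp
  have "j \<le> n \<Longrightarrow> gates_mat (n + m) (map ?g (map (\<lambda>q. ({q}, V q)) [0..<j]))
      = diag_block n m (\<lambda>c. finprod G (?f c) {..<j})" for j
  proof (induction j)
    case 0
    show ?case
      by (simp add: block_op_one)
  next
    case (Suc j)
    have "gates_mat (n + m) (map ?g (map (\<lambda>q. ({q}, V q)) [0..<Suc j]))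
        = diag_block n m (\<lambda>c. if \<forall>q\<in>{j}. bit c q then V j else 1\<^sub>m (2 ^ m)) *
          diag_block n m (\<lambda>c. finprod G (?f c) {..<j})"
      using Suc C_gate_block_op[of "{j}" n m "V j"] by (simp add: gates_mat_snoc)
    also have "\<dots> = diag_block n m (\<lambda>c. (if \<forall>q\<in>{j}. bit c q then V j else 1\<^sub>m (2 ^ m)) * finprod G (?f c) {..<j})"
      using fin mem_carrier[OF V] by (intro block_op_mult) auto
    also have "\<dots> = diag_block n m (\<lambda>c. finprod G (?f c) {..<Suc j})"
    proof (intro block_op_cong refl)
      fix c :: nat
      have "finprod G (?f c) {..<Suc j} = ?f c j \<otimes>\<^bsub>G\<^esub> finprod G (?f c) {..<j}"
        unfolding lessThan_Suc by (intro finprod_insert) (auto simp: V)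
      then show "(if \<forall>q\<in>{j}. bit c q then V j else 1\<^sub>m (2 ^ m)) * finprod G (?f c) {..<j}
          = finprod G (?f c) {..<Suc j}"
        using Suc.prems by simp
    qed
    finally show ?case .
  qed
  then have n: "gates_mat (n + m) (map ?g (map (\<lambda>q. ({q}, V q)) [0..<n]))
      = diag_block n m (\<lambda>c. finprod G (?f c) {..<n})"
    by blast
  have "stage_op n m V = gate_mat (n + m) (C_gate n m {} (V n)) *
      gates_mat (n + m) (map ?g (map (\<lambda>q. ({q}, V q)) [0..<n]))"
    by (simp add: stage_op_def stage_controls_def gates_mat_snoc)
  also have "\<dots> = diag_block n m (\<lambda>c. V n) * diag_block n m (\<lambda>c. finprod G (?f c) {..<n})"
    using C_gate_block_op[of "{}" n m "V n"] n by simp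
  also have "\<dots> = diag_block n m (\<lambda>c. V n * finprod G (?f c) {..<n})"
    using fin mem_carrier[OF V] by (intro block_op_mult) auto
  also have "\<dots> = diag_block n m (\<lambda>c. finprod G (?f c) {..n})"
  proof (intro block_op_cong refl)
    fix c :: nat
    have "finprod G (?f c) {..n} = ?f c n \<otimes>\<^bsub>G\<^esub> finprod G (?f c) {..<n}"
      unfolding lessThan_Suc_atMost[symmetric] lessThan_Suc by (intro finprod_insert) (auto simp: V)
    then show "V n * finprod G (?f c) {..<n} = finprod G (?f c) {..n}"
      by simp
  qed
  finally show ?thesis .
qed

text \<open>\<open>Suc i\<close> because stage \<open>i\<close> follows layer
  \<open>i\<close>.\<close>

definition parity_schedule :: "(nat \<times> nat) list list \<Rightarrow> nat \<Rightarrow> nat \<Rightarrow> nat set" where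
  "parity_schedule Ls i q = run_cnots (concat (take (Suc i) Ls)) init q"

text \<open>The factors are absorbed one at a time: each is realizable alone, and realizable phases
  multiply on the same schedule, so the number of factors does not affect the depth.\<close>

lemma rUCG_realizable:
  assumes "rUCG n k m \<U> M" and Ls: "Ls \<noteq> []"
    and visits: "(small_subsets n k) \<subseteq> visited {..<n} Ls"
  shows "\<exists>v. (\<forall>i q. v i q \<in> \<U>) \<and>
    M = diag_block n m (\<lambda>c. phase_schedule.phase G (parity_schedule Ls) n (length Ls) v {q. bit c q})"
proof -
  interpret S: phase_schedule G "parity_schedule Ls" n "length Ls"
    by unfold_locales
  obtain D :: "complex mat monoid" and U and terms :: "(nat set \<times> complex mat) list"
    where U: "U \<in> hom D G"
      and terms: "\<forall>(Q, \<mu>)\<in>set terms. Q \<subseteq> {..<n} \<and> card Q \<le> k \<and> \<mu> \<in> carrier D"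
      and M: "M = gates_mat (n + m) (map (\<lambda>(Q, \<mu>). C_gate n m Q (U \<mu>)) terms)"
    using assms(1) unfolding rUCG_def rUCG_over_def by blast
  have visit: "\<exists>i<length Ls. \<exists>q<n. parity_schedule Ls i q = T" if "T \<subseteq> {..<n}" "T \<noteq> {}" "card T \<le> k" for T
  proof -
    have "T \<in> visited {..<n} Ls"
      using visits that by blast
    then obtain i q where "0 < i" "i \<le> length Ls" "q < n" "T = run_cnots (concat (take i Ls)) init q"
      unfolding visited_def by auto
    then show ?thesis
      by (intro exI[of _ "i - 1"] conjI exI[of _ q]) (auto simp: parity_schedule_def)
  qed
  have "\<exists>\<chi>. S.realizable \<chi> \<and> gates_mat (n + m) (map (\<lambda>(Q, \<mu>). C_gate n m Q (U \<mu>)) terms)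
      = diag_block n m (\<lambda>c. \<chi> {q. bit c q})"
    using terms
  proof (induction terms rule: rev_induct)
    case Nil
    then show ?case
      using S.realizable_one block_op_one[of n m] by (intro exI[of _ "\<lambda>x. \<one>\<^bsub>G\<^esub>"]) simp
  next
    case (snoc t terms)
    obtain Q \<mu> where t: "t = (Q, \<mu>)"
      by fastforce
    have Q: "Q \<subseteq> {..<n}" "card Q \<le> k" and V: "U \<mu> \<in> \<U>"
      using snoc.prems t hom_in_carrier[OF U] by auto
    obtain \<chi> where \<chi>: "S.realizable \<chi>" "gates_mat (n + m) (map (\<lambda>(Q, \<mu>). C_gate n m Q (U \<mu>)) terms)
        = diag_block n m (\<lambda>c. \<chi> {q. bit c q})"
      using snoc by auto
    let ?\<psi> = "\<lambda>x. if Q \<subseteq> x then U \<mu> else \<one>\<^bsub>G\<^esub>"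
    have \<psi>: "S.realizable ?\<psi>"
      using family Ls visit Q V
      by (intro S.realizable_controlled[of k]) (auto simp: target_family_def)
    have \<chi>c: "\<chi> x \<in> carrier_mat (2 ^ m) (2 ^ m)" for x
    proof -
      obtain v where v: "\<And>i q. v i q \<in> carrier G" "S.phase v = \<chi>"
        using \<chi>(1) unfolding S.realizable_def by blast
      have "S.phase v x \<in> carrier G"
        unfolding S.phase_def using v(1) by (intro finprod_closed) (auto intro: S.stage_phase_closed[simplified])
      then show ?thesis
        using v(2) mem_carrier by simp
    qed
    have "gates_mat (n + m) (map (\<lambda>(Q, \<mu>). C_gate n m Q (U \<mu>)) (terms @ [t]))
        = diag_block n m (\<lambda>c. if \<forall>q\<in>Q. bit c q then U \<mu> else 1\<^sub>m (2 ^ m)) *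
          diag_block n m (\<lambda>c. \<chi> {q. bit c q})"
      using \<chi>(2) C_gate_block_op[OF Q(1), of m "U \<mu>"] by (simp add: t gates_mat_snoc)
    also have "\<dots> = diag_block n m (\<lambda>c. (if \<forall>q\<in>Q. bit c q then U \<mu> else 1\<^sub>m (2 ^ m)) * \<chi> {q. bit c q})"
      using \<chi>c mem_carrier[OF V] by (intro block_op_mult) auto
    also have "\<dots> = diag_block n m (\<lambda>c. ?\<psi> {q. bit c q} \<otimes>\<^bsub>G\<^esub> \<chi> {q. bit c q})"
      by (intro block_op_cong) (auto simp: subset_iff)
    finally show ?case
      using S.realizable_mult[OF \<psi> \<chi>(1)] by blast
  qed
  then show ?thesis
    unfolding M S.realizable_def by auto
qed

text \<open>The invariant after \<open>j\<close> blocks: the control state has been moved by the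
  first \<open>j\<close> layers, while the accumulated phase is expressed in the original control
  state \<open>c\<close>.\<close>

lemma schedule_implements:
  assumes layers: "cnot_layers {..<n} Ls"
    and v: "\<And>i q. v i q \<in> \<U>"
    and T: "\<And>i. i < length Ls \<Longrightarrow> implements (n + m) a (T i) (stage_op n m (v i))"
    and j: "j \<le> length Ls"
  shows "implements_gates (n + m) a
    (concat (flat_circuit (map (\<lambda>i. ([map cnot_gate (Ls ! i)], T i)) [0..<j])))
    (block_op n m (fold cnot_act (concat (take j Ls)))
      (\<lambda>c. finprod G (\<lambda>i. phase_schedule.stage_phase G (parity_schedule Ls) n i (v i) {q. bit c q}) {..<j}))"
  using j
proof (induction j)
  interpret S: phase_schedule G "parity_schedule Ls" n "length Ls"
    by unfold_locales
  case 0
  have "implements_gates (n + m) a [] (gates_mat (n + m) [])"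
    by (rule implements_gates_local) simp
  then show ?case
    using block_op_one[of n m] by (simp add: flat_circuit_def id_def)
next
  interpret S: phase_schedule G "parity_schedule Ls" n "length Ls"
    by unfold_locales
  case (Suc j)
  let ?F = "\<lambda>j. fold cnot_act (concat (take j Ls))"
  let ?X = "\<lambda>j c. finprod G (\<lambda>i. S.stage_phase i (v i) {q. bit c q}) {..<j}"
  let ?S = "\<lambda>c :: nat. finprod G (\<lambda>q. if q = n \<or> bit c q then v j q else \<one>\<^bsub>G\<^esub>) {..n}"
  let ?L = "Ls ! j"
  let ?one = "\<lambda>c :: nat. 1\<^sub>m (2 ^ m) :: complex mat"
  have on: "fst g < n \<and> snd g < n" if "g \<in> set (concat Ls)" for g
    using layers that unfolding cnot_layers_def cnots_on_def by fastforce
  have onL: "fst g < n \<and> snd g < n" if "g \<in> set ?L" for g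
  proof (rule on)
    have "?L \<in> set Ls"
      using Suc.prems by (intro nth_mem) simp
    then show "g \<in> set (concat Ls)"
      using that by auto
  qed
  have onF: "fst g < n \<and> snd g < n" if "g \<in> set (concat (take i Ls))" for g i
    using on[of g] that set_take_subset[of i Ls] by auto
  have F_less: "?F i c < 2 ^ n" if "c < 2 ^ n" for i c
    using onF that by (intro fold_cnot_act_less) auto
  have phase: "S.stage_phase i (v i) x \<in> \<U>" for i x
    using S.stage_phase_closed[of "v i" i x] v by simp
  then have phases: "(\<lambda>i. S.stage_phase i (v i) x) \<in> Y \<rightarrow> carrier G" for x Y
    by simp
  have X: "?X i c \<in> carrier_mat (2 ^ m) (2 ^ m)" for i c
  proof -
    have "?X i c \<in> carrier G"
      by (intro finprod_closed phases)
    then show ?thesis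
      using mem_carrier by simp
  qed
  have "?S c \<in> carrier G" for c
    using v one_closed by (intro finprod_closed) auto
  then have Sc: "?S c \<in> carrier_mat (2 ^ m) (2 ^ m)" for c
    using mem_carrier by simp
  have "implements_gates (n + m) a (map cnot_gate ?L) (gates_mat (n + m) (map cnot_gate ?L))"
    using onL by (intro implements_gates_local) fastforce
  then have L: "implements_gates (n + m) a (map cnot_gate ?L) (block_op n m (fold cnot_act ?L) ?one)"
    using gates_mat_control_cnots[of ?L n m] onL by simp
  have T': "implements_gates (n + m) a (concat (T j)) (diag_block n m ?S)"
    using T[of j] Suc.prems v unfolding implements_iff by (simp add: stage_op_block)
  have flat: "concat (flat_circuit (map (\<lambda>i. ([map cnot_gate (Ls ! i)], T i)) [0..<Suc j]))
      = concat (flat_circuit (map (\<lambda>i. ([map cnot_gate (Ls ! i)], T i)) [0..<j])) @ (map cnot_gate ?L @ concat (T j))"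
    by (simp add: flat_circuit_def)
  have "diag_block n m ?S * block_op n m (fold cnot_act ?L) ?one
      = block_op n m (fold cnot_act ?L) (\<lambda>c. ?S (fold cnot_act ?L c))"
    using Sc onL by (subst block_op_mult) (auto simp: right_mult_one_mat[OF Sc] intro!: fold_cnot_act_less)
  then have LT: "implements_gates (n + m) a (map cnot_gate ?L @ concat (T j))
      (block_op n m (fold cnot_act ?L) (\<lambda>c. ?S (fold cnot_act ?L c)))"
    using implements_gates_append[OF L T'] by simp
  have "block_op n m (fold cnot_act ?L) (\<lambda>c. ?S (fold cnot_act ?L c)) * block_op n m (?F j) (?X j)
      = block_op n m (\<lambda>c. fold cnot_act ?L (?F j c)) (\<lambda>c. ?S (fold cnot_act ?L (?F j c)) * ?X j c)"
    using Sc X F_less by (intro block_op_mult) auto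
  also have "\<dots> = block_op n m (?F (Suc j)) (?X (Suc j))"
  proof (intro block_op_cong)
    fix c :: nat
    have take: "concat (take (Suc j) Ls) = concat (take j Ls) @ ?L"
      using Suc.prems by (simp add: take_Suc_conv_app_nth)
    then show eq: "fold cnot_act ?L (?F j c) = ?F (Suc j) c"
      by simp
    \<comment> \<open>The stage reads the moved bits, which are the scheduled parities of the
      original ones.\<close>
    have "?S (?F (Suc j) c) = S.stage_phase j (v j) {q. bit c q}"
      unfolding S.stage_phase_def parity_schedule_def bit_run_cnots(1) ..
    moreover have "?X (Suc j) c = S.stage_phase j (v j) {q. bit c q} \<otimes>\<^bsub>G\<^esub> ?X j c"
      unfolding lessThan_Suc using phases phase by (intro finprod_insert) auto
    ultimately show "?S (fold cnot_act ?L (?F j c)) * ?X j c = ?X (Suc j) c"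
      unfolding eq by simp
  qed
  finally have eq: "block_op n m (fold cnot_act ?L) (\<lambda>c. ?S (fold cnot_act ?L c)) * block_op n m (?F j) (?X j)
      = block_op n m (?F (Suc j)) (?X (Suc j))" .
  have IH: "implements_gates (n + m) a
      (concat (flat_circuit (map (\<lambda>i. ([map cnot_gate (Ls ! i)], T i)) [0..<j]))) (block_op n m (?F j) (?X j))"
    using Suc by simp
  show ?case
    unfolding flat eq[symmetric] by (intro implements_gates_append IH LT) simp_all
qed

lemma ex_alternating_circuit:
  assumes A: "diagonalizes m A \<U>" and m: "1 \<le> m" and n: "2 \<le> n" and k: "1 \<le> k"
    and M: "rUCG n k m \<U> M"
  shows "\<exists>a bs. alternating n m a \<U> A bs \<and> implements (n + m) a (flat_circuit bs) M \<and>
    real (D_CNOT bs) \<le> 49224 / real n * (\<Sum>i=0..k. real (n choose i)) \<and>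
    real (D_CU bs) \<le> 49224 * log 2 (real n) / real n * (\<Sum>i=0..k. real (n choose i)) \<and>
    real a \<le> 49224 * real (m * n)"
proof -
  let ?\<Sigma> = "\<Sum>i=0..k. real (n choose i)"
  obtain l where l: "loopable {..<n} (small_subsets n k) l"
    "real l \<le> 6153 / real n * ?\<Sigma>"
    using loopable_bounded_subsets[OF n k] by blast
  from l(1) obtain Ls where Ls: "loop {..<n} Ls"
    and visits: "(small_subsets n k) \<subseteq> visited {..<n} Ls" and "length Ls \<le> l"
    unfolding loopable_def by blast
  then have len: "real (length Ls) \<le> 6153 / real n * ?\<Sigma>"
    using l(2) by linarith
  \<comment> \<open>A visited set guarantees a layer, and with it a stage that can hold the
    uncontrolled factors.\<close>
  have "{0} \<in> (small_subsets n k)"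
    using n k by simp
  then have "{0} \<in> visited {..<n} Ls"
    using visits by blast
  then obtain i where "0 < i" "i \<le> length Ls"
    unfolding visited_def by blast
  then have "Ls \<noteq> []"
    by auto
  interpret S: phase_schedule G "parity_schedule Ls" n "length Ls"
    by unfold_locales
  from rUCG_realizable[OF M \<open>Ls \<noteq> []\<close> visits] obtain v where "(\<forall>i q. v i q \<in> \<U>) \<and>
    M = diag_block n m (\<lambda>c. S.phase v {q. bit c q})" ..
  then have v: "\<And>i q. v i q \<in> \<U>" and Mv: "M = diag_block n m (\<lambda>c. S.phase v {q. bit c q})"
    by simp_all
  \<comment> \<open>\<open>Suc s\<close> doublings are enough for \<open>n\<close> copies, while
    \<open>s\<close> itself is at most \<open>log 2 n\<close>.\<close>
  obtain s where s: "2 ^ s \<le> n" "n < 2 * 2 ^ s"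
    using power_of_two_below[of n] n by auto
  let ?a = "(n - 1) * m"
  have "\<forall>i. \<exists>T. layered (n + m + ?a) T \<and> (\<forall>g\<in>set (concat T). unit_gate n m ?a \<U> A g) \<and>
      implements (n + m) ?a T (stage_op n m (v i)) \<and> length T = 2 * Suc s + 4"
    using ex_stage_circuit[OF A v mem_carrier _ _ m, of n "Suc s"] n s by auto
  from choice[OF this] obtain T where "\<forall>i. layered (n + m + ?a) (T i) \<and>
      (\<forall>g\<in>set (concat (T i)). unit_gate n m ?a \<U> A g) \<and>
      implements (n + m) ?a (T i) (stage_op n m (v i)) \<and> length (T i) = 2 * Suc s + 4" ..
  then have T: "\<And>i. layered (n + m + ?a) (T i)" "\<And>i. \<forall>g\<in>set (concat (T i)). unit_gate n m ?a \<U> A g"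
    "\<And>i. implements (n + m) ?a (T i) (stage_op n m (v i))" "\<And>i. length (T i) = 2 * Suc s + 4"
    by blast+
  let ?bs = "map (\<lambda>i. ([map cnot_gate (Ls ! i)], T i)) [0..<length Ls]"
  have layers: "cnot_layers {..<n} Ls"
    using Ls by (simp add: loop_def)
  have "alternating n m ?a \<U> A ?bs"
    unfolding alternating_def
  proof clarify
    fix S T' assume "(S, T') \<in> set ?bs"
    then obtain i where i: "i < length Ls" "S = [map cnot_gate (Ls ! i)]" "T' = T i"
      by auto
    have "cnots_on {..<n} (Ls ! i)" "disjoint_gates (map cnot_gate (Ls ! i))"
      using layers i(1) unfolding disjoint_gates_cnots cnot_layers_def by auto
    then have "layered n S" "\<forall>g\<in>set (concat S). cnot_on {..<n} g"
      unfolding layered_iff i(2) cnots_on_def cnot_on_def by fastforce+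
    then show "layered n S \<and> (\<forall>g\<in>set (concat S). cnot_on {..<n} g) \<and> layered (n + m + ?a) T' \<and>
        (\<forall>g\<in>set (concat T'). unit_gate n m ?a \<U> A g) \<and> (\<exists>M. CU_operator n m \<U> M \<and> implements (n + m) ?a T' M)"
      using T(1-3)[of i] stage_op_CU_operator[of "v i"] v unfolding i(3) by blast
  qed
  moreover have "implements (n + m) ?a (flat_circuit ?bs) M"
  proof -
    have "fold cnot_act (concat Ls) c = c" for c
      using Ls by (intro bit_eqI) (simp add: bit_run_cnots(1) loop_def)
    then have "M = block_op n m (fold cnot_act (concat (take (length Ls) Ls)))
        (\<lambda>c. finprod G (\<lambda>i. S.stage_phase i (v i) {q. bit c q}) {..<length Ls})"
      unfolding Mv S.phase_def by (intro block_op_cong) simp_all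
    then show ?thesis
      unfolding implements_iff using schedule_implements[OF layers v T(3), of "length Ls"] by simp
  qed
  moreover have D: "D_CNOT ?bs = length Ls" "D_CU ?bs = length Ls * (2 * Suc s + 4)"
    unfolding D_CNOT_def D_CU_def by (simp_all add: comp_def T(4) sum_list_triv)
  moreover have "0 \<le> ?\<Sigma>"
    by (intro sum_nonneg) simp
  moreover have "real (length Ls) \<le> 49224 / real n * ?\<Sigma>"
  proof -
    have "6153 / real n * ?\<Sigma> \<le> 49224 / real n * ?\<Sigma>"
      using \<open>0 \<le> ?\<Sigma>\<close> by (intro mult_right_mono divide_right_mono) auto
    then show ?thesis
      using len by linarith
  qed
  \<comment> \<open>\<open>49224 = 8 * 6153\<close>: a stage has depth \<open>2 * s + 6\<close>, at
    most \<open>8 * log 2 n\<close> because both \<open>s\<close> and 1 are at most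
    \<open>log 2 n\<close>.\<close>
  moreover have "real (length Ls * (2 * Suc s + 4)) \<le> 49224 * log 2 (real n) / real n * ?\<Sigma>"
  proof -
    have "real s \<le> log 2 (real n)"
      using s(1) by (rule le_log2_of_power)
    moreover have "1 \<le> log 2 (real n)"
      using n by (simp add: le_log_iff)
    ultimately have "real (2 * Suc s + 4) \<le> 8 * log 2 (real n)"
      by simp
    then have "real (length Ls) * real (2 * Suc s + 4) \<le> (6153 / real n * ?\<Sigma>) * (8 * log 2 (real n))"
      using len \<open>0 \<le> ?\<Sigma>\<close> by (intro mult_mono) auto
    then show ?thesis
      by (simp add: algebra_simps)
  qed
  moreover have "real ?a \<le> 49224 * real (m * n)"
  proof -
    have "?a \<le> 49224 * (m * n)"
      by (cases n) (auto simp: algebra_simps)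
    then show ?thesis
      by (metis of_nat_le_iff of_nat_mult of_nat_numeral)
  qed
  ultimately show ?thesis
    by (intro exI[of _ ?a] exI[of _ ?bs]) (simp only: D simp_thms)
qed

end

theorem theorem9:
  shows "\<exists>C :: real. \<forall>(m :: nat) \<U>. m \<ge> 1 \<and> target_family m \<U> \<longrightarrow>
    (\<exists>A. diagonalizes m A \<U> \<and>
      (\<forall>(n :: nat) (k :: nat) M. n \<ge> 2 \<and> 1 \<le> k \<and> k \<le> n \<and> rUCG n k m \<U> M \<longrightarrow>
        (\<exists>(a :: nat) bs. alternating n m a \<U> A bs \<and> implements (n + m) a (flat_circuit bs) M \<and>
           real (D_CNOT bs) \<le> C / real n * (\<Sum>i = 0..k. real (n choose i)) \<and>
           real (D_CU bs) \<le> C * log 2 (real n) / real n * (\<Sum>i = 0..k. real (n choose i)) \<and>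
           real a \<le> C * real (m * n))))"
proof (intro exI[of _ 49224] allI impI, goal_cases)
  case (1 m \<U>)
  then interpret unitary_family m \<U>
    by unfold_locales blast
  \<comment> \<open>The diagonalizing unitary depends on the family alone, so it is available before
    \<open>n\<close>, \<open>k\<close> and \<open>M\<close> are fixed.\<close>
  obtain A where A: "diagonalizes m A \<U>"
    using ex_diagonalizing by blast
  then show ?case
    using ex_alternating_circuit[OF A] 1 by blast
qed

end
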